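(* Consider the continuous piecewise quadratic family $$\dot x=-y+d\,x+l\,x^2+m_jxy+n_jy^2,\qquad \dot y=x(1-y),\qquad \text{if } (-1)^jy<0,\quad j=1,2,$$ with real parameters $(d,l,m_1,m_2,n_1,n_2)$. The maximal weak-focus order of the origin in this family is $4$. This maximal order is attained when the parameters lie on $$\mathcal T^c=\{d=2l+n_1+n_2=m_1-m_2=0,\ \ m_2(n_1-n_2)(n_1+n_2-1)\neq0\}.$$ Additionally, the weak-foci on $\mathcal T^c$ unfold $3$ crossing limit cycles of small amplitude bifurcating from the origin, multiplicities taken into account, when perturbing inside this family.
   Context: Here $j=1$ on $\{y>0\}$ and $j=2$ on $\{y<0\}$. When $|d|<2$, orbits near the origin turn counterclockwise around it. Let $\Pi_1$ be the half-return map from the positive to the negative $x$-half-axis through $y>0$, and $\Pi_2$ the half-return map from the negative to the positive $x$-half-axis through $y<0$, points being parametrized by their distance $r_0$ to the origin. The displacement map is $\Delta(r_0)=\Pi_2^{-1}(r_0)-\Pi_1(r_0)=\sum_{k\ge1}W_kr_0^k$. Weak-focus order: for $d=0$ (then $W_1=0$), the origin is a weak-focus of order $\ell$ if $W_k=0$ for $1\le k\le \ell-1$ and $W_\ell\ne0$. A crossing limit cycle is an isolated periodic orbit meeting $\{y=0\}$ only at points where both vector fields are transversal to this line and point to the same side. Those near and surrounding the origin correspond to isolated positive zeros of $\Delta$, and the multiplicity of a limit cycle is the multiplicity of the zero. A parameter value $\lambda_0$ "unfolds $k$ limit cycles of small amplitude bifurcating from the origin, multiplicities taken into account" if for every neighborhood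 $U$ of the origin and every neighborhood $V$ of $\lambda_0$ in the parameter space of the family there is $\lambda\in V$ for which the system has $k$ crossing limit cycles in $U$ surrounding the origin, counted with multiplicity. *)

theory Defs
  imports "HOL-Analysis.Analysis"
begin

section \<open>The piecewise quadratic family\<close>

text \<open>Parameters are tuples \<open>(d, l, m\<^sub>1, m\<^sub>2, n\<^sub>1, n\<^sub>2)\<close>, with the Euclidean topology.\<close>

type_synonym params = "real \<times> real \<times> real \<times> real \<times> real \<times> real"

fun quad_field :: "real \<Rightarrow> real \<Rightarrow> real \<Rightarrow> real \<Rightarrow> real \<times> real \<Rightarrow> real \<times> real" where
  "quad_field d l m n (x, y) = (- y + d * x + l * x\<^sup>2 + m * x * y + n * y\<^sup>2, x * (1 - y))"

fun upper_field :: "params \<Rightarrow> real \<times> real \<Rightarrow> real \<times> real" where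
  "upper_field (d, l, m1, m2, n1, n2) = quad_field d l m1 n1"

fun lower_field :: "params \<Rightarrow> real \<times> real \<Rightarrow> real \<times> real" where
  "lower_field (d, l, m1, m2, n1, n2) = quad_field d l m2 n2"

text \<open>The two fields agree on the line \<open>y = 0\<close>, so its assignment to the second branch is only
  the continuous extension.\<close>

definition pw_field :: "params \<Rightarrow> real \<times> real \<Rightarrow> real \<times> real" where
  "pw_field p z = (if snd z > 0 then upper_field p z else lower_field p z)"

lemma upper_field_eq_lower_field:
  assumes "snd z = 0"
  shows "upper_field p z = lower_field p z"
  using assms by (cases p; cases z) auto

section \<open>Half-return maps and displacement map\<close>

text \<open>The field \<open>X\<close> has an orbit arc from \<open>a\<close> to \<open>b\<close> whose interior lies in \<open>S\<close>.\<close>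

definition orbit_arc ::
  "(real \<times> real \<Rightarrow> real \<times> real) \<Rightarrow> (real \<times> real) set \<Rightarrow> real \<times> real \<Rightarrow> real \<times> real \<Rightarrow> bool" where
  "orbit_arc X S a b \<longleftrightarrow>
     (\<exists>T>0. \<exists>\<gamma>. \<gamma> 0 = a \<and> \<gamma> T = b \<and>
        (\<forall>t\<in>{0..T}. (\<gamma> has_vector_derivative X (\<gamma> t)) (at t within {0..T})) \<and>
        (\<forall>t\<in>{0<..<T}. \<gamma> t \<in> S))"

text \<open>Graphs of the half-return maps \<open>\<Pi>\<^sub>1\<close> and \<open>\<Pi>\<^sub>2\<close>: the second distance is the image of the first.\<close>

definition half_return1 :: "params \<Rightarrow> real \<Rightarrow> real \<Rightarrow> bool" where
  "half_return1 p r s \<longleftrightarrow> r > 0 \<and> s > 0 \<and> orbit_arc (upper_field p) {z. snd z > 0} (r, 0) (- s, 0)"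

definition half_return2 :: "params \<Rightarrow> real \<Rightarrow> real \<Rightarrow> bool" where
  "half_return2 p s r \<longleftrightarrow> s > 0 \<and> r > 0 \<and> orbit_arc (lower_field p) {z. snd z < 0} (- s, 0) (r, 0)"

definition Pi1 :: "params \<Rightarrow> real \<Rightarrow> real" where
  "Pi1 p r = (THE s. half_return1 p r s)"

definition Pi2_inv :: "params \<Rightarrow> real \<Rightarrow> real" where
  "Pi2_inv p r = (THE s. half_return2 p s r)"

definition displacement_defined :: "params \<Rightarrow> real \<Rightarrow> bool" where
  "displacement_defined p r \<longleftrightarrow> (\<exists>s. half_return1 p r s) \<and> (\<exists>s. half_return2 p s r)"

definition displacement :: "params \<Rightarrow> real \<Rightarrow> real" where
  "displacement p r = Pi2_inv p r - Pi1 p r"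

section \<open>Weak-focus order\<close>

text \<open>\<open>\<Delta>(r) = \<Sum>\<^bsub>k\<ge>1\<^esub> W\<^sub>k r\<^sup>k\<close> for all small \<open>r > 0\<close>; this determines every \<open>W k\<close>.\<close>

definition displacement_series :: "params \<Rightarrow> (nat \<Rightarrow> real) \<Rightarrow> bool" where
  "displacement_series p W \<longleftrightarrow> W 0 = 0 \<and>
     (\<exists>\<epsilon>>0. \<forall>r\<in>{0<..<\<epsilon>}. displacement_defined p r \<and> (\<lambda>k. W k * r ^ k) sums displacement p r)"

definition weak_focus_of_order :: "params \<Rightarrow> nat \<Rightarrow> bool" where
  "weak_focus_of_order p q \<longleftrightarrow> fst p = 0 \<and>
     (\<exists>W. displacement_series p W \<and> (\<forall>k. 1 \<le> k \<and> k < q \<longrightarrow> W k = 0) \<and> W q \<noteq> 0)"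

section \<open>Crossing limit cycles and unfoldings\<close>

definition periodic_orbit :: "params \<Rightarrow> (real \<times> real) set \<Rightarrow> bool" where
  "periodic_orbit p \<Gamma> \<longleftrightarrow>
     (\<exists>\<gamma> T. T > 0 \<and> (\<forall>t. (\<gamma> has_vector_derivative pw_field p (\<gamma> t)) (at t)) \<and>
        (\<forall>t. \<gamma> (t + T) = \<gamma> t) \<and> (\<exists>t. \<gamma> t \<noteq> \<gamma> 0) \<and> \<Gamma> = range \<gamma>)"

text \<open>A positive product of the vertical components says that both fields are transversal to
  \<open>y = 0\<close> and point to the same side.\<close>

definition crossing_limit_cycle :: "params \<Rightarrow> (real \<times> real) set \<Rightarrow> bool" where
  "crossing_limit_cycle p \<Gamma> \<longleftrightarrow> periodic_orbit p \<Gamma> \<and>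
     (\<exists>N. open N \<and> \<Gamma> \<subseteq> N \<and> (\<forall>\<Gamma>'. periodic_orbit p \<Gamma>' \<and> \<Gamma>' \<subseteq> N \<longrightarrow> \<Gamma>' = \<Gamma>)) \<and>
     (\<forall>z\<in>\<Gamma>. snd z = 0 \<longrightarrow> snd (upper_field p z) * snd (lower_field p z) > 0)"

text \<open>\<open>r\<close> is a zero of multiplicity \<open>\<mu>\<close> if \<open>\<Delta>(\<rho>) = (\<rho> - r)\<^sup>\<mu> g(\<rho>)\<close> near \<open>r\<close>, where \<open>g\<close> has a nonzero
  limit at \<open>r\<close>.\<close>

definition displacement_zero_mult :: "params \<Rightarrow> real \<Rightarrow> nat \<Rightarrow> bool" where
  "displacement_zero_mult p r \<mu> \<longleftrightarrow> \<mu> \<ge> 1 \<and> displacement p r = 0 \<and>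
     (\<forall>\<^sub>F \<rho> in nhds r. displacement_defined p \<rho>) \<and>
     (\<exists>c. c \<noteq> 0 \<and> ((\<lambda>\<rho>. displacement p \<rho> / (\<rho> - r) ^ \<mu>) \<longlongrightarrow> c) (at r))"

definition cycle_mult :: "params \<Rightarrow> (real \<times> real) set \<Rightarrow> nat \<Rightarrow> bool" where
  "cycle_mult p \<Gamma> \<mu> \<longleftrightarrow> (\<exists>r>0. (r, 0) \<in> \<Gamma> \<and> displacement_zero_mult p r \<mu>)"

text \<open>The cycles in \<open>C\<close> need not exhaust those inside \<open>U\<close>: a large \<open>U\<close> may contain further ones.\<close>

definition has_cycles_in :: "params \<Rightarrow> (real \<times> real) set \<Rightarrow> nat \<Rightarrow> bool" where
  "has_cycles_in p U k \<longleftrightarrow>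
     (\<exists>C \<mu>. finite C \<and>
        (\<forall>\<Gamma>\<in>C. crossing_limit_cycle p \<Gamma> \<and> \<Gamma> \<subseteq> U \<and> (0, 0) \<in> inside \<Gamma> \<and> cycle_mult p \<Gamma> (\<mu> \<Gamma>)) \<and>
        (\<Sum>\<Gamma>\<in>C. \<mu> \<Gamma>) = k)"

definition unfolds_cycles :: "params \<Rightarrow> nat \<Rightarrow> bool" where
  "unfolds_cycles p k \<longleftrightarrow>
     (\<forall>U V. open U \<and> (0, 0) \<in> U \<and> open V \<and> p \<in> V \<longrightarrow> (\<exists>q\<in>V. has_cycles_in q U k))"

definition Tc :: "params set" where
  "Tc = {(d, l, m1, m2, n1, n2). d = 0 \<and> 2 * l + n1 + n2 = 0 \<and> m1 - m2 = 0 \<and>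
           m2 * (n1 - n2) * (n1 + n2 - 1) \<noteq> 0}"

end

theory Submission
  imports Defs "HOL-Complex_Analysis.Complex_Analysis"
begin

text \<open>Reflecting the lower half plane and reversing time there turns both half-return maps into maps
  through \<open>y > 0\<close> of one five-parameter family of half systems. In polar coordinates Cherkas' substitution
  reduces a half system to an Abel equation \<open>w' = a\<^sub>1 w + a\<^sub>2 w\<^sup>2 + a\<^sub>3 w\<^sup>3\<close> on \<open>[0, \<pi>]\<close> with \<open>w = r\<close> on the \<open>x\<close>-axis. Writing
  \<open>w = \<rho> W\<close>, Picard iteration with complex \<open>\<rho>\<close> shows that \<open>W(\<pi>)\<close> is holomorphic in \<open>\<rho>\<close> and depends
  continuously on the parameters.

  For \<open>d = 0\<close> one has \<open>1/W(\<pi>) = 1 - \<rho> \<alpha>(\<pi>) - \<rho>\<^sup>2 \<integral> a\<^sub>3 W\<close> with \<open>\<alpha> = \<integral> a\<^sub>2\<close> and \<open>W = 1 + \<rho> \<alpha> + O(\<rho>\<^sup>2)\<close>. Hence,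
  each under the vanishing of the previous ones, \<open>W\<^sub>2\<close>, \<open>W\<^sub>3\<close>, \<open>W\<^sub>4\<close> are nonzero multiples of
  \<open>m\<^sub>1 - m\<^sub>2\<close>, \<open>m\<^sub>2 (2 l + n\<^sub>1 + n\<^sub>2)\<close>, \<open>m\<^sub>2 (n\<^sub>1 - n\<^sub>2) (n\<^sub>1 + n\<^sub>2 - 1)\<close>. When all three vanish the origin is a
  center: reversible if \<open>m\<^sub>1 = m\<^sub>2 = 0\<close>, reducible to a linear system if \<open>n\<^sub>1 = n\<^sub>2 = - l\<close>, and symmetric under
  a projective involution if \<open>n\<^sub>1 + n\<^sub>2 = 1\<close>.

  On \<open>Tc\<close>, perturbing \<open>l\<close>, then \<open>m\<^sub>1\<close>, then \<open>d\<close> creates three sign changes of \<open>\<Delta>(\<rho>)/\<rho>\<close>. Its third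
  derivative stays nonzero near \<open>0\<close>, so by Rolle's theorem the three zeros are simple.\<close>

section \<open>Polynomials in a complex parameter\<close>

text \<open>A complex rho serves two ends. It makes the displacement series converge, and Cauchy's
  inequality turns uniform closeness of \<open>disp_quot\<close> under a change of parameters into
  closeness of its third derivative, so differentiability in the parameters never has to be
  discussed. The linear coefficient \<open>a\<close> gets no such factor and must be small by
  itself: this is the origin of the bound 1/64 on the trace parameter d, while the other parameters
  are compensated by shrinking the radius. Focal values are computed from 1/W because division by
  W^2 turns the quadratic term of the Abel equation into one that integrates explicitly. On the
  geometric side the obstacle is that a limit cycle must be isolated among all periodic orbits in a
  neighbourhood, not only among those already known to be zeros of the displacement. Rotation around
  the origin brings any competitor to the positive axis, and its outermost crossing there turns out
  to be such a zero.\<close>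

definition abel_rhs :: "(real \<Rightarrow> real) \<Rightarrow> (real \<Rightarrow> real) \<Rightarrow> (real \<Rightarrow> real) \<Rightarrow> real \<Rightarrow> complex \<Rightarrow> complex \<Rightarrow> complex" where
  "abel_rhs a b c t \<rho> w = of_real (a t) * w + of_real (b t) * \<rho> * w\<^sup>2 + of_real (c t) * \<rho>\<^sup>2 * w ^ 3"

primrec abel_iter :: "(real \<Rightarrow> real) \<Rightarrow> (real \<Rightarrow> real) \<Rightarrow> (real \<Rightarrow> real) \<Rightarrow> nat \<Rightarrow> real \<Rightarrow> complex \<Rightarrow> complex" where
  "abel_iter a b c 0 = (\<lambda>t \<rho>. 1)"
| "abel_iter a b c (Suc n) =
     (\<lambda>t \<rho>. 1 + integral {0..t} (\<lambda>u. abel_rhs a b c u \<rho> (abel_iter a b c n u \<rho>)))"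

definition abel_sol :: "(real \<Rightarrow> real) \<Rightarrow> (real \<Rightarrow> real) \<Rightarrow> (real \<Rightarrow> real) \<Rightarrow> real \<Rightarrow> complex \<Rightarrow> complex" where
  "abel_sol a b c t \<rho> = lim (\<lambda>n. abel_iter a b c n t \<rho>)"

text \<open>The common degree bound and the continuity of the coefficients are what survives
  integration in \<open>t\<close>, coefficient by coefficient. Membership of the Picard iterates
  then gives holomorphy in \<open>\<rho>\<close> with no differentiation under the integral
  sign.\<close>

definition poly_param :: "(real \<Rightarrow> complex \<Rightarrow> complex) \<Rightarrow> bool" where
  "poly_param F \<longleftrightarrow> (\<exists>Q K. (\<forall>t. degree (Q t) \<le> K) \<and> (\<forall>k. continuous_on {0..pi} (\<lambda>t. coeff (Q t) k)) \<and>
      (\<forall>t\<in>{0..pi}. \<forall>\<rho>. F t \<rho> = poly (Q t) \<rho>))"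

lemma poly_param_const:
  assumes "continuous_on {0..pi} f"
  shows "poly_param (\<lambda>t \<rho>. f t)"
proof -
  have "continuous_on {0..pi} (\<lambda>t. coeff [:f t:] k)" for k
    using assms by (cases k) simp_all
  then show ?thesis
    unfolding poly_param_def by (intro exI[of _ "\<lambda>t. [:f t:]"] exI[of _ 0]) simp
qed

lemma poly_param_var: "poly_param (\<lambda>t \<rho>. \<rho>)"
  unfolding poly_param_def
  by (rule exI[of _ "\<lambda>t. [:0, 1:]"], rule exI[of _ 1]) auto

lemma poly_eq_sum_coeff: "degree (p :: complex poly) \<le> K \<Longrightarrow> poly p x = (\<Sum>k\<le>K. coeff p k * x ^ k)"
  unfolding poly_altdef by (rule sum.mono_neutral_left) (auto simp: coeff_eq_0)

lemma poly_param_add: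
  assumes "poly_param F" "poly_param G"
  shows "poly_param (\<lambda>t \<rho>. F t \<rho> + G t \<rho>)"
proof -
  obtain P K where P: "\<forall>t. degree (P t) \<le> K" "\<forall>k. continuous_on {0..pi} (\<lambda>t. coeff (P t) k)"
      "\<forall>t\<in>{0..pi}. \<forall>\<rho>. F t \<rho> = poly (P t) \<rho>"
    using assms(1) unfolding poly_param_def by blast
  obtain Q L where Q: "\<forall>t. degree (Q t) \<le> L" "\<forall>k. continuous_on {0..pi} (\<lambda>t. coeff (Q t) k)"
      "\<forall>t\<in>{0..pi}. \<forall>\<rho>. G t \<rho> = poly (Q t) \<rho>"
    using assms(2) unfolding poly_param_def by blast
  have "degree (P t + Q t) \<le> max K L" for t
    using P(1) Q(1) by (meson degree_add_le_max le_trans max.mono)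
  then show ?thesis
    unfolding poly_param_def using P Q
    by (intro exI[of _ "\<lambda>t. P t + Q t"] exI[of _ "max K L"]) (auto intro: continuous_on_add)
qed

lemma poly_param_mult:
  assumes "poly_param F" "poly_param G"
  shows "poly_param (\<lambda>t \<rho>. F t \<rho> * G t \<rho>)"
proof -
  obtain P K where P: "\<forall>t. degree (P t) \<le> K" "\<forall>k. continuous_on {0..pi} (\<lambda>t. coeff (P t) k)"
      "\<forall>t\<in>{0..pi}. \<forall>\<rho>. F t \<rho> = poly (P t) \<rho>"
    using assms(1) unfolding poly_param_def by blast
  obtain Q L where Q: "\<forall>t. degree (Q t) \<le> L" "\<forall>k. continuous_on {0..pi} (\<lambda>t. coeff (Q t) k)"
      "\<forall>t\<in>{0..pi}. \<forall>\<rho>. G t \<rho> = poly (Q t) \<rho>"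
    using assms(2) unfolding poly_param_def by blast
  have "degree (P t * Q t) \<le> K + L" for t
    using P(1) Q(1) by (meson degree_mult_le le_trans add_mono)
  then show ?thesis
    unfolding poly_param_def using P Q
    by (intro exI[of _ "\<lambda>t. P t * Q t"] exI[of _ "K + L"])
       (auto simp: coeff_mult intro!: continuous_intros)
qed

lemma poly_param_power: "poly_param F \<Longrightarrow> poly_param (\<lambda>t \<rho>. F t \<rho> ^ n)"
  by (induction n) (auto intro: poly_param_mult poly_param_const)

lemma poly_param_continuous:
  assumes "poly_param F"
  shows "continuous_on {0..pi} (\<lambda>t. F t \<rho>)"
proof -
  obtain P K where P: "\<forall>t. degree (P t) \<le> K" "\<forall>k. continuous_on {0..pi} (\<lambda>t. coeff (P t) k)"
      "\<forall>t\<in>{0..pi}. \<forall>\<rho>. F t \<rho> = poly (P t) \<rho>"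
    using assms(1) unfolding poly_param_def by blast
  have "continuous_on {0..pi} (\<lambda>t. \<Sum>k\<le>K. coeff (P t) k * \<rho> ^ k)"
    using P(2) by (intro continuous_intros) auto
  moreover have "F t \<rho> = (\<Sum>k\<le>K. coeff (P t) k * \<rho> ^ k)" if "t \<in> {0..pi}" for t
    using P(3) that poly_eq_sum_coeff[of "P t" K] P(1) by auto
  ultimately show ?thesis
    by (metis (no_types, lifting) continuous_on_cong)
qed

lemma poly_param_holomorphic:
  assumes "poly_param F" "t \<in> {0..pi}"
  shows "(\<lambda>\<rho>. F t \<rho>) holomorphic_on S"
proof -
  obtain P where "\<forall>t\<in>{0..pi}. \<forall>\<rho>. F t \<rho> = poly (P t) \<rho>"
    using assms(1) unfolding poly_param_def by blast
  then have "(\<lambda>\<rho>. F t \<rho>) = poly (P t)" using assms(2) by auto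
  then show ?thesis by (simp add: holomorphic_intros)
qed

text \<open>The bound \<open>K\<close> on the degree is the same for all \<open>u\<close>, so the
  integrand is a fixed finite sum of monomials and the integral can be moved onto its
  coefficients.\<close>

lemma poly_param_integral:
  assumes "poly_param F"
  shows "poly_param (\<lambda>t \<rho>. integral {0..t} (\<lambda>u. F u \<rho>))"
proof -
  obtain P K where P: "\<forall>t. degree (P t) \<le> K" "\<forall>k. continuous_on {0..pi} (\<lambda>t. coeff (P t) k)"
      "\<forall>t\<in>{0..pi}. \<forall>\<rho>. F t \<rho> = poly (P t) \<rho>"
    using assms(1) unfolding poly_param_def by blast
  define Q where "Q t = (\<Sum>k\<le>K. monom (integral {0..t} (\<lambda>u. coeff (P u) k)) k)" for t
  have "degree (Q t) \<le> K" for t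
    unfolding Q_def by (rule degree_sum_le) (auto intro: order_trans[OF degree_monom_le])
  moreover have "continuous_on {0..pi} (\<lambda>t. coeff (Q t) k)" for k
  proof -
    have "continuous_on {0..pi} (\<lambda>t. integral {0..t} (\<lambda>u. coeff (P u) k))" for k
      using P(2) by (intro indefinite_integral_continuous_1 integrable_continuous_real) auto
    then show ?thesis
      unfolding Q_def by (cases "k \<le> K") (auto simp: coeff_sum)
  qed
  moreover have "integral {0..t} (\<lambda>u. F u \<rho>) = poly (Q t) \<rho>" if t: "t \<in> {0..pi}" for t \<rho>
  proof -
    have i: "(\<lambda>u. coeff (P u) k) integrable_on {0..t}" for k
      using P(2) t by (intro integrable_continuous_real) (auto intro: continuous_on_subset)
    have "integral {0..t} (\<lambda>u. F u \<rho>) = integral {0..t} (\<lambda>u. \<Sum>k\<le>K. coeff (P u) k * \<rho> ^ k)"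
      using P(3) t P(1) by (intro integral_cong) (auto simp: poly_eq_sum_coeff)
    also have "\<dots> = (\<Sum>k\<le>K. integral {0..t} (\<lambda>u. coeff (P u) k * \<rho> ^ k))"
      using i by (intro integral_sum) (auto intro!: integrable_on_mult_left)
    also have "\<dots> = (\<Sum>k\<le>K. integral {0..t} (\<lambda>u. coeff (P u) k) * \<rho> ^ k)"
      by (simp add: integral_mult_left)
    finally show ?thesis by (simp add: Q_def poly_sum poly_monom)
  qed
  ultimately show ?thesis unfolding poly_param_def by blast
qed

section \<open>Abel equations with a small complex parameter\<close>

text \<open>The bound 1/8 times the interval length \<open>pi\<close> < 4 is below 1/2, so the
  integral operator maps the disc of radius 1/2 about 1 into itself. On that disc |w| <= 3/2, and M
  |rho| <= 1/100 keeps the nonlinear terms minor beside the bound for the linear one.\<close>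

lemma abel_rhs_bound:
  assumes "\<bar>a t\<bar> \<le> 1/16" "\<bar>b t\<bar> \<le> M" "\<bar>c t\<bar> \<le> M" "M \<ge> 1" "norm \<rho> \<le> 1 / (100 * M)"
    and w: "norm (w - 1) \<le> 1/2"
  shows "norm (abel_rhs a b c t \<rho> w) \<le> 1/8"
proof -
  have nw: "norm w \<le> 3/2"
    using norm_triangle_ineq[of "w - 1" 1] w by simp
  have Mr: "M * norm \<rho> \<le> 1/100"
    using assms(4,5) by (simp add: field_simps)
  have r1: "norm \<rho> \<le> 1/100"
    using Mr mult_right_mono[OF assms(4) norm_ge_zero[of \<rho>]] by linarith
  have 1: "norm (of_real (a t) * w) \<le> 1/16 * (3/2)"
    unfolding norm_mult using assms(1) nw by (intro mult_mono) auto
  have w2: "norm w ^ 2 \<le> (3/2)^2" and w3: "norm w ^ 3 \<le> (3/2)^3"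
    using nw by (intro power_mono; simp)+
  have br: "\<bar>b t\<bar> * norm \<rho> \<le> 1/100" and cr: "\<bar>c t\<bar> * norm \<rho> \<le> 1/100"
    using mult_right_mono[OF assms(2), of "norm \<rho>"] mult_right_mono[OF assms(3), of "norm \<rho>"] Mr by auto
  have 2: "norm (of_real (b t) * \<rho> * w\<^sup>2) \<le> 1/100 * (3/2)^2"
    unfolding norm_mult norm_power norm_of_real using br w2 by (intro mult_mono) auto
  have "\<bar>c t\<bar> * norm \<rho> ^ 2 \<le> 1/100 * (1/100)"
    using mult_mono[OF cr r1] by (simp add: power2_eq_square mult.assoc)
  then have 3: "norm (of_real (c t) * \<rho>\<^sup>2 * w ^ 3) \<le> 1/100 * (1/100) * (3/2)^3"
    unfolding norm_mult norm_power norm_of_real by (rule mult_mono) (use w3 in auto)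
  have "norm (abel_rhs a b c t \<rho> w) \<le> 1/16 * (3/2) + 1/100 * (3/2)^2 + 1/100 * (1/100) * (3/2)^3"
    unfolding abel_rhs_def using 1 2 3 by (intro order_trans[OF norm_triangle_ineq] add_mono)
  then show ?thesis by (simp add: power2_eq_square power3_eq_cube)
qed

text \<open>A Lipschitz constant 1/8 over a length below 4 makes the Picard map a contraction with
  factor 1/2.\<close>

lemma abel_rhs_diff:
  assumes "\<bar>a t\<bar> \<le> 1/16" "\<bar>b t\<bar> \<le> M" "\<bar>c t\<bar> \<le> M" "M \<ge> 1" "norm \<rho> \<le> 1 / (100 * M)"
    and v: "norm (v - 1) \<le> 1/2" and w: "norm (w - 1) \<le> 1/2"
  shows "norm (abel_rhs a b c t \<rho> v - abel_rhs a b c t \<rho> w) \<le> norm (v - w) / 8"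
proof -
  have nw: "norm w \<le> 3/2" "norm v \<le> 3/2"
    using norm_triangle_ineq[of "w - 1" 1] w norm_triangle_ineq[of "v - 1" 1] v by simp_all
  have Mr: "M * norm \<rho> \<le> 1/100"
    using assms(4,5) by (simp add: field_simps)
  have r1: "norm \<rho> \<le> 1/100"
    using Mr mult_right_mono[OF assms(4) norm_ge_zero[of \<rho>]] by linarith
  have br: "\<bar>b t\<bar> * norm \<rho> \<le> 1/100" and cr: "\<bar>c t\<bar> * norm \<rho> \<le> 1/100"
    using mult_right_mono[OF assms(2), of "norm \<rho>"] mult_right_mono[OF assms(3), of "norm \<rho>"] Mr by auto
  have w2: "norm (v + w) \<le> 3"
    using nw norm_triangle_ineq[of v w] by linarith
  have sq: "norm v ^ 2 \<le> (3/2)^2" "norm w ^ 2 \<le> (3/2)^2" "norm v * norm w \<le> 3/2 * (3/2)"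
    using nw by (auto intro!: power_mono) (use mult_mono[OF nw(2) nw(1)] in auto)
  have w3: "norm (v\<^sup>2 + v * w + w\<^sup>2) \<le> 27/4"
    using norm_triangle_ineq[of "v\<^sup>2 + v * w" "w\<^sup>2"] norm_triangle_ineq[of "v\<^sup>2" "v * w"] sq
    by (simp add: norm_power norm_mult power2_eq_square)
  have 2: "norm (of_real (b t) * \<rho> * (v + w)) \<le> 1/100 * 3"
    unfolding norm_mult norm_of_real using br w2 by (intro mult_mono) auto
  have "\<bar>c t\<bar> * norm \<rho> ^ 2 \<le> 1/100 * (1/100)"
    using mult_mono[OF cr r1] by (simp add: power2_eq_square mult.assoc)
  then have 3: "norm (of_real (c t) * \<rho>\<^sup>2 * (v\<^sup>2 + v * w + w\<^sup>2)) \<le> 1/100 * (1/100) * (27/4)"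
    unfolding norm_mult norm_power norm_of_real by (rule mult_mono) (use w3 in auto)
  \<comment> \<open>The divided difference of \<open>abel_rhs\<close> in its last argument: the
    common factor v - w has been taken out of v^2 - w^2 and v^3 - w^3.\<close>
  define F where "F = of_real (a t) + of_real (b t) * \<rho> * (v + w) + of_real (c t) * \<rho>\<^sup>2 * (v\<^sup>2 + v * w + w\<^sup>2)"
  have "norm F \<le> 1/16 + 1/100 * 3 + 1/100 * (1/100) * (27/4)"
    unfolding F_def using assms(1) 2 3 by (intro order_trans[OF norm_triangle_ineq] add_mono) auto
  then have F: "norm F \<le> 1/8" by simp
  have "abel_rhs a b c t \<rho> v - abel_rhs a b c t \<rho> w = F * (v - w)"
    unfolding abel_rhs_def F_def by (simp add: algebra_simps power2_eq_square power3_eq_cube)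
  then show ?thesis
    using mult_right_mono[OF F norm_ge_zero[of "v - w"]] by (simp add: norm_mult)
qed

section \<open>Picard iteration for the Abel equation\<close>

locale abel =
  fixes a b c :: "real \<Rightarrow> real" and M :: real
  assumes cont: "continuous_on {0..pi} a" "continuous_on {0..pi} b" "continuous_on {0..pi} c"
    and bounds: "\<And>t. t \<in> {0..pi} \<Longrightarrow> \<bar>a t\<bar> \<le> 1/16" "\<And>t. t \<in> {0..pi} \<Longrightarrow> \<bar>b t\<bar> \<le> M"
      "\<And>t. t \<in> {0..pi} \<Longrightarrow> \<bar>c t\<bar> \<le> M" "M \<ge> 1"
begin

abbreviation "V \<equiv> abel_rhs a b c"
abbreviation "Wn \<equiv> abel_iter a b c"
abbreviation "W \<equiv> abel_sol a b c"
text \<open>Chosen so that \<open>M * rad\<close> = 1/100, the smallness used in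
  \<open>abel_rhs_bound\<close> and \<open>abel_rhs_diff\<close>.\<close>

definition rad :: real where "rad = 1 / (100 * M)"

lemma V_bound:
  assumes "t \<in> {0..pi}" "norm \<rho> \<le> rad" "norm (w - 1) \<le> 1/2"
  shows "norm (V t \<rho> w) \<le> 1/8"
  using abel_rhs_bound[of a t b M c \<rho> w] bounds assms by (auto simp: rad_def)

lemma V_diff:
  assumes "t \<in> {0..pi}" "norm \<rho> \<le> rad" "norm (v - 1) \<le> 1/2" "norm (w - 1) \<le> 1/2"
  shows "norm (V t \<rho> v - V t \<rho> w) \<le> norm (v - w) / 8"
  using abel_rhs_diff[of a t b M c \<rho> v w] bounds assms by (auto simp: rad_def)

lemma V_continuous:
  assumes "continuous_on {0..pi} f"
  shows "continuous_on {0..pi} (\<lambda>t. V t \<rho> (f t))"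
  unfolding abel_rhs_def using assms cont by (intro continuous_intros)

lemma iter_poly_param: "poly_param (Wn n)"
proof (induction n)
  case 0
  then show ?case by (simp add: poly_param_const)
next
  case (Suc n)
  have c: "poly_param (\<lambda>t \<rho>. complex_of_real (f t))" if "continuous_on {0..pi} f" for f
    using that by (intro poly_param_const continuous_intros)
  have "poly_param (\<lambda>u \<rho>. V u \<rho> (Wn n u \<rho>))"
    unfolding abel_rhs_def
    using c cont Suc by (intro poly_param_add poly_param_mult poly_param_power poly_param_var)
  then show ?case
    by (auto intro!: poly_param_add poly_param_integral poly_param_const)
qed

lemma iter_Suc: "Wn (Suc n) t \<rho> = 1 + integral {0..t} (\<lambda>u. V u \<rho> (Wn n u \<rho>))"
  by simp

declare abel_iter.simps(2) [simp del]

lemma integral_le_sup: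
  assumes "continuous_on {0..pi} f" "t \<in> {0..pi}" "\<And>u. u \<in> {0..pi} \<Longrightarrow> norm (f u :: complex) \<le> K" "K \<ge> 0"
  shows "norm (integral {0..t} f) \<le> 4 * K"
proof -
  have "norm (integral {0..t} f) \<le> K * (t - 0)"
    using assms by (intro integral_bound) (auto intro: continuous_on_subset)
  also have "\<dots> \<le> K * 4"
    using assms pi_less_4 by (intro mult_left_mono) auto
  finally show ?thesis by simp
qed

lemma iter_bound:
  assumes "t \<in> {0..pi}" "norm \<rho> \<le> rad"
  shows "norm (Wn n t \<rho> - 1) \<le> 1/2"
  using assms
proof (induction n arbitrary: t)
  case (Suc n)
  have "norm (integral {0..t} (\<lambda>u. V u \<rho> (Wn n u \<rho>))) \<le> 4 * (1/8)"
    using Suc poly_param_continuous[OF iter_poly_param]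
    by (intro integral_le_sup V_continuous V_bound) auto
  then show ?case by (simp add: iter_Suc)
qed simp

text \<open>The factor 1/2 is 4 / 8: \<open>V_diff\<close> divides the previous bound by 8, and
  integration multiplies it by at most 4.\<close>

lemma iter_step:
  assumes "t \<in> {0..pi}" "norm \<rho> \<le> rad"
  shows "norm (Wn (Suc n) t \<rho> - Wn n t \<rho>) \<le> (1/2) ^ n"
  using assms
proof (induction n arbitrary: t)
  case 0
  have "norm (Wn (Suc 0) t \<rho> - 1) \<le> 1/2" using iter_bound[of t \<rho> "Suc 0"] 0 by simp
  then show ?case by simp
next
  case (Suc n)
  note c = V_continuous[OF poly_param_continuous[OF iter_poly_param]]
  have i: "(\<lambda>u. V u \<rho> (Wn k u \<rho>)) integrable_on {0..t}" for k
    using Suc.prems(1) by (intro integrable_continuous_real continuous_on_subset[OF c]) auto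
  have "Wn (Suc (Suc n)) t \<rho> - Wn (Suc n) t \<rho> =
      integral {0..t} (\<lambda>u. V u \<rho> (Wn (Suc n) u \<rho>)) - integral {0..t} (\<lambda>u. V u \<rho> (Wn n u \<rho>))"
    unfolding iter_Suc[of "Suc n" t] iter_Suc[of n t] by (rule add_diff_cancel_left)
  also have "\<dots> = integral {0..t} (\<lambda>u. V u \<rho> (Wn (Suc n) u \<rho>) - V u \<rho> (Wn n u \<rho>))"
    using i by (intro integral_diff[symmetric])
  also have "norm \<dots> \<le> 4 * ((1/2) ^ n / 8)"
  proof (rule integral_le_sup)
    show "norm (V u \<rho> (Wn (Suc n) u \<rho>) - V u \<rho> (Wn n u \<rho>)) \<le> (1/2) ^ n / 8" if "u \<in> {0..pi}" for u
    proof -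
      have "norm (V u \<rho> (Wn (Suc n) u \<rho>) - V u \<rho> (Wn n u \<rho>)) \<le> norm (Wn (Suc n) u \<rho> - Wn n u \<rho>) / 8"
        using that Suc.prems(2) by (intro V_diff iter_bound)
      then show ?thesis using Suc.IH[OF that Suc.prems(2)] by linarith
    qed
  next
    show "continuous_on {0..pi} (\<lambda>u. V u \<rho> (Wn (Suc n) u \<rho>) - V u \<rho> (Wn n u \<rho>))"
      by (intro continuous_on_diff c)
  qed (use Suc.prems in simp_all)
  also have "4 * ((1/2) ^ n / 8) \<le> (1/2 :: real) ^ Suc n" by simp
  finally show ?case .
qed

text \<open>Uniformity is needed in both variables: in \<open>\<rho>\<close> for holomorphy of the
  limit, in \<open>t\<close> for continuity and for passing to the limit under the integral. The
  iterates are partial sums of a telescoping series dominated by a geometric one.\<close>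

lemma uniform_limit_iter: "uniform_limit ({0..pi} \<times> cball 0 rad) (\<lambda>n x. Wn n (fst x) (snd x)) (\<lambda>x. W (fst x) (snd x)) sequentially"
proof -
  let ?S = "{0..pi} \<times> cball 0 rad"
  have "uniform_limit ?S (\<lambda>n x. \<Sum>i<n. Wn (Suc i) (fst x) (snd x) - Wn i (fst x) (snd x))
     (\<lambda>x. \<Sum>i. Wn (Suc i) (fst x) (snd x) - Wn i (fst x) (snd x)) sequentially" (is "uniform_limit _ _ ?g _")
    by (rule Weierstrass_m_test[of _ _ "\<lambda>n. (1/2) ^ n"])
       (auto intro!: iter_step)
  then have "uniform_limit ?S (\<lambda>n x. Wn n (fst x) (snd x) - 1) ?g sequentially"
    by (subst (asm) sum_lessThan_telescope) (simp add: abel_iter.simps(1))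
  then have *: "uniform_limit ?S (\<lambda>n x. Wn n (fst x) (snd x)) (\<lambda>x. ?g x + 1) sequentially"
    by (auto simp: uniform_limit_iff dist_norm algebra_simps)
  \<comment> \<open>\<open>W\<close> is defined as a pointwise \<open>lim\<close>, which has to be
    identified with the sum of the series.\<close>
  have "W (fst x) (snd x) = ?g x + 1" if "x \<in> ?S" for x
    unfolding abel_sol_def using tendsto_uniform_limitI[OF * that] by (simp add: limI)
  with * show ?thesis
    by (subst uniform_limit_cong') auto
qed

lemma iter_tendsto:
  assumes "t \<in> {0..pi}" "norm \<rho> \<le> rad"
  shows "(\<lambda>n. Wn n t \<rho>) \<longlonglongrightarrow> W t \<rho>"
  using tendsto_uniform_limitI[OF uniform_limit_iter, of "(t, \<rho>)"] assms by auto

lemma sol_bound: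
  assumes "t \<in> {0..pi}" "norm \<rho> \<le> rad"
  shows "norm (W t \<rho> - 1) \<le> 1/2"
proof -
  have "(\<lambda>n. norm (Wn n t \<rho> - 1)) \<longlonglongrightarrow> norm (W t \<rho> - 1)"
    by (intro tendsto_intros iter_tendsto assms)
  then show ?thesis
    by (rule Lim_bounded) (use iter_bound assms in auto)
qed

text \<open>Weierstrass' theorem on locally uniform limits, applied to iterates that are polynomials
  in \<open>\<rho>\<close>.\<close>

lemma sol_holomorphic:
  assumes "t \<in> {0..pi}"
  shows "W t holomorphic_on ball 0 rad"
proof (rule holomorphic_uniform_sequence)
  show "Wn n t holomorphic_on ball 0 rad" for n
    using poly_param_holomorphic[OF iter_poly_param assms] by simp
  have u: "uniform_limit (cball 0 rad) (\<lambda>n. Wn n t) (W t) sequentially"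
    using uniform_limit_iter assms unfolding uniform_limit_iff by (fastforce elim: eventually_mono)
  fix x :: complex assume "x \<in> ball 0 rad"
  then obtain d where d: "d > 0" "cball x d \<subseteq> ball 0 rad"
    using open_ball open_contains_cball by blast
  have "uniform_limit (cball x d) (\<lambda>n. Wn n t) (W t) sequentially"
    using uniform_limit_on_subset[OF u] d(2) ball_subset_cball[of 0 rad] by blast
  with d
  show "\<exists>d>0. cball x d \<subseteq> ball 0 rad \<and> uniform_limit (cball x d) (\<lambda>n. Wn n t) (W t) sequentially"
    by blast
qed auto

lemma sol_continuous:
  assumes "norm \<rho> \<le> rad"
  shows "continuous_on {0..pi} (\<lambda>t. W t \<rho>)"
proof (rule uniform_limit_theorem)
  show "uniform_limit {0..pi} (\<lambda>n t. Wn n t \<rho>) (\<lambda>t. W t \<rho>) sequentially"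
    using uniform_limit_iter assms unfolding uniform_limit_iff by (fastforce elim: eventually_mono)
qed (use poly_param_continuous[OF iter_poly_param] in auto)

text \<open>The recursion of the iterates passes to the limit: \<open>V_diff\<close> transfers their
  uniform convergence to the integrands.\<close>

lemma sol_integral:
  assumes "t \<in> {0..pi}" "norm \<rho> \<le> rad"
  shows "W t \<rho> = 1 + integral {0..t} (\<lambda>u. V u \<rho> (W u \<rho>))"
proof -
  have u: "uniform_limit {0..pi} (\<lambda>n t. Wn n t \<rho>) (\<lambda>t. W t \<rho>) sequentially"
    using uniform_limit_iter assms unfolding uniform_limit_iff by (fastforce elim: eventually_mono)
  have u2: "uniform_limit (cbox 0 t) (\<lambda>n u. V u \<rho> (Wn n u \<rho>)) (\<lambda>u. V u \<rho> (W u \<rho>)) sequentially"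
    unfolding uniform_limit_iff
  proof (intro allI impI)
    fix e :: real assume "e > 0"
    from u have "\<forall>\<^sub>F n in sequentially. \<forall>x\<in>{0..pi}. dist (Wn n x \<rho>) (W x \<rho>) < e"
      using \<open>e > 0\<close> unfolding uniform_limit_iff by blast
    then show "\<forall>\<^sub>F n in sequentially. \<forall>x\<in>cbox 0 t. dist (V x \<rho> (Wn n x \<rho>)) (V x \<rho> (W x \<rho>)) < e"
    proof (rule eventually_mono, intro ballI)
      fix n x assume *: "\<forall>x\<in>{0..pi}. dist (Wn n x \<rho>) (W x \<rho>) < e" and x: "x \<in> cbox 0 t"
      have xp: "x \<in> {0..pi}" using x assms by auto
      have "norm (V x \<rho> (Wn n x \<rho>) - V x \<rho> (W x \<rho>)) \<le> norm (Wn n x \<rho> - W x \<rho>) / 8"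
        using xp assms by (intro V_diff iter_bound sol_bound)
      also have "\<dots> < e"
        using bspec[OF * xp] \<open>e > 0\<close> norm_ge_zero[of "Wn n x \<rho> - W x \<rho>"] unfolding dist_norm by linarith
      finally show "dist (V x \<rho> (Wn n x \<rho>)) (V x \<rho> (W x \<rho>)) < e" by (simp add: dist_norm)
    qed
  qed
  have "continuous_on (cbox 0 t) (\<lambda>u. V u \<rho> (Wn n u \<rho>))" for n
    using assms
    by (intro continuous_on_subset[OF V_continuous[OF poly_param_continuous[OF iter_poly_param]]]) auto
  then obtain I J where I: "\<And>n. ((\<lambda>u. V u \<rho> (Wn n u \<rho>)) has_integral I n) (cbox 0 t)"
      and J: "((\<lambda>u. V u \<rho> (W u \<rho>)) has_integral J) (cbox 0 t)" and lim: "I \<longlonglongrightarrow> J"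
    using uniform_limit_integral_cbox[OF u2] by auto
  have "(\<lambda>n. 1 + I n) \<longlonglongrightarrow> 1 + J" by (intro tendsto_intros lim)
  moreover have "(\<lambda>n. Wn (Suc n) t \<rho>) = (\<lambda>n. 1 + I n)"
    using I by (auto simp: iter_Suc integral_unique)
  ultimately have "(\<lambda>n. Wn (Suc n) t \<rho>) \<longlonglongrightarrow> 1 + J" by simp
  then have "W t \<rho> = 1 + J"
    using LIMSEQ_unique[OF LIMSEQ_Suc[OF iter_tendsto[OF assms]]] by blast
  then show ?thesis using J by (auto simp: integral_unique)
qed

lemma sol_0: "norm \<rho> \<le> rad \<Longrightarrow> W 0 \<rho> = 1"
  using sol_integral[of 0 \<rho>] by simp

lemma sol_deriv:
  assumes "t \<in> {0..pi}" "norm \<rho> \<le> rad"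
  shows "((\<lambda>t. W t \<rho>) has_vector_derivative V t \<rho> (W t \<rho>)) (at t within {0..pi})"
proof -
  have "((\<lambda>t. 1 + integral {0..t} (\<lambda>u. V u \<rho> (W u \<rho>))) has_vector_derivative 0 + V t \<rho> (W t \<rho>)) (at t within {0..pi})"
    using assms by (intro has_vector_derivative_add has_vector_derivative_const
        integral_has_vector_derivative V_continuous sol_continuous)
  then have "((\<lambda>t. 1 + integral {0..t} (\<lambda>u. V u \<rho> (W u \<rho>))) has_vector_derivative V t \<rho> (W t \<rho>)) (at t within {0..pi})"
    by simp
  then show ?thesis
    by (rule has_vector_derivative_transform[rotated 2]) (use assms sol_integral in auto)
qed

text \<open>For real \<open>\<rho>\<close> the iteration stays real. This allows taking
  \<open>Re\<close> of the complex solution later and still having a solution of the Abel equation,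
  although that equation is nonlinear.\<close>

lemma iter_real: "t \<in> {0..pi} \<Longrightarrow> Wn n t (of_real r) \<in> \<real>"
proof (induction n arbitrary: t)
  case (Suc n)
  have "V u (of_real r) (Wn n u (of_real r)) = of_real (Re (V u (of_real r) (Wn n u (of_real r))))"
    if "u \<in> {0..t}" for u
    using Suc.IH[of u] that Suc.prems unfolding abel_rhs_def
    by (intro of_real_Re[symmetric] Reals_add Reals_mult Reals_power) auto
  then have "integral {0..t} (\<lambda>u. V u (of_real r) (Wn n u (of_real r))) =
      integral {0..t} (\<lambda>u. complex_of_real (Re (V u (of_real r) (Wn n u (of_real r)))))"
    by (intro integral_cong) auto
  also have "\<dots> = of_real (integral {0..t} (\<lambda>u. Re (V u (of_real r) (Wn n u (of_real r)))))"
  proof -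
    have "continuous_on {0..t} (\<lambda>u. Re (V u (of_real r) (Wn n u (of_real r))))"
      using Suc.prems
      by (intro continuous_intros continuous_on_subset[OF V_continuous[OF poly_param_continuous[OF iter_poly_param]]]) auto
    then show ?thesis
      by (intro integral_unique has_integral_of_real integrable_integral integrable_continuous_real)
  qed
  finally show ?case by (simp add: iter_Suc)
qed auto

lemma sol_real:
  assumes "t \<in> {0..pi}" "\<bar>r\<bar> \<le> rad"
  shows "W t (of_real r) \<in> \<real>"
proof (rule Lim_in_closed_set)
  show "(\<lambda>n. Wn n t (of_real r)) \<longlonglongrightarrow> W t (of_real r)"
    using assms by (intro iter_tendsto) auto
qed (use iter_real assms in \<open>auto intro: closed_complex_Reals\<close>)

text \<open>Without the linear coefficient every term of the right-hand side carries a factor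
  \<open>\<rho>\<close>. This first order estimate is the start of the expansion in
  \<open>half_sol_expansion\<close>.\<close>

lemma sol_minus_1_linear:
  assumes "t \<in> {0..pi}" "norm \<rho> \<le> rad" "\<And>t. t \<in> {0..pi} \<Longrightarrow> a t = 0"
  shows "norm (W t \<rho> - 1) \<le> 32 * M * norm \<rho>"
proof -
  have "norm (integral {0..t} (\<lambda>u. V u \<rho> (W u \<rho>))) \<le> 4 * (8 * M * norm \<rho>)"
  proof (rule integral_le_sup)
    fix u assume u: "u \<in> {0..pi}"
    let ?w = "W u \<rho>"
    have nw: "norm ?w \<le> 3/2"
      using norm_triangle_ineq[of "?w - 1" 1] sol_bound[OF u assms(2)] by simp
    have w2: "norm ?w ^ 2 \<le> (3/2)^2" and w3: "norm ?w ^ 3 \<le> (3/2)^3"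
      using nw by (intro power_mono; simp)+
    have "norm \<rho> \<le> 1 / (100 * M)" using assms(2) by (simp add: rad_def)
    also have "\<dots> \<le> 1" using bounds(4) by (simp add: field_simps)
    finally have r2: "norm \<rho> * norm \<rho> \<le> norm \<rho>" by (simp add: mult_left_le)
    have 1: "norm (of_real (b u) * \<rho> * ?w\<^sup>2) \<le> M * norm \<rho> * (3/2)^2"
      unfolding norm_mult norm_power norm_of_real using bounds(2,4) u w2 by (intro mult_mono) auto
    have 2: "norm (of_real (c u) * \<rho>\<^sup>2 * ?w ^ 3) \<le> M * norm \<rho> * (3/2)^3"
      unfolding norm_mult norm_power norm_of_real using bounds(3,4) u w3 r2
      by (intro mult_mono) (auto simp: power2_eq_square)
    have "norm (V u \<rho> ?w) \<le> M * norm \<rho> * (3/2)^2 + M * norm \<rho> * (3/2)^3"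
      using norm_triangle_ineq[of "of_real (b u) * \<rho> * ?w\<^sup>2" "of_real (c u) * \<rho>\<^sup>2 * ?w ^ 3"] 1 2 assms(3)[OF u]
      unfolding abel_rhs_def by simp
    also have "\<dots> \<le> 8 * M * norm \<rho>"
      using mult_nonneg_nonneg[of M "norm \<rho>"] bounds(4) by (simp add: power2_eq_square power3_eq_cube)
    finally show "norm (V u \<rho> ?w) \<le> 8 * M * norm \<rho>" .
  qed (use assms bounds(4) V_continuous sol_continuous in auto)
  then show ?thesis using sol_integral[OF assms(1,2)] by simp
qed

end

text \<open>Instead of Gronwall's inequality, the difference is estimated where it is largest:
  \<open>d s\<close> <= 4 (\<open>d s\<close> / 8 + 2 e), and the term in \<open>d s\<close> is
  absorbed on the left. Both equations share \<open>M\<close>, hence the same disc of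
  \<open>\<rho>\<close>.\<close>

lemma abel_sol_dependence:
  assumes "abel a b c M" "abel a' b' c' M"
    and close: "\<And>t. t \<in> {0..pi} \<Longrightarrow> \<bar>a t - a' t\<bar> \<le> e" "\<And>t. t \<in> {0..pi} \<Longrightarrow> \<bar>b t - b' t\<bar> \<le> e"
      "\<And>t. t \<in> {0..pi} \<Longrightarrow> \<bar>c t - c' t\<bar> \<le> e"
    and t: "t \<in> {0..pi}" and \<rho>: "norm \<rho> \<le> 1 / (100 * M)"
  shows "norm (abel_sol a b c t \<rho> - abel_sol a' b' c' t \<rho>) \<le> 16 * e"
proof -
  interpret X: abel a b c M by fact
  interpret Y: abel a' b' c' M by fact
  have e0: "e \<ge> 0" using close(1)[OF t] by linarith
  have r: "norm \<rho> \<le> X.rad" "norm \<rho> \<le> Y.rad" using \<rho> by (simp_all add: X.rad_def Y.rad_def)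
  define d where "d t = norm (abel_sol a b c t \<rho> - abel_sol a' b' c' t \<rho>)" for t
  have "continuous_on {0..pi} d"
    unfolding d_def by (intro continuous_intros X.sol_continuous Y.sol_continuous r)
  then obtain s where s: "s \<in> {0..pi}" "\<And>t. t \<in> {0..pi} \<Longrightarrow> d t \<le> d s"
    using continuous_attains_sup[of "{0..pi}" d] by auto
  have rho1: "norm \<rho> \<le> 1/100"
    using \<rho> X.bounds(4) order_trans[of "norm \<rho>" "1 / (100 * M)" "1/100"] by (simp add: field_simps)
  have i: "(\<lambda>u. X.V u \<rho> (X.W u \<rho>)) integrable_on {0..s}" "(\<lambda>u. Y.V u \<rho> (Y.W u \<rho>)) integrable_on {0..s}"
    using s(1)
    by (intro integrable_continuous_real continuous_on_subset[OF X.V_continuous[OF X.sol_continuous[OF r(1)]]]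
        continuous_on_subset[OF Y.V_continuous[OF Y.sol_continuous[OF r(2)]]]; auto)+
  have "d s = norm (integral {0..s} (\<lambda>u. X.V u \<rho> (X.W u \<rho>) - Y.V u \<rho> (Y.W u \<rho>)))"
    unfolding d_def X.sol_integral[OF s(1) r(1)] Y.sol_integral[OF s(1) r(2)]
    using integral_diff[OF i] by simp
  also have "\<dots> \<le> 4 * (d s / 8 + 2 * e)"
  proof (rule X.integral_le_sup)
    fix u assume u: "u \<in> {0..pi}"
    let ?w = "Y.W u \<rho>"
    have nw: "norm ?w \<le> 3/2"
      using norm_triangle_ineq[of "?w - 1" 1] Y.sol_bound[OF u r(2)] by simp
    have w2: "norm ?w ^ 2 \<le> (3/2)^2" and w3: "norm ?w ^ 3 \<le> (3/2)^3"
      using nw by (intro power_mono; simp)+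
    have r2: "norm \<rho> ^ 2 \<le> (1/100)^2" using rho1 by (intro power_mono) auto
    have 1: "norm (of_real (a u - a' u) * ?w) \<le> e * (3/2)"
      unfolding norm_mult norm_of_real using close(1)[OF u] nw e0 by (intro mult_mono) auto
    have 2: "norm (of_real (b u - b' u) * \<rho> * ?w\<^sup>2) \<le> e * (1/100) * (3/2)^2"
      unfolding norm_mult norm_power norm_of_real using close(2)[OF u] w2 rho1 e0 by (intro mult_mono) auto
    have 3: "norm (of_real (c u - c' u) * \<rho>\<^sup>2 * ?w ^ 3) \<le> e * (1/100)^2 * (3/2)^3"
      unfolding norm_mult norm_power norm_of_real using close(3)[OF u] w3 r2 e0 by (intro mult_mono) auto
    have "X.V u \<rho> ?w - Y.V u \<rho> ?w = of_real (a u - a' u) * ?w + of_real (b u - b' u) * \<rho> * ?w\<^sup>2 + of_real (c u - c' u) * \<rho>\<^sup>2 * ?w ^ 3"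
      by (simp add: abel_rhs_def algebra_simps)
    also have "norm \<dots> \<le> e * (3/2) + e * (1/100) * (3/2)^2 + e * (1/100)^2 * (3/2)^3"
      using 1 2 3 by (intro order_trans[OF norm_triangle_ineq] add_mono)
    also have "\<dots> \<le> 2 * e"
      using e0 by (simp add: power2_eq_square power3_eq_cube)
    finally have A: "norm (X.V u \<rho> ?w - Y.V u \<rho> ?w) \<le> 2 * e" .
    have B: "norm (X.V u \<rho> (X.W u \<rho>) - X.V u \<rho> ?w) \<le> d u / 8"
      unfolding d_def using u r by (intro X.V_diff X.sol_bound Y.sol_bound)
    have "norm (X.V u \<rho> (X.W u \<rho>) - Y.V u \<rho> ?w) \<le> norm (X.V u \<rho> (X.W u \<rho>) - X.V u \<rho> ?w) + norm (X.V u \<rho> ?w - Y.V u \<rho> ?w)"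
      using norm_triangle_ineq[of "X.V u \<rho> (X.W u \<rho>) - X.V u \<rho> ?w" "X.V u \<rho> ?w - Y.V u \<rho> ?w"] by simp
    then show "norm (X.V u \<rho> (X.W u \<rho>) - Y.V u \<rho> ?w) \<le> d s / 8 + 2 * e"
      using A B s(2)[OF u] by linarith
  next
    show "continuous_on {0..pi} (\<lambda>u. X.V u \<rho> (X.W u \<rho>) - Y.V u \<rho> (Y.W u \<rho>))"
      by (intro continuous_on_diff X.V_continuous X.sol_continuous Y.V_continuous Y.sol_continuous r)
  qed (use s e0 in \<open>auto simp: d_def\<close>)
  finally have "d s \<le> 16 * e" by simp
  then show ?thesis using s(2)[OF t] by (simp add: d_def)
qed

section \<open>Planar differential equations\<close>

text \<open>The function exp(-2 C t) |u|^2 has nonpositive derivative, so it cannot rise above its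
  initial value 0.\<close>

lemma gronwall_zero:
  fixes u :: "real \<Rightarrow> 'a::real_inner"
  assumes der: "\<And>t. t \<in> {0..T} \<Longrightarrow> (u has_vector_derivative u' t) (at t within {0..T})"
    and bound: "\<And>t. t \<in> {0..T} \<Longrightarrow> norm (u' t) \<le> C * norm (u t)"
    and "u 0 = 0" "t \<in> {0..T}"
  shows "u t = 0"
proof (cases "t = 0")
  case False
  then have t: "0 < t" "t \<le> T" using assms by auto
  define f where "f s = exp (- 2 * C * s) * (u s \<bullet> u s)" for s
  define f' where "f' s = exp (- 2 * C * s) * (2 * (u s \<bullet> u' s) - 2 * C * (u s \<bullet> u s))" for s
  have "\<exists>x\<in>{0<..<t}. f t - f 0 = (\<lambda>h. h * f' x) (t - 0)"
  proof (rule mvt_simple[OF t(1)])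
    fix s assume s: "0 \<le> s" "s \<le> t"
    have "(u has_derivative (\<lambda>h. h *\<^sub>R u' s)) (at s within {0..t})"
      using der[of s] s t unfolding has_vector_derivative_def
      by (auto intro: has_derivative_subset)
    then show "(f has_derivative (\<lambda>h. h * f' s)) (at s within {0..t})"
      unfolding f_def f'_def
      by (auto intro!: derivative_eq_intros simp: algebra_simps inner_commute)
  qed
  then obtain x where x: "x \<in> {0<..<t}" "f t - f 0 = t * f' x" by auto
  have "u x \<bullet> u' x \<le> norm (u x) * norm (u' x)"
    by (rule norm_cauchy_schwarz)
  also have "\<dots> \<le> norm (u x) * (C * norm (u x))"
    using bound[of x] x t by (intro mult_left_mono) auto
  also have "\<dots> = C * (u x \<bullet> u x)" by (simp add: power2_norm_eq_inner[symmetric] power2_eq_square)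
  finally have "f' x \<le> 0"
    unfolding f'_def by (intro mult_nonneg_nonpos) auto
  then have "f t \<le> f 0" using x(2) mult_nonneg_nonpos[of t "f' x"] t by linarith
  also have "f 0 = 0" using assms(3) by (simp add: f_def)
  finally have "exp (- 2 * C * t) * (u t \<bullet> u t) \<le> 0" by (simp add: f_def)
  then have "u t \<bullet> u t \<le> 0" by (simp add: mult_le_0_iff)
  then show ?thesis by (metis inner_gt_zero_iff not_less)
qed (use assms in simp)

text \<open>One constant for each ball, rather than a global one, makes the class closed under
  products, so that it contains polynomial fields.\<close>

definition locally_lipschitz :: "('a::real_normed_vector \<Rightarrow> 'b::real_normed_vector) \<Rightarrow> bool" where
  "locally_lipschitz f \<longleftrightarrow>
     (\<forall>R. \<exists>C\<ge>0. \<forall>z w. norm z \<le> R \<longrightarrow> norm w \<le> R \<longrightarrow> norm (f z - f w) \<le> C * norm (z - w))"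

lemma locally_lipschitzE:
  assumes "locally_lipschitz f"
  obtains C where "C \<ge> 0" "\<And>z w. norm z \<le> R \<Longrightarrow> norm w \<le> R \<Longrightarrow> norm (f z - f w) \<le> C * norm (z - w)"
  using assms unfolding locally_lipschitz_def by blast

lemma locally_lipschitz_bounded:
  assumes "locally_lipschitz f"
  obtains K where "K \<ge> 0" "\<And>z. norm z \<le> R \<Longrightarrow> norm (f z) \<le> K"
proof -
  obtain C where C: "C \<ge> 0" "\<And>z w. norm z \<le> \<bar>R\<bar> \<Longrightarrow> norm w \<le> \<bar>R\<bar> \<Longrightarrow> norm (f z - f w) \<le> C * norm (z - w)"
    by (rule locally_lipschitzE[OF assms]) blast
  show thesis
  proof
    show "norm (f z) \<le> C * \<bar>R\<bar> + norm (f 0)" if "norm z \<le> R" for z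
    proof -
      have "norm (f z - f 0) \<le> C * norm (z - 0)" using C(2)[of z 0] that by auto
      also have "\<dots> \<le> C * \<bar>R\<bar>" using that C(1) by (intro mult_left_mono) auto
      finally show ?thesis using norm_triangle_ineq[of "f z - f 0" "f 0"] by simp
    qed
  qed (use C in simp)
qed

lemma locally_lipschitz_const: "locally_lipschitz (\<lambda>z. c)"
  unfolding locally_lipschitz_def by auto

lemma locally_lipschitz_linear:
  assumes "bounded_linear f"
  shows "locally_lipschitz f"
proof -
  interpret bounded_linear f by fact
  show ?thesis
    unfolding locally_lipschitz_def
    using nonneg_bounded by (metis diff mult.commute)
qed

lemma locally_lipschitz_add:
  assumes "locally_lipschitz f" "locally_lipschitz g"
  shows "locally_lipschitz (\<lambda>z. f z + g z)"
  unfolding locally_lipschitz_def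
proof
  fix R
  obtain C where C: "C \<ge> 0" "\<And>z w. norm z \<le> R \<Longrightarrow> norm w \<le> R \<Longrightarrow> norm (f z - f w) \<le> C * norm (z - w)"
    by (rule locally_lipschitzE[OF assms(1)]) blast
  obtain D where D: "D \<ge> 0" "\<And>z w. norm z \<le> R \<Longrightarrow> norm w \<le> R \<Longrightarrow> norm (g z - g w) \<le> D * norm (z - w)"
    by (rule locally_lipschitzE[OF assms(2)]) blast
  have "norm (f z + g z - (f w + g w)) \<le> (C + D) * norm (z - w)" if "norm z \<le> R" "norm w \<le> R" for z w
    using norm_triangle_ineq[of "f z - f w" "g z - g w"] C(2)[OF that] D(2)[OF that]
    by (simp add: algebra_simps)
  then show "\<exists>C\<ge>0. \<forall>z w. norm z \<le> R \<longrightarrow> norm w \<le> R \<longrightarrow> norm (f z + g z - (f w + g w)) \<le> C * norm (z - w)"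
    using C(1) D(1) by (intro exI[of _ "C + D"]) auto
qed

lemma locally_lipschitz_mult:
  fixes f g :: "'a::real_normed_vector \<Rightarrow> real"
  assumes "locally_lipschitz f" "locally_lipschitz g"
  shows "locally_lipschitz (\<lambda>z. f z * g z)"
  unfolding locally_lipschitz_def
proof
  fix R
  obtain C where C: "C \<ge> 0" "\<And>z w. norm z \<le> R \<Longrightarrow> norm w \<le> R \<Longrightarrow> norm (f z - f w) \<le> C * norm (z - w)"
    by (rule locally_lipschitzE[OF assms(1)]) blast
  obtain D where D: "D \<ge> 0" "\<And>z w. norm z \<le> R \<Longrightarrow> norm w \<le> R \<Longrightarrow> norm (g z - g w) \<le> D * norm (z - w)"
    by (rule locally_lipschitzE[OF assms(2)]) blast
  obtain K where K: "K \<ge> 0" "\<And>z. norm z \<le> R \<Longrightarrow> norm (f z) \<le> K"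
    by (rule locally_lipschitz_bounded[OF assms(1)]) blast
  obtain J where J: "J \<ge> 0" "\<And>z. norm z \<le> R \<Longrightarrow> norm (g z) \<le> J"
    by (rule locally_lipschitz_bounded[OF assms(2)]) blast
  have "norm (f z * g z - f w * g w) \<le> (K * D + J * C) * norm (z - w)" if zw: "norm z \<le> R" "norm w \<le> R" for z w
  proof -
    have "f z * g z - f w * g w = f z * (g z - g w) + g w * (f z - f w)" by (simp add: algebra_simps)
    also have "norm \<dots> \<le> norm (f z) * norm (g z - g w) + norm (g w) * norm (f z - f w)"
      by (metis norm_mult norm_triangle_ineq)
    also have "\<dots> \<le> K * (D * norm (z - w)) + J * (C * norm (z - w))"
      using C D K J zw by (intro add_mono mult_mono) auto
    finally show ?thesis by (simp add: algebra_simps)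
  qed
  then show "\<exists>C\<ge>0. \<forall>z w. norm z \<le> R \<longrightarrow> norm w \<le> R \<longrightarrow> norm (f z * g z - f w * g w) \<le> C * norm (z - w)"
    using C(1) D(1) K(1) J(1) by (intro exI[of _ "K * D + J * C"]) auto
qed

lemma locally_lipschitz_power:
  fixes f :: "'a::real_normed_vector \<Rightarrow> real"
  shows "locally_lipschitz f \<Longrightarrow> locally_lipschitz (\<lambda>z. f z ^ n)"
  by (induction n) (auto intro: locally_lipschitz_mult locally_lipschitz_const)

text \<open>Needed for the piecewise field, which \<open>pw_field_eq\<close> writes as a polynomial
  in the coordinates and the positive part of the second one.\<close>

lemma locally_lipschitz_max_0:
  fixes f :: "'a::real_normed_vector \<Rightarrow> real"
  assumes "locally_lipschitz f"
  shows "locally_lipschitz (\<lambda>z. max (f z) 0)"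
proof -
  have "norm (max a 0 - max b 0) \<le> norm (a - b)" for a b :: real by (auto simp: max_def)
  then show ?thesis
    using assms unfolding locally_lipschitz_def by (meson order_trans)
qed

lemma locally_lipschitz_Pair:
  fixes f g :: "'a::real_normed_vector \<Rightarrow> real"
  assumes "locally_lipschitz f" "locally_lipschitz g"
  shows "locally_lipschitz (\<lambda>z. (f z, g z))"
proof -
  have *: "norm x \<le> norm (fst x) + norm (snd x)" for x :: "real \<times> real"
    by (cases x) (simp add: norm_Pair sqrt_sum_squares_le_sum_abs)
  show ?thesis
    unfolding locally_lipschitz_def
  proof
    fix R
    obtain C where C: "C \<ge> 0" "\<And>z w. norm z \<le> R \<Longrightarrow> norm w \<le> R \<Longrightarrow> norm (f z - f w) \<le> C * norm (z - w)"
      by (rule locally_lipschitzE[OF assms(1)]) blast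
    obtain D where D: "D \<ge> 0" "\<And>z w. norm z \<le> R \<Longrightarrow> norm w \<le> R \<Longrightarrow> norm (g z - g w) \<le> D * norm (z - w)"
      by (rule locally_lipschitzE[OF assms(2)]) blast
    have "norm ((f z, g z) - (f w, g w)) \<le> (C + D) * norm (z - w)" if "norm z \<le> R" "norm w \<le> R" for z w
      using *[of "(f z, g z) - (f w, g w)"] C(2)[OF that] D(2)[OF that]
      by (simp add: algebra_simps)
    then show "\<exists>C\<ge>0. \<forall>z w. norm z \<le> R \<longrightarrow> norm w \<le> R \<longrightarrow> norm ((f z, g z) - (f w, g w)) \<le> C * norm (z - w)"
      using C(1) D(1) by (intro exI[of _ "C + D"]) auto
  qed
qed

lemmas locally_lipschitz_intros =
  locally_lipschitz_const locally_lipschitz_add locally_lipschitz_mult locally_lipschitz_power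
  locally_lipschitz_max_0 locally_lipschitz_Pair
  locally_lipschitz_linear[OF bounded_linear_fst] locally_lipschitz_linear[OF bounded_linear_snd]

definition solves :: "('a::real_normed_vector \<Rightarrow> 'a) \<Rightarrow> (real \<Rightarrow> 'a) \<Rightarrow> real \<Rightarrow> bool" where
  "solves X \<gamma> T \<longleftrightarrow> (\<forall>t\<in>{0..T}. (\<gamma> has_vector_derivative X (\<gamma> t)) (at t within {0..T}))"

lemma solves_continuous: "solves X \<gamma> T \<Longrightarrow> continuous_on {0..T} \<gamma>"
  unfolding solves_def continuous_on_eq_continuous_within
  using has_vector_derivative_continuous by blast

lemma solves_subset: "solves X \<gamma> T \<Longrightarrow> S \<le> T \<Longrightarrow> solves X \<gamma> S"
  unfolding solves_def
  by (rule ballI, rule has_vector_derivative_within_subset[of \<gamma> _ _ "{0..T}"]) auto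

lemma solves_cong:
  assumes "solves X \<gamma> T" "\<And>t. t \<in> {0..T} \<Longrightarrow> X (\<gamma> t) = Y (\<gamma> t)"
  shows "solves Y \<gamma> T"
  using assms unfolding solves_def by auto

lemma solves_unique:
  fixes X :: "'a::real_inner \<Rightarrow> 'a"
  assumes "locally_lipschitz X" and s: "solves X \<alpha> T" "solves X \<beta> T" and "\<alpha> 0 = \<beta> 0" "t \<in> {0..T}"
  shows "\<alpha> t = \<beta> t"
proof -
  have "bounded (\<alpha> ` {0..T} \<union> \<beta> ` {0..T})"
    using s by (intro compact_imp_bounded compact_Un compact_continuous_image solves_continuous) auto
  then obtain R where R: "\<And>z. z \<in> \<alpha> ` {0..T} \<union> \<beta> ` {0..T} \<Longrightarrow> norm z \<le> R"
    unfolding bounded_iff by blast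
  obtain C where C: "\<And>z w. norm z \<le> R \<Longrightarrow> norm w \<le> R \<Longrightarrow> norm (X z - X w) \<le> C * norm (z - w)"
    by (rule locally_lipschitzE[OF assms(1)]) blast
  have "\<alpha> t - \<beta> t = 0"
  proof (rule gronwall_zero)
    fix t assume "t \<in> {0..T}"
    then show "((\<lambda>t. \<alpha> t - \<beta> t) has_vector_derivative X (\<alpha> t) - X (\<beta> t)) (at t within {0..T})"
      using s unfolding solves_def by (intro has_vector_derivative_diff) auto
    show "norm (X (\<alpha> t) - X (\<beta> t)) \<le> C * norm (\<alpha> t - \<beta> t)"
      using R \<open>t \<in> {0..T}\<close> by (intro C) auto
  qed (use assms in auto)
  then show ?thesis by simp
qed

lemma solves_time_reversed:
  assumes "solves X \<gamma> T"
  shows "solves (\<lambda>z. - X z) (\<lambda>t. \<gamma> (T - t)) T"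
  unfolding solves_def
proof
  fix t assume t: "t \<in> {0..T}"
  have "(\<gamma> has_vector_derivative X (\<gamma> (T - t))) (at (T - t) within (\<lambda>t. T - t) ` {0..T})"
    using assms t unfolding solves_def by (auto intro!: has_vector_derivative_within_subset[of \<gamma> _ _ "{0..T}"])
  then have "((\<gamma> \<circ> (\<lambda>t. T - t)) has_vector_derivative (-1) *\<^sub>R X (\<gamma> (T - t))) (at t within {0..T})"
    by (intro vector_diff_chain_within) (auto intro!: derivative_eq_intros)
  then show "((\<lambda>t. \<gamma> (T - t)) has_vector_derivative - X (\<gamma> (T - t))) (at t within {0..T})"
    by (simp add: o_def)
qed

text \<open>The curve is parametrized by an angle and has velocity \<open>g\<close> times the field.
  The elapsed time \<open>\<tau>\<close> is the integral of \<open>g\<close>, and running along its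
  inverse \<open>\<phi>\<close> removes the factor \<open>g\<close>.\<close>

lemma reparametrize_arc:
  fixes \<gamma> :: "real \<Rightarrow> 'a::real_normed_vector"
  assumes "L > 0"
    and der: "\<And>s. s \<in> {0..L} \<Longrightarrow> (\<gamma> has_vector_derivative g s *\<^sub>R X (\<gamma> s)) (at s within {0..L})"
    and g: "continuous_on {0..L} g" "\<And>s. s \<in> {0..L} \<Longrightarrow> g s > 0"
  obtains T \<phi> where "T > 0" "\<phi> 0 = 0" "\<phi> T = L" "\<phi> ` {0..T} = {0..L}" "\<And>t. t \<in> {0<..<T} \<Longrightarrow> \<phi> t \<in> {0<..<L}"
    "solves X (\<lambda>t. \<gamma> (\<phi> t)) T"
proof -
  \<comment> \<open>Clamping extends \<open>g\<close> continuously and positively beyond both ends,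
    so that 0 and \<open>L\<close> become interior points of \<open>S\<close> and the inverse
    function rule applies to them as well.\<close>
  define G where "G s = g (max 0 (min L s))" for s
  have Gc: "continuous_on S G" for S
  proof -
    have "continuous_on S (\<lambda>s. max 0 (min L s))"
      by (intro continuous_on_max continuous_on_min continuous_on_const continuous_on_id)
    moreover have "(\<lambda>s. max 0 (min L s)) ` S \<subseteq> {0..L}" using \<open>L > 0\<close> by auto
    ultimately show ?thesis
      unfolding G_def by (rule continuous_on_compose2[OF g(1)])
  qed
  have Gpos: "G s > 0" for s unfolding G_def using g(2) \<open>L > 0\<close> by auto
  define \<tau> where "\<tau> s = integral {-1..s} G - integral {-1..0} G" for s
  define S where "S = {-1<..<L + 1}"
  have d: "(\<tau> has_real_derivative G s) (at s)" if "s \<in> S" for s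
  proof -
    have "((\<lambda>s. integral {-1..s} G) has_vector_derivative G s) (at s within {-1..L + 1})"
      by (rule integral_has_vector_derivative[OF Gc]) (use that in \<open>simp add: S_def\<close>)
    then have "(\<tau> has_vector_derivative G s - 0) (at s within {-1..L + 1})"
      unfolding \<tau>_def by (rule has_vector_derivative_diff) (rule has_vector_derivative_const)
    then have "(\<tau> has_vector_derivative G s) (at s within {-1..L + 1})" by simp
    then have "(\<tau> has_vector_derivative G s) (at s within S)"
      by (rule has_vector_derivative_within_subset) (auto simp: S_def)
    moreover have "at s within S = at s"
      by (rule at_within_open[OF that]) (simp add: S_def)
    ultimately show ?thesis
      by (simp add: has_real_derivative_iff_has_vector_derivative)
  qed
  have mono: "\<tau> s < \<tau> s'" if "s < s'" "s \<in> S" "s' \<in> S" for s s'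
  proof (rule DERIV_pos_imp_increasing[OF that(1)])
    fix x assume "s \<le> x" "x \<le> s'"
    then have "x \<in> S" using that by (auto simp: S_def)
    then show "\<exists>y. (\<tau> has_real_derivative y) (at x) \<and> 0 < y" using d Gpos by blast
  qed
  have inj: "inj_on \<tau> S"
  proof (rule inj_onI)
    fix x y assume "x \<in> S" "y \<in> S" "\<tau> x = \<tau> y"
    then show "x = y" using mono[of x y] mono[of y x] by linarith
  qed
  define \<phi> where "\<phi> = the_inv_into S \<tau>"
  have \<phi>: "\<phi> (\<tau> s) = s" if "s \<in> S" for s
    unfolding \<phi>_def using the_inv_into_f_f[OF inj that] .
  have cont: "continuous_on S \<tau>"
    using d by (meson DERIV_continuous continuous_at_imp_continuous_on)
  have sub: "{0..L} \<subseteq> S" unfolding S_def using \<open>L > 0\<close> by auto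
  define T where "T = \<tau> L"
  have \<tau>0: "\<tau> 0 = 0" by (simp add: \<tau>_def)
  have "0 \<in> S" "L \<in> S" using sub \<open>L > 0\<close> by auto
  then have "T > 0" using mono[of 0 L] \<open>L > 0\<close> \<tau>0 by (simp add: T_def)
  have img: "\<exists>s\<in>{0..L}. t = \<tau> s" if "t \<in> {0..T}" for t
  proof -
    have "\<exists>s\<ge>0. s \<le> L \<and> \<tau> s = t"
      using that \<open>L > 0\<close> \<tau>0 by (intro IVT' continuous_on_subset[OF cont sub]) (auto simp: T_def)
    then show ?thesis by auto
  qed
  have mono_le: "\<tau> s \<le> \<tau> s'" if "s \<le> s'" "s \<in> {0..L}" "s' \<in> {0..L}" for s s'
    using mono[of s s'] that subsetD[OF sub, of s] subsetD[OF sub, of s'] by (cases "s = s'") auto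
  have sub': "\<phi> ` {0..T} \<subseteq> {0..L}"
  proof (rule image_subsetI)
    fix t assume "t \<in> {0..T}"
    then obtain s where "s \<in> {0..L}" "t = \<tau> s" using img by blast
    then show "\<phi> t \<in> {0..L}" using \<phi>[of s] sub by (simp add: subset_iff)
  qed
  show thesis
  proof (rule that)
    show "T > 0" by fact
    show "\<phi> 0 = 0" using \<phi>[of 0] \<tau>0 \<open>0 \<in> S\<close> by simp
    show "\<phi> T = L" using \<phi>[of L] \<open>L \<in> S\<close> by (simp add: T_def)
    show "\<phi> ` {0..T} = {0..L}"
    proof
      show "\<phi> ` {0..T} \<subseteq> {0..L}" using sub' .
      show "{0..L} \<subseteq> \<phi> ` {0..T}"
      proof
        fix s assume s: "s \<in> {0..L}"
        then have "\<tau> s \<in> {0..T}" using mono_le[of 0 s] mono_le[of s L] \<tau>0 by (auto simp: T_def)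
        then show "s \<in> \<phi> ` {0..T}" using \<phi>[of s] s sub by (metis imageI subsetD)
      qed
    qed
    show "\<phi> t \<in> {0<..<L}" if "t \<in> {0<..<T}" for t
    proof -
      have "t \<in> {0..T}" using that by auto
      then obtain s where s: "s \<in> {0..L}" "t = \<tau> s" using img by blast
      then have "s \<noteq> 0" "s \<noteq> L" using that \<tau>0 by (auto simp: T_def)
      then show ?thesis using s \<phi>[of s] subsetD[OF sub s(1)] by auto
    qed
    show "solves X (\<lambda>t. \<gamma> (\<phi> t)) T"
      unfolding solves_def
    proof
      fix t assume t: "t \<in> {0..T}"
      obtain s where s: "s \<in> {0..L}" "t = \<tau> s" using img[OF t] by blast
      have sS: "s \<in> S" using subsetD[OF sub s(1)] .
      have "(\<phi> has_real_derivative inverse (G s)) (at t)"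
        unfolding s(2)
        by (rule has_field_derivative_inverse_strong[OF d[OF sS]]) (use Gpos[of s] sS cont \<phi> in \<open>auto simp: S_def\<close>)
      then have D: "(\<phi> has_vector_derivative inverse (g s)) (at t within {0..T})"
        using s(1) by (simp add: G_def has_real_derivative_iff_has_vector_derivative has_vector_derivative_at_within)
      have "\<phi> t = s" using \<phi>[OF sS] s by simp
      have "(\<gamma> has_vector_derivative g s *\<^sub>R X (\<gamma> s)) (at (\<phi> t) within \<phi> ` {0..T})"
        using der[OF s(1)] \<open>\<phi> t = s\<close> sub' by (auto intro: has_vector_derivative_within_subset)
      from vector_diff_chain_within[OF D this]
      show "((\<lambda>t. \<gamma> (\<phi> t)) has_vector_derivative X (\<gamma> (\<phi> t))) (at t within {0..T})"
        using g(2)[OF s(1)] \<open>\<phi> t = s\<close> by (simp add: o_def)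
    qed
  qed
qed

section \<open>Polar coordinates for a half system\<close>

type_synonym half_params = "real \<times> real \<times> real \<times> real \<times> real"

text \<open>The parameter \<open>k\<close> is 1 for the upper and -1 for the lower half system,
  since reflection turns 1 - y into 1 + y.\<close>

fun half_field :: "half_params \<Rightarrow> real \<times> real \<Rightarrow> real \<times> real" where
  "half_field (D, L, M, N, k) (x, y) = (- y + D * x + L * x\<^sup>2 + M * x * y + N * y\<^sup>2, x * (1 - k * y))"

fun upper_half :: "params \<Rightarrow> half_params" where
  "upper_half (d, l, m1, m2, n1, n2) = (d, l, m1, n1, 1)"

text \<open>The lower half system under the reflection \<open>y \<mapsto> - y\<close> and time reversal, so that both half-return
  maps become maps through \<open>y > 0\<close>.\<close>

fun lower_half :: "params \<Rightarrow> half_params" where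
  "lower_half (d, l, m1, m2, n1, n2) = (- d, - l, m2, - n2, - 1)"

definition half_return :: "half_params \<Rightarrow> real \<Rightarrow> real \<Rightarrow> bool" where
  "half_return q r s \<longleftrightarrow> r > 0 \<and> s > 0 \<and> orbit_arc (half_field q) {z. snd z > 0} (r, 0) (- s, 0)"

text \<open>Only \<open>D\<close> enters the linear Abel coefficient, whose bound does not improve
  for small radius. The other parameters occur with a power of the radius, so an arbitrary bound
  \<open>C\<close> is harmless.\<close>

fun half_box :: "real \<Rightarrow> half_params \<Rightarrow> bool" where
  "half_box C (D, L, M, N, k) \<longleftrightarrow>
     1 \<le> C \<and> \<bar>D\<bar> \<le> 1/64 \<and> \<bar>L\<bar> \<le> C \<and> \<bar>M\<bar> \<le> C \<and> \<bar>N\<bar> \<le> C \<and> \<bar>k\<bar> \<le> C"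

fun polar_A :: "half_params \<Rightarrow> real \<Rightarrow> real" where
  "polar_A (D, L, M, N, k) t = cos t * (L * (cos t)\<^sup>2 + M * cos t * sin t + (N - k) * (sin t)\<^sup>2)"

fun polar_B :: "half_params \<Rightarrow> real \<Rightarrow> real" where
  "polar_B (D, L, M, N, k) t = sin t * ((L + k) * (cos t)\<^sup>2 + M * cos t * sin t + N * (sin t)\<^sup>2)"

text \<open>The derivative of \<open>polar_B\<close>, arranged so that a bound can be read off
  factor by factor.\<close>

fun polar_B' :: "half_params \<Rightarrow> real \<Rightarrow> real" where
  "polar_B' (D, L, M, N, k) t =
     (L + k) * (cos t * (cos t)\<^sup>2 - 2 * (cos t * (sin t)\<^sup>2)) + M * (2 * ((cos t)\<^sup>2 * sin t) - sin t * (sin t)\<^sup>2)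
     + N * (3 * ((sin t)\<^sup>2 * cos t))"

fun polar_D :: "half_params \<Rightarrow> real \<Rightarrow> real" where
  "polar_D (D, L, M, N, k) t = 1 - D * (cos t * sin t)"

fun polar_D' :: "half_params \<Rightarrow> real \<Rightarrow> real" where
  "polar_D' (D, L, M, N, k) t = - D * ((cos t)\<^sup>2 - (sin t)\<^sup>2)"

text \<open>In polar coordinates \<open>r' = D c\<^sup>2 r + A r\<^sup>2\<close>, \<open>\<theta>' = polar_D - B r\<close>. Cherkas' substitution
  \<open>w = r / (polar_D - B r)\<close>, which is the identity on the \<open>x\<close>-axis, turns this into the Abel equation
  \<open>dw/d\<theta> = a\<^sub>1 w + a\<^sub>2 w\<^sup>2 + a\<^sub>3 w\<^sup>3\<close> with the following coefficients.\<close>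

definition abel1 :: "half_params \<Rightarrow> real \<Rightarrow> real" where
  "abel1 q t = (fst q * (cos t)\<^sup>2 - polar_D' q t) / polar_D q t"

definition abel2 :: "half_params \<Rightarrow> real \<Rightarrow> real" where
  "abel2 q t = polar_B q t * (2 * (fst q * (cos t)\<^sup>2) - polar_D' q t) / polar_D q t + polar_A q t + polar_B' q t"

definition abel3 :: "half_params \<Rightarrow> real \<Rightarrow> real" where
  "abel3 q t = (fst q * (cos t)\<^sup>2) * (polar_B q t)\<^sup>2 / polar_D q t + polar_A q t * polar_B q t"

definition half_sol :: "half_params \<Rightarrow> real \<Rightarrow> complex \<Rightarrow> complex" where
  "half_sol q = abel_sol (abel1 q) (abel2 q) (abel3 q)"

lemma abs_add_le: "\<bar>x\<bar> \<le> a \<Longrightarrow> \<bar>y\<bar> \<le> b \<Longrightarrow> \<bar>x + y\<bar> \<le> a + b" for x y :: real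
  by linarith

lemma abs_diff_le: "\<bar>x\<bar> \<le> a \<Longrightarrow> \<bar>y\<bar> \<le> b \<Longrightarrow> \<bar>x - y\<bar> \<le> a + b" for x y :: real
  by linarith

lemma abs_mult_le: "\<bar>x\<bar> \<le> a \<Longrightarrow> \<bar>y\<bar> \<le> b \<Longrightarrow> \<bar>x * y\<bar> \<le> a * b" for x y :: real
  unfolding abs_mult by (rule mult_mono) auto

lemma abs_cos_sq_le: "\<bar>(cos t)\<^sup>2\<bar> \<le> (1 :: real)" and abs_sin_sq_le: "\<bar>(sin t)\<^sup>2\<bar> \<le> (1 :: real)"
  using sin_cos_squared_add[of t] zero_le_power2[of "sin t"] zero_le_power2[of "cos t"]
  unfolding abs_power2 by linarith+

lemma polar_bounds:
  assumes "half_box C q"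
  shows "\<bar>fst q\<bar> \<le> 1/64" "\<bar>polar_A q t\<bar> \<le> 4 * C" "\<bar>polar_B q t\<bar> \<le> 4 * C" "\<bar>polar_B' q t\<bar> \<le> 12 * C"
    "63/64 \<le> polar_D q t" "polar_D q t \<le> 65/64" "\<bar>polar_D' q t\<bar> \<le> 1/32"
proof -
  obtain D L M N k where q: "q = (D, L, M, N, k)" by (cases q)
  have b: "\<bar>D\<bar> \<le> 1/64" "\<bar>L\<bar> \<le> C" "\<bar>M\<bar> \<le> C" "\<bar>N\<bar> \<le> C" "\<bar>k\<bar> \<le> C" "1 \<le> C"
    using assms q by auto
  note i = abs_add_le abs_diff_le abs_mult_le abs_cos_le_one abs_sin_le_one abs_cos_sq_le abs_sin_sq_le b
  show "\<bar>fst q\<bar> \<le> 1/64" using b q by simp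
  have "\<bar>polar_A q t\<bar> \<le> 1 * (C * 1 + C * 1 * 1 + (C + C) * 1)"
    unfolding q polar_A.simps by (intro i)
  then show "\<bar>polar_A q t\<bar> \<le> 4 * C" by simp
  have "\<bar>polar_B q t\<bar> \<le> 1 * ((C + C) * 1 + C * 1 * 1 + C * 1)"
    unfolding q polar_B.simps by (intro i)
  then show "\<bar>polar_B q t\<bar> \<le> 4 * C" by simp
  have n: "\<bar>2\<bar> \<le> (2::real)" "\<bar>3\<bar> \<le> (3::real)" by auto
  have "\<bar>polar_B' q t\<bar> \<le> (C + C) * (1 * 1 + 2 * (1 * 1)) + C * (2 * (1 * 1) + 1 * 1) + C * (3 * (1 * 1))"
    unfolding q polar_B'.simps by (intro i n)
  then show "\<bar>polar_B' q t\<bar> \<le> 12 * C" by simp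
  have "\<bar>D * (cos t * sin t)\<bar> \<le> 1/64 * (1 * 1)" by (intro i)
  then show "63/64 \<le> polar_D q t" "polar_D q t \<le> 65/64" unfolding q by auto
  have "\<bar>- D * ((cos t)\<^sup>2 - (sin t)\<^sup>2)\<bar> \<le> 1/64 * (1 + 1)"
    by (intro abs_mult_le abs_diff_le abs_cos_sq_le abs_sin_sq_le) (use b in simp)
  then show "\<bar>polar_D' q t\<bar> \<le> 1/32" unfolding q by auto
qed

lemma polar_deriv:
  "(polar_B q has_real_derivative polar_B' q t) (at t within S)"
  "(polar_D q has_real_derivative polar_D' q t) (at t within S)"
proof -
  obtain D L M N k where q: "q = (D, L, M, N, k)" by (cases q)
  show "(polar_B q has_real_derivative polar_B' q t) (at t within S)"
    unfolding q polar_B.simps[abs_def] polar_B'.simps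
    by (rule derivative_eq_intros refl)+ (simp add: algebra_simps power2_eq_square)
  show "(polar_D q has_real_derivative polar_D' q t) (at t within S)"
    unfolding q polar_D.simps[abs_def] polar_D'.simps
    by (rule derivative_eq_intros refl)+ (simp add: algebra_simps power2_eq_square)
qed

lemma polar_continuous:
  "continuous_on S (polar_A q)" "continuous_on S (polar_B q)" "continuous_on S (polar_B' q)"
  "continuous_on S (polar_D q)" "continuous_on S (polar_D' q)"
proof -
  obtain D L M N k where q: "q = (D, L, M, N, k)" by (cases q)
  show "continuous_on S (polar_A q)" "continuous_on S (polar_B q)" "continuous_on S (polar_B' q)"
    "continuous_on S (polar_D q)" "continuous_on S (polar_D' q)"
    unfolding q polar_A.simps[abs_def] polar_B.simps[abs_def] polar_B'.simps[abs_def] polar_D.simps[abs_def]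
      polar_D'.simps[abs_def]
    by (intro continuous_intros)+
qed

text \<open>For |D| <= 1/64 the linear coefficient is at most (1/64 + 1/32) / (63/64) = 1/21, below
  the required 1/16. The constant 100 C^2 covers \<open>abel2\<close>, of size C, and
  \<open>abel3\<close>, of size C^2.\<close>

lemma abel_half:
  assumes "half_box C q"
  shows "abel (abel1 q) (abel2 q) (abel3 q) (100 * C\<^sup>2)"
proof
  note b = polar_bounds[OF assms]
  have C: "C \<ge> 1" using assms by (cases q) auto
  then have CC: "C \<le> C\<^sup>2" by (simp add: power2_eq_square mult_left_le)
  have nz: "polar_D q t \<noteq> 0" for t using b(5)[of t] by linarith
  show "continuous_on {0..pi} (abel1 q)" "continuous_on {0..pi} (abel2 q)" "continuous_on {0..pi} (abel3 q)"
    unfolding abel1_def abel2_def abel3_def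
    by (intro continuous_intros polar_continuous ballI nz)+
  show "1 \<le> 100 * C\<^sup>2" using C CC by linarith
  have inv: "\<bar>1 / polar_D q t\<bar> \<le> 64/63" for t
    using b(5)[of t] by (simp add: abs_if field_simps)
  have fc: "\<bar>fst q * (cos t)\<^sup>2\<bar> \<le> 1/64 * 1" for t by (intro abs_mult_le b abs_cos_sq_le)
  fix t
  have "\<bar>(fst q * (cos t)\<^sup>2 - polar_D' q t) * (1 / polar_D q t)\<bar> \<le> (1/64 * 1 + 1/32) * (64/63)"
    by (intro abs_mult_le abs_diff_le b fc inv)
  then show "\<bar>abel1 q t\<bar> \<le> 1/16" unfolding abel1_def by simp
  have "\<bar>polar_B q t * (2 * (fst q * (cos t)\<^sup>2) - polar_D' q t) * (1 / polar_D q t) + polar_A q t + polar_B' q t\<bar>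
      \<le> 4 * C * (2 * (1/64 * 1) + 1/32) * (64/63) + 4 * C + 12 * C"
    by (intro abs_mult_le abs_diff_le abs_add_le b fc inv) auto
  also have "\<dots> \<le> 100 * C" using C by simp
  also have "\<dots> \<le> 100 * C\<^sup>2" using CC by simp
  finally show "\<bar>abel2 q t\<bar> \<le> 100 * C\<^sup>2" unfolding abel2_def by simp
  have "\<bar>(fst q * (cos t)\<^sup>2) * (polar_B q t * polar_B q t) * (1 / polar_D q t) + polar_A q t * polar_B q t\<bar>
      \<le> 1/64 * 1 * (4 * C * (4 * C)) * (64/63) + 4 * C * (4 * C)"
    by (intro abs_mult_le abs_diff_le abs_add_le b fc inv)
  also have "\<dots> \<le> 100 * C\<^sup>2" using C by (simp add: power2_eq_square)
  finally show "\<bar>abel3 q t\<bar> \<le> 100 * C\<^sup>2" unfolding abel3_def by (simp add: power2_eq_square)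
qed

text \<open>The radius \<open>rad\<close> of the Abel equation for the bound 100 C^2 of
  \<open>abel_half\<close>.\<close>

definition half_radius :: "real \<Rightarrow> real" where "half_radius C = 1 / (10000 * C\<^sup>2)"

lemma half_radius_pos: "half_box C q \<Longrightarrow> half_radius C > 0"
  by (cases q) (auto simp: half_radius_def)

lemma half_radius_le: "half_box C q \<Longrightarrow> half_radius C \<le> 1 / (10000 * C)"
  by (cases q) (auto simp: half_radius_def field_simps power2_eq_square)

context
  fixes C q
  assumes box: "half_box C q"
begin

interpretation abel "abel1 q" "abel2 q" "abel3 q" "100 * C\<^sup>2" by (rule abel_half[OF box])

lemma rad_eq: "rad = half_radius C"
  by (simp add: rad_def half_radius_def)

lemma half_sol_bound: "t \<in> {0..pi} \<Longrightarrow> norm \<rho> \<le> half_radius C \<Longrightarrow> norm (half_sol q t \<rho> - 1) \<le> 1/2"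
  using sol_bound by (simp add: half_sol_def rad_eq)

lemma half_sol_holomorphic: "t \<in> {0..pi} \<Longrightarrow> half_sol q t holomorphic_on ball 0 (half_radius C)"
  using sol_holomorphic by (simp add: half_sol_def rad_eq)

lemma half_sol_continuous: "norm \<rho> \<le> half_radius C \<Longrightarrow> continuous_on {0..pi} (\<lambda>t. half_sol q t \<rho>)"
  using sol_continuous by (simp add: half_sol_def rad_eq)

lemma half_sol_real: "t \<in> {0..pi} \<Longrightarrow> \<bar>r\<bar> \<le> half_radius C \<Longrightarrow> half_sol q t (of_real r) = of_real (Re (half_sol q t (of_real r)))"
  using sol_real[of t r] by (simp add: half_sol_def rad_eq)

lemma half_sol_0: "norm \<rho> \<le> half_radius C \<Longrightarrow> half_sol q 0 \<rho> = 1"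
  using sol_0 by (simp add: half_sol_def rad_eq)

lemma half_sol_Re_bounds:
  assumes "t \<in> {0..pi}" "\<bar>r\<bar> \<le> half_radius C"
  shows "1/2 \<le> Re (half_sol q t (of_real r))" "Re (half_sol q t (of_real r)) \<le> 3/2"
  using half_sol_bound[of t "of_real r"] assms complex_Re_le_cmod[of "half_sol q t (of_real r) - 1"]
    complex_Re_le_cmod[of "1 - half_sol q t (of_real r)"] by (auto simp: norm_minus_commute)

lemma half_sol_deriv:
  assumes "t \<in> {0..pi}" "\<bar>r\<bar> \<le> half_radius C"
  defines "w \<equiv> \<lambda>t. Re (half_sol q t (of_real r))"
  shows "(w has_real_derivative abel1 q t * w t + abel2 q t * r * (w t)\<^sup>2 + abel3 q t * r\<^sup>2 * (w t) ^ 3) (at t within {0..pi})"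
proof -
  have "((\<lambda>t. half_sol q t (of_real r)) has_vector_derivative abel_rhs (abel1 q) (abel2 q) (abel3 q) t (of_real r) (half_sol q t (of_real r))) (at t within {0..pi})"
    using sol_deriv[of t "of_real r"] assms(1,2) by (simp add: half_sol_def rad_eq)
  then have "(w has_vector_derivative Re (abel_rhs (abel1 q) (abel2 q) (abel3 q) t (of_real r) (half_sol q t (of_real r)))) (at t within {0..pi})"
    unfolding w_def by (rule bounded_linear.has_vector_derivative[OF bounded_linear_Re])
  moreover have "abel_rhs (abel1 q) (abel2 q) (abel3 q) t (of_real r) (half_sol q t (of_real r)) =
      of_real (abel1 q t * w t + abel2 q t * r * (w t)\<^sup>2 + abel3 q t * r\<^sup>2 * (w t) ^ 3)"
    unfolding w_def abel_rhs_def by (subst (1 2 3) half_sol_real[OF assms(1,2)]) simp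
  ultimately show ?thesis by (simp add: has_real_derivative_iff_has_vector_derivative)
qed

text \<open>A real solution of the Abel equation is turned back into an orbit by inverting Cherkas'
  substitution. The factor \<open>g\<close> is the reciprocal of the angular velocity, because the
  curve is parametrized by the angle.\<close>

lemma polar_arc:
  assumes r: "0 < r" "r \<le> half_radius C"
  obtains R g where "continuous_on {0..pi} R" "\<And>t. t \<in> {0..pi} \<Longrightarrow> 0 < R t \<and> R t \<le> 4 * r" "R 0 = r"
    "R pi = r * Re (half_sol q pi (of_real r))"
    "continuous_on {0..pi} g" "\<And>t. t \<in> {0..pi} \<Longrightarrow> 0 < g t"
    "\<And>t. t \<in> {0..pi} \<Longrightarrow> ((\<lambda>t. (R t * cos t, R t * sin t)) has_vector_derivative
        g t *\<^sub>R half_field q (R t * cos t, R t * sin t)) (at t within {0..pi})"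
proof -
  note b = polar_bounds[OF box]
  have C: "C \<ge> 1" using box by (cases q) auto
  define W where "W t = Re (half_sol q t (of_real r))" for t
  define w where "w t = r * W t" for t
  define u where "u t = 1 + polar_B q t * w t" for t
  \<comment> \<open>Obtained by solving w = R / (\<open>polar_D\<close> - \<open>polar_B\<close> R)
    for R. Then \<open>polar_D\<close> - \<open>polar_B\<close> R equals \<open>polar_D\<close> /
    \<open>u\<close>, whose reciprocal is \<open>g\<close>.\<close>
  define R where "R t = polar_D q t * w t / u t" for t
  define g where "g t = u t / polar_D q t" for t
  have W: "1/2 \<le> W t" "W t \<le> 3/2" if "t \<in> {0..pi}" for t
    using half_sol_Re_bounds[OF that, of r] r by (auto simp: W_def)
  have w: "0 < w t" "w t \<le> 3/2 * r" if "t \<in> {0..pi}" for t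
    unfolding w_def using W[OF that] r by (auto simp: mult.commute)
  have u: "1/2 \<le> u t" "u t \<le> 3/2" if "t \<in> {0..pi}" for t
  proof -
    have "\<bar>polar_B q t * w t\<bar> \<le> 4 * C * (3/2 * (1 / (10000 * C)))"
      using w[OF that] r half_radius_le[OF box] by (intro abs_mult_le b) auto
    then have "\<bar>polar_B q t * w t\<bar> \<le> 1/2" using C by simp
    then show "1/2 \<le> u t" "u t \<le> 3/2" unfolding u_def by linarith+
  qed
  have Dpos: "polar_D q t > 0" for t using b(5)[of t] by linarith
  have cW: "continuous_on {0..pi} W"
    unfolding W_def using half_sol_continuous[of "of_real r"] r by (intro continuous_intros) auto
  have cw: "continuous_on {0..pi} w" unfolding w_def by (intro continuous_intros cW)
  have cu: "continuous_on {0..pi} u" unfolding u_def by (intro continuous_intros cw polar_continuous)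
  have nz: "u t \<noteq> 0" if "t \<in> {0..pi}" for t using u[OF that] by linarith
  show thesis
  proof (rule that[of R g])
    show "continuous_on {0..pi} R" unfolding R_def
      by (intro continuous_intros cw cu polar_continuous ballI nz)
    show "continuous_on {0..pi} g" unfolding g_def
      by (intro continuous_intros cu polar_continuous ballI) (use Dpos in \<open>metis less_irrefl\<close>)
    show "0 < g t" if "t \<in> {0..pi}" for t
      unfolding g_def using u[OF that] Dpos[of t] by simp
    show "0 < R t \<and> R t \<le> 4 * r" if "t \<in> {0..pi}" for t
    proof
      show "0 < R t" unfolding R_def using u[OF that] w[OF that] Dpos[of t] by simp
      have "polar_D q t * w t \<le> 65/64 * (3/2 * r)"
        using b(6)[of t] Dpos[of t] w[OF that] by (intro mult_mono) auto
      also have "\<dots> \<le> 4 * r * u t" using mult_left_mono[OF u(1)[OF that], of "4 * r"] r by simp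
      finally show "R t \<le> 4 * r" unfolding R_def using u(1)[OF that] by (simp add: pos_divide_le_eq)
    qed
    \<comment> \<open>At the angles 0 and pi the sine vanishes, so \<open>polar_B\<close> is 0,
      \<open>polar_D\<close> is 1, and \<open>R\<close> coincides with \<open>w\<close>.\<close>
    have "half_sol q 0 (of_real r) = 1" using half_sol_0[of "of_real r"] r by simp
    then show "R 0 = r" unfolding R_def u_def w_def W_def by (cases q) simp
    show "R pi = r * Re (half_sol q pi (of_real r))" unfolding R_def u_def w_def W_def by (cases q) simp
    fix t assume t: "t \<in> {0..pi}"
    obtain D L M N k where q: "q = (D, L, M, N, k)" by (cases q)
    define A B B' d d' s c where defs: "A = polar_A q t" "B = polar_B q t" "B' = polar_B' q t"
      "d = polar_D q t" "d' = polar_D' q t" "s = sin t" "c = cos t"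
    define w' where "w' = (D * c\<^sup>2 - d') / d * w t + (B * (2 * (D * c\<^sup>2) - d') / d + A + B') * (w t)\<^sup>2
       + (D * c\<^sup>2 * B\<^sup>2 / d + A * B) * (w t) ^ 3"
    have d0: "d \<noteq> 0" using Dpos[of t] by (simp add: defs)
    have dW: "(W has_real_derivative abel1 q t * W t + abel2 q t * r * (W t)\<^sup>2 + abel3 q t * r\<^sup>2 * (W t) ^ 3) (at t within {0..pi})"
      unfolding W_def using half_sol_deriv[OF t, of r] r by simp
    have dw: "(w has_real_derivative w') (at t within {0..pi})"
      unfolding w_def
      by (rule derivative_eq_intros refl dW)+
         (simp add: w'_def abel1_def abel2_def abel3_def q w_def defs algebra_simps power2_eq_square power3_eq_cube)
    \<comment> \<open>Clearing the denominator and grouping by powers of u = 1 + B w gives the form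
      in which the quotient rule for \<open>R\<close> simplifies.\<close>
    have w'd: "w' * d = D * c\<^sup>2 * w t * (u t)\<^sup>2 - d' * w t * u t + d * (A * (w t)\<^sup>2 * u t + B' * (w t)\<^sup>2)"
      unfolding w'_def u_def defs(2)[symmetric] using d0
      by (simp add: field_simps power2_eq_square power3_eq_cube)
    have du: "(u has_real_derivative B' * w t + B * w') (at t within {0..pi})"
      unfolding u_def by (rule derivative_eq_intros refl dw polar_deriv)+ (simp add: defs)
    define R' where "R' = u t / d * (D * c\<^sup>2 * R t + A * (R t)\<^sup>2)"
    have dR: "(R has_real_derivative R') (at t within {0..pi})"
      unfolding R_def
    proof (rule derivative_eq_intros refl dw du polar_deriv nz[OF t])+
      have "((d' * w t + w' * d) * u t - d * w t * (B' * w t + B * w')) / (u t * u t) = R'"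
      proof -
        have "(d' * w t + w' * d) * u t - d * w t * (B' * w t + B * w') =
           d' * w t * u t + (w' * d) * (u t - B * w t) - d * B' * (w t)\<^sup>2"
          by (simp add: algebra_simps power2_eq_square)
        also have "u t - B * w t = 1" by (simp add: u_def defs)
        also have "d' * w t * u t + (w' * d) * 1 - d * B' * (w t)\<^sup>2 = D * c\<^sup>2 * w t * (u t)\<^sup>2 + d * A * (w t)\<^sup>2 * u t"
          unfolding w'd by (simp add: algebra_simps)
        also have "\<dots> = R' * (u t * u t)"
          unfolding R'_def R_def defs(4)[symmetric] using d0 nz[OF t]
          by (simp add: field_simps power2_eq_square)
        finally show ?thesis using nz[OF t] by (simp add: field_simps)
      qed
      then show "((polar_D' q t * w t + w' * polar_D q t) * u t - polar_D q t * w t * (B' * w t + B * w')) / (u t * u t) = R'"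
        by (simp add: defs)
    qed
    have g1: "g t * (d - R t * B) = 1"
    proof -
      have "d - R t * B = d / u t"
        unfolding R_def defs(4)[symmetric] using nz[OF t] by (simp add: field_simps u_def defs)
      then show ?thesis unfolding g_def defs(4)[symmetric] using nz[OF t] d0 by simp
    qed
    have R'g: "R' = g t * (D * c\<^sup>2 * R t + A * (R t)\<^sup>2)" by (simp add: R'_def g_def defs)
    have dd: "d = 1 - D * (c * s)" and AA: "A = c * (L * c\<^sup>2 + M * c * s + (N - k) * s\<^sup>2)"
      and BB: "B = s * ((L + k) * c\<^sup>2 + M * c * s + N * s\<^sup>2)"
      by (simp_all add: defs q)
    \<comment> \<open>Radial and angular velocity are combined back into the Cartesian field; the
      surplus degree in \<open>s\<close> and \<open>c\<close> is removed by s^2 + c^2 = 1.\<close>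
    have X1: "(D * c\<^sup>2 * R t + A * (R t)\<^sup>2) * c - R t * s * (d - R t * B) =
       - (R t * s) + D * (R t * c) + L * (R t * c)\<^sup>2 + M * (R t * c) * (R t * s) + N * (R t * s)\<^sup>2"
    proof -
      have "A * c + s * B = L * c\<^sup>2 + M * c * s + N * s\<^sup>2"
      proof -
        have "A * c + s * B = (s\<^sup>2 + c\<^sup>2) * (L * c\<^sup>2 + M * c * s + N * s\<^sup>2)"
          unfolding AA BB by (simp add: algebra_simps power2_eq_square)
        then show ?thesis by (simp add: defs)
      qed
      moreover have "(D * c\<^sup>2 * R t + A * (R t)\<^sup>2) * c - R t * s * (d - R t * B) =
          (D * c\<^sup>2 * R t * c - R t * s * d) + (R t)\<^sup>2 * (A * c + s * B)"
        by (simp add: algebra_simps power2_eq_square)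
      ultimately have "(D * c\<^sup>2 * R t + A * (R t)\<^sup>2) * c - R t * s * (d - R t * B) =
          (D * c\<^sup>2 * R t * c - R t * s * d) + (R t)\<^sup>2 * (L * c\<^sup>2 + M * c * s + N * s\<^sup>2)"
        by simp
      also have "D * c\<^sup>2 * R t * c - R t * s * d = - (R t * s) + D * (R t * c) * (s\<^sup>2 + c\<^sup>2)"
        unfolding dd by (simp add: algebra_simps power2_eq_square)
      also have "s\<^sup>2 + c\<^sup>2 = 1" by (simp add: defs)
      finally show ?thesis by (simp add: algebra_simps power2_eq_square)
    qed
    have X2: "(D * c\<^sup>2 * R t + A * (R t)\<^sup>2) * s + R t * c * (d - R t * B) = R t * c * (1 - k * (R t * s))"
    proof -
      have "(D * c\<^sup>2 * R t + A * (R t)\<^sup>2) * s + R t * c * (d - R t * B) = R t * c * (1 - k * (R t * s) * (s\<^sup>2 + c\<^sup>2))"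
        unfolding dd AA BB by (simp add: algebra_simps power2_eq_square)
      also have "s\<^sup>2 + c\<^sup>2 = 1" by (simp add: defs)
      finally show ?thesis by simp
    qed
    have dx: "((\<lambda>t. R t * cos t) has_real_derivative R' * c - R t * s) (at t within {0..pi})"
      by (rule derivative_eq_intros refl dR)+ (simp add: defs)
    have dy: "((\<lambda>t. R t * sin t) has_real_derivative R' * s + R t * c) (at t within {0..pi})"
      by (rule derivative_eq_intros refl dR)+ (simp add: defs)
    have dist1: "g t * (P * c - R t * s * Q) = g t * P * c - R t * s * (g t * Q)" for P Q
      by (simp add: algebra_simps)
    have dist2: "g t * (P * s + R t * c * Q) = g t * P * s + R t * c * (g t * Q)" for P Q
      by (simp add: algebra_simps)
    have e1: "R' * c - R t * s = g t * ((D * c\<^sup>2 * R t + A * (R t)\<^sup>2) * c - R t * s * (d - R t * B))"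
      unfolding dist1 g1 R'g by simp
    have e2: "R' * s + R t * c = g t * ((D * c\<^sup>2 * R t + A * (R t)\<^sup>2) * s + R t * c * (d - R t * B))"
      unfolding dist2 g1 R'g by simp
    have "((\<lambda>t. (R t * cos t, R t * sin t)) has_vector_derivative (R' * c - R t * s, R' * s + R t * c)) (at t within {0..pi})"
      using dx dy unfolding has_real_derivative_iff_has_vector_derivative by (rule has_vector_derivative_Pair)
    note this[unfolded e1 e2 X1 X2]
    then show "((\<lambda>t. (R t * cos t, R t * sin t)) has_vector_derivative
        g t *\<^sub>R half_field q (R t * cos t, R t * sin t)) (at t within {0..pi})"
      unfolding q half_field.simps scaleR_Pair real_scaleR_def defs .
  qed
qed

end

section \<open>Half-return maps\<close>

lemma half_field_eq:
  "half_field (D, L, M, N, k) = (\<lambda>z. ((-1) * snd z + D * fst z + L * fst z ^ 2 + M * fst z * snd z + N * snd z ^ 2,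
     fst z * (1 + (- k) * snd z)))"
  by (rule ext) (auto simp: split_beta)

lemma half_field_lipschitz: "locally_lipschitz (half_field q)"
  by (cases q) (simp only: half_field_eq, intro locally_lipschitz_intros)

lemma upper_field_eq_half: "upper_field p = half_field (upper_half p)"
  by (rule ext, cases p) (auto simp: split_beta)

text \<open>With the positive part of y the two branches become one formula that is visibly locally
  Lipschitz across y = 0, which gives uniqueness of solutions of the piecewise system.\<close>

lemma pw_field_eq:
  "pw_field (d, l, m1, m2, n1, n2) = (\<lambda>z. ((-1) * snd z + d * fst z + l * fst z ^ 2 + m2 * fst z * snd z + n2 * snd z ^ 2
      + (m1 - m2) * fst z * max (snd z) 0 + (n1 - n2) * max (snd z) 0 ^ 2,
     fst z * (1 + (- 1) * snd z)))"
  by (rule ext) (auto simp: pw_field_def split_beta max_def algebra_simps)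

lemma pw_field_lipschitz: "locally_lipschitz (pw_field p)"
  by (cases p) (simp only: pw_field_eq, intro locally_lipschitz_intros)

lemma pw_field_upper: "snd z \<ge> 0 \<Longrightarrow> pw_field p z = upper_field p z"
  using upper_field_eq_lower_field[of z p] by (cases "snd z = 0") (auto simp: pw_field_def)

lemma pw_field_lower: "snd z \<le> 0 \<Longrightarrow> pw_field p z = lower_field p z"
  by (auto simp: pw_field_def)

definition reflect :: "real \<times> real \<Rightarrow> real \<times> real" where "reflect z = (fst z, - snd z)"

lemma reflect_reflect [simp]: "reflect (reflect z) = z"
  and fst_reflect [simp]: "fst (reflect z) = fst z"
  and snd_reflect [simp]: "snd (reflect z) = - snd z"
  and reflect_axis [simp]: "reflect (x, 0) = (x, 0)"
  and norm_reflect [simp]: "norm (reflect z) = norm z"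
  by (auto simp: reflect_def norm_Pair norm_prod_def)

lemma lower_field_reflect: "half_field (lower_half p) (reflect z) = - reflect (lower_field p z)"
  by (cases p; cases z) (auto simp: reflect_def)

lemma lower_field_reflect': "lower_field p (reflect z) = - reflect (half_field (lower_half p) z)"
  using lower_field_reflect[of p "reflect z"] by (simp add: reflect_def prod_eq_iff)

lemma bounded_linear_reflect: "bounded_linear reflect"
  unfolding reflect_def[abs_def]
  by (intro bounded_linear_Pair bounded_linear_minus bounded_linear_fst bounded_linear_snd)

lemma solves_reversal:
  assumes "solves X \<gamma> T" and R: "bounded_linear R" "\<And>z. Y (R z) = - R (X z)"
  shows "solves Y (\<lambda>t. R (\<gamma> (T - t))) T"
  unfolding solves_def R(2)
proof
  fix t assume t: "t \<in> {0..T}"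
  have "((\<lambda>t. \<gamma> (T - t)) has_vector_derivative - X (\<gamma> (T - t))) (at t within {0..T})"
    using solves_time_reversed[OF assms(1)] t by (auto simp: solves_def)
  from bounded_linear.has_vector_derivative[OF R(1) this]
  show "((\<lambda>t. R (\<gamma> (T - t))) has_vector_derivative - R (X (\<gamma> (T - t)))) (at t within {0..T})"
    by (simp add: linear_neg[OF bounded_linear.linear[OF R(1)]])
qed

lemma orbit_arc_iff:
  "orbit_arc X S a b \<longleftrightarrow> (\<exists>T>0. \<exists>\<gamma>. solves X \<gamma> T \<and> \<gamma> 0 = a \<and> \<gamma> T = b \<and> (\<forall>t\<in>{0<..<T}. \<gamma> t \<in> S))"
  unfolding orbit_arc_def solves_def by blast

lemma half_return1_iff: "half_return1 p r s \<longleftrightarrow> half_return (upper_half p) r s"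
  by (simp add: half_return1_def half_return_def upper_field_eq_half)

text \<open>Used with two reversing maps: the reflection in the x-axis, which relates the lower
  field to its half system, and later x to -x, which produces the reversible centers.\<close>

lemma orbit_arc_reversal:
  assumes "orbit_arc X S a b" "bounded_linear R" "\<And>z. Y (R z) = - R (X z)"
  shows "orbit_arc Y (R ` S) (R b) (R a)"
proof -
  obtain T \<gamma> where T: "T > 0" "solves X \<gamma> T" "\<gamma> 0 = a" "\<gamma> T = b" "\<forall>t\<in>{0<..<T}. \<gamma> t \<in> S"
    using assms(1) unfolding orbit_arc_iff by blast
  show ?thesis
    unfolding orbit_arc_iff
    using T solves_reversal[OF T(2) assms(2,3)]
    by (intro exI[of _ T] conjI exI[of _ "\<lambda>t. R (\<gamma> (T - t))"]) auto
qed

lemma reflect_image: "reflect ` {z. 0 < snd z} = {z. snd z < 0}" "reflect ` {z. snd z < 0} = {z. 0 < snd z}"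
proof -
  have "reflect ` S = {z. reflect z \<in> S}" for S
    by (auto simp: image_iff) (metis reflect_reflect)
  then show "reflect ` {z. 0 < snd z} = {z. snd z < 0}" "reflect ` {z. snd z < 0} = {z. 0 < snd z}"
    by simp_all
qed

lemma half_return2_iff: "half_return2 p s r \<longleftrightarrow> half_return (lower_half p) r s"
  unfolding half_return2_def half_return_def
  using orbit_arc_reversal[of "lower_field p" "{z. snd z < 0}" "(- s, 0)" "(r, 0)" reflect "half_field (lower_half p)", OF _ bounded_linear_reflect lower_field_reflect]
    orbit_arc_reversal[of "half_field (lower_half p)" "{z. 0 < snd z}" "(r, 0)" "(- s, 0)" reflect "lower_field p", OF _ bounded_linear_reflect lower_field_reflect']
  by (auto simp: reflect_image)

text \<open>Both arcs agree as long as both run; one that ended earlier would be on the axis while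
  the other is still strictly above it.\<close>

lemma upper_arc_unique:
  fixes X :: "real \<times> real \<Rightarrow> real \<times> real"
  assumes "locally_lipschitz X" "solves X \<alpha> T" "solves X \<beta> S" "\<alpha> 0 = \<beta> 0" "T > 0" "S > 0"
    and "\<forall>t\<in>{0<..<T}. snd (\<alpha> t) > 0" "\<forall>t\<in>{0<..<S}. snd (\<beta> t) > 0"
    and "snd (\<alpha> T) = 0" "snd (\<beta> S) = 0"
  shows "T = S" "\<And>t. t \<in> {0..T} \<Longrightarrow> \<alpha> t = \<beta> t"
proof -
  have *: "\<alpha> t = \<beta> t" if "t \<in> {0..min T S}" for t
  proof (rule solves_unique[where X = X and T = "min T S"])
    show "locally_lipschitz X" "\<alpha> 0 = \<beta> 0" "t \<in> {0..min T S}" by fact+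
    show "solves X \<alpha> (min T S)" by (rule solves_subset[OF assms(2)]) simp
    show "solves X \<beta> (min T S)" by (rule solves_subset[OF assms(3)]) simp
  qed
  have "\<not> T < S"
  proof
    assume "T < S"
    then have "snd (\<beta> T) > 0" using assms(5) by (intro bspec[OF assms(8)]) simp
    moreover have "\<alpha> T = \<beta> T" using \<open>T < S\<close> assms(5) by (intro *) simp
    ultimately show False using assms(9) by simp
  qed
  moreover have "\<not> S < T"
  proof
    assume "S < T"
    then have "snd (\<alpha> S) > 0" using assms(6) by (intro bspec[OF assms(7)]) simp
    moreover have "\<alpha> S = \<beta> S" using \<open>S < T\<close> assms(6) by (intro *) simp
    ultimately show False using assms(10) by simp
  qed
  ultimately show "T = S" by simp
  with * show "\<And>t. t \<in> {0..T} \<Longrightarrow> \<alpha> t = \<beta> t" by simp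
qed

lemma half_return_unique:
  assumes "half_return q r s" "half_return q r s'"
  shows "s = s'"
proof -
  obtain T \<gamma> where T: "T > 0" "solves (half_field q) \<gamma> T" "\<gamma> 0 = (r, 0)" "\<gamma> T = (- s, 0)" "\<forall>t\<in>{0<..<T}. snd (\<gamma> t) > 0"
    using assms(1) unfolding half_return_def orbit_arc_iff by blast
  obtain S \<delta> where S: "S > 0" "solves (half_field q) \<delta> S" "\<delta> 0 = (r, 0)" "\<delta> S = (- s', 0)" "\<forall>t\<in>{0<..<S}. snd (\<delta> t) > 0"
    using assms(2) unfolding half_return_def orbit_arc_iff by blast
  have e: "\<gamma> 0 = \<delta> 0" "snd (\<gamma> T) = 0" "snd (\<delta> S) = 0" using T(3,4) S(3,4) by simp_all
  have "T = S"
    by (rule upper_arc_unique(1)[OF half_field_lipschitz T(2) S(2) e(1) T(1) S(1) T(5) S(5) e(2,3)])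
  moreover have "\<gamma> T = \<delta> T"
    by (rule upper_arc_unique(2)[OF half_field_lipschitz T(2) S(2) e(1) T(1) S(1) T(5) S(5) e(2,3)]) (use T(1) in simp)
  ultimately show ?thesis using T(4) S(4) by simp
qed

text \<open>The value of the Abel variable w = rho W at the angle pi, where it is the distance to
  the origin.\<close>

definition half_map :: "half_params \<Rightarrow> real \<Rightarrow> real" where
  "half_map q r = r * Re (half_sol q pi (of_real r))"

lemma half_map_bounds:
  assumes "half_box C q" "0 < r" "r \<le> half_radius C"
  shows "r / 2 \<le> half_map q r" "half_map q r \<le> 3/2 * r"
proof -
  have "1/2 \<le> Re (half_sol q pi (of_real r))" "Re (half_sol q pi (of_real r)) \<le> 3/2"
    using half_sol_Re_bounds[OF assms(1), of pi r] assms(2,3) by simp_all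
  then have "r * (1/2) \<le> half_map q r" "half_map q r \<le> r * (3/2)"
    unfolding half_map_def using assms(2) by (intro mult_left_mono; simp)+
  then show "r / 2 \<le> half_map q r" "half_map q r \<le> 3/2 * r" by simp_all
qed

lemma half_arc_exists:
  assumes "half_box C q" "0 < r" "r \<le> half_radius C"
  obtains T \<gamma> R where "T > 0" "solves (half_field q) \<gamma> T" "\<gamma> 0 = (r, 0)" "\<gamma> T = (- half_map q r, 0)"
    "\<And>t. t \<in> {0<..<T} \<Longrightarrow> snd (\<gamma> t) > 0"
    "continuous_on {0..pi} R" "\<And>t. t \<in> {0..pi} \<Longrightarrow> 0 < R t \<and> R t \<le> 4 * r" "R 0 = r" "R pi = half_map q r"
    "\<gamma> ` {0..T} = (\<lambda>t. (R t * cos t, R t * sin t)) ` {0..pi}"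
proof -
  obtain R g where R: "continuous_on {0..pi} R" "\<And>t. t \<in> {0..pi} \<Longrightarrow> 0 < R t \<and> R t \<le> 4 * r" "R 0 = r"
    "R pi = r * Re (half_sol q pi (of_real r))"
    "continuous_on {0..pi} g" "\<And>t. t \<in> {0..pi} \<Longrightarrow> 0 < g t"
    "\<And>t. t \<in> {0..pi} \<Longrightarrow> ((\<lambda>t. (R t * cos t, R t * sin t)) has_vector_derivative
        g t *\<^sub>R half_field q (R t * cos t, R t * sin t)) (at t within {0..pi})"
    by (rule polar_arc[OF assms]) (rule that)
  obtain T \<phi> where T: "T > 0" "\<phi> 0 = 0" "\<phi> T = pi" "\<phi> ` {0..T} = {0..pi}" "\<And>t. t \<in> {0<..<T} \<Longrightarrow> \<phi> t \<in> {0<..<pi}"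
    "solves (half_field q) (\<lambda>t. (R (\<phi> t) * cos (\<phi> t), R (\<phi> t) * sin (\<phi> t))) T"
    by (rule reparametrize_arc[OF pi_gt_zero R(7) R(5,6)]) (assumption | rule that)+
  show thesis
  proof (rule that[OF T(1) T(6) _ _ _ R(1,2,3)])
    show "R pi = half_map q r" using R(4) by (simp add: half_map_def)
    then show "(R (\<phi> T) * cos (\<phi> T), R (\<phi> T) * sin (\<phi> T)) = (- half_map q r, 0)" using T(3) by simp
    show "(R (\<phi> 0) * cos (\<phi> 0), R (\<phi> 0) * sin (\<phi> 0)) = (r, 0)" using T(2) R(3) by simp
    show "snd (R (\<phi> t) * cos (\<phi> t), R (\<phi> t) * sin (\<phi> t)) > 0" if "t \<in> {0<..<T}" for t
      using T(5)[OF that] R(2)[of "\<phi> t"] sin_gt_zero[of "\<phi> t"] by simp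
    show "(\<lambda>t. (R (\<phi> t) * cos (\<phi> t), R (\<phi> t) * sin (\<phi> t))) ` {0..T} = (\<lambda>t. (R t * cos t, R t * sin t)) ` {0..pi}"
      unfolding T(4)[symmetric] image_image ..
  qed
qed

text \<open>Existence comes from the polar arc and uniqueness from
  \<open>half_return_unique\<close>, so the definite descriptions \<open>Pi1\<close> and
  \<open>Pi2_inv\<close> can be replaced by an explicit analytic formula.\<close>

lemma half_return_iff_half_map:
  assumes "half_box C q" "0 < r" "r \<le> half_radius C"
  shows "half_return q r s \<longleftrightarrow> s = half_map q r"
proof -
  have "half_map q r > 0" using half_map_bounds[OF assms] assms(2) by linarith
  moreover obtain T \<gamma> where "T > 0" "solves (half_field q) \<gamma> T" "\<gamma> 0 = (r, 0)" "\<gamma> T = (- half_map q r, 0)"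
    "\<And>t. t \<in> {0<..<T} \<Longrightarrow> snd (\<gamma> t) > 0"
    by (rule half_arc_exists[OF assms]) (rule that)
  ultimately have "half_return q r (half_map q r)"
    unfolding half_return_def orbit_arc_iff using assms(2) by blast
  then show ?thesis using half_return_unique by blast
qed

definition params_box :: "real \<Rightarrow> params \<Rightarrow> bool" where
  "params_box C p \<longleftrightarrow> half_box C (upper_half p) \<and> half_box C (lower_half p)"

definition disp_quot :: "params \<Rightarrow> complex \<Rightarrow> complex" where
  "disp_quot p \<rho> = half_sol (lower_half p) pi \<rho> - half_sol (upper_half p) pi \<rho>"

lemma displacement_eq:
  assumes "params_box C p" "0 < r" "r \<le> half_radius C"
  shows "displacement_defined p r"
    and "displacement p r = half_map (lower_half p) r - half_map (upper_half p) r"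
    and "displacement p r = r * Re (disp_quot p (of_real r))"
proof -
  have b: "half_box C (upper_half p)" "half_box C (lower_half p)"
    using assms(1) by (auto simp: params_box_def)
  note i = half_return_iff_half_map[OF b(1) assms(2,3)] half_return_iff_half_map[OF b(2) assms(2,3)]
  show "displacement_defined p r"
    unfolding displacement_defined_def half_return1_iff half_return2_iff i by simp
  show *: "displacement p r = half_map (lower_half p) r - half_map (upper_half p) r"
    unfolding displacement_def Pi1_def Pi2_inv_def half_return1_iff half_return2_iff i by simp
  then show "displacement p r = r * Re (disp_quot p (of_real r))"
    by (simp add: half_map_def disp_quot_def right_diff_distrib)
qed

text \<open>The derivative is W + r W'. On the disc of radius \<open>half_radius C / 2\<close> about
  \<open>r\<close> one has |W - 1| <= 1/2, so Cauchy's inequality gives |r W'| <= 1/8, while W >=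
  1/2.\<close>

lemma half_map_deriv_pos:
  assumes "half_box C q" "\<bar>r\<bar> \<le> half_radius C / 8"
  obtains D where "(half_map q has_real_derivative D) (at r)" "D > 0"
proof -
  let ?W = "half_sol q pi"
  have \<delta>: "half_radius C > 0" using half_radius_pos[OF assms(1)] .
  have hol: "?W holomorphic_on ball 0 (half_radius C)" using half_sol_holomorphic[OF assms(1)] by simp
  have dW: "(?W has_field_derivative deriv ?W (of_real r)) (at (of_real r))"
    using assms(2) \<delta> by (intro holomorphic_derivI[OF hol]) auto
  have dRe: "((\<lambda>x. Re (?W (of_real x))) has_real_derivative Re (deriv ?W (of_real r))) (at r)"
    using bounded_linear.has_vector_derivative[OF bounded_linear_Re has_vector_derivative_real_field[OF dW]]
    by (simp add: has_real_derivative_iff_has_vector_derivative)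
  have d: "(half_map q has_real_derivative 1 * Re (?W (of_real r)) + r * Re (deriv ?W (of_real r))) (at r)"
    unfolding half_map_def[abs_def] using DERIV_mult[OF DERIV_ident dRe] by (simp add: mult.commute)
  have sub: "cball (of_real r) (half_radius C / 2) \<subseteq> (ball 0 (half_radius C) :: complex set)"
  proof
    fix z :: complex assume "z \<in> cball (of_real r) (half_radius C / 2)"
    then have "norm (z - of_real r) \<le> half_radius C / 2" by (simp add: dist_norm norm_minus_commute)
    then have "norm z \<le> half_radius C / 2 + \<bar>r\<bar>" using norm_triangle_ineq[of "z - of_real r" "of_real r"] by simp
    then show "z \<in> ball 0 (half_radius C)" using assms(2) \<delta> by simp
  qed
  have "norm ((deriv ^^ 1) (\<lambda>z. ?W z - 1) (of_real r)) \<le> fact 1 * (1/2) / (half_radius C / 2) ^ 1"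
  proof (rule Cauchy_inequality)
    show "(\<lambda>z. ?W z - 1) holomorphic_on ball (of_real r) (half_radius C / 2)"
      using sub ball_subset_cball by (intro holomorphic_intros holomorphic_on_subset[OF hol]) blast
    show "continuous_on (cball (of_real r) (half_radius C / 2)) (\<lambda>z. ?W z - 1)"
      by (intro continuous_intros holomorphic_on_imp_continuous_on holomorphic_on_subset[OF hol sub])
    fix x :: complex assume "norm (of_real r - x) = half_radius C / 2"
    then have "x \<in> cball (of_real r) (half_radius C / 2)" by (simp add: dist_norm)
    then have "norm x < half_radius C" using sub by auto
    then show "norm (?W x - 1) \<le> 1/2" using half_sol_bound[OF assms(1), of pi x] by simp
  qed (use \<delta> in auto)
  moreover have "deriv (\<lambda>z. ?W z - 1) (of_real r) = deriv ?W (of_real r)"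
    using dW by (intro DERIV_imp_deriv) (auto intro!: derivative_eq_intros)
  ultimately have "norm (deriv ?W (of_real r)) \<le> 1 / half_radius C" by simp
  then have "\<bar>Re (deriv ?W (of_real r))\<bar> \<le> 1 / half_radius C"
    using abs_Re_le_cmod order_trans by blast
  then have "\<bar>r * Re (deriv ?W (of_real r))\<bar> \<le> (half_radius C / 8) * (1 / half_radius C)"
    using assms(2) by (intro abs_mult_le)
  then have "\<bar>r * Re (deriv ?W (of_real r))\<bar> \<le> 1/8" using \<delta> by simp
  moreover have "1/2 \<le> Re (?W (of_real r))"
    using half_sol_Re_bounds(1)[OF assms(1), of pi r] assms(2) \<delta> by simp
  ultimately have "1 * Re (?W (of_real r)) + r * Re (deriv ?W (of_real r)) > 0" by linarith
  with d show thesis using that by blast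
qed

lemma half_map_strict_mono:
  assumes "half_box C q" "0 \<le> r" "r < s" "s \<le> half_radius C / 8"
  shows "half_map q r < half_map q s"
proof (rule DERIV_pos_imp_increasing[OF assms(3)])
  fix x assume "r \<le> x" "x \<le> s"
  then have "\<bar>x\<bar> \<le> half_radius C / 8" using assms by auto
  from half_map_deriv_pos[OF assms(1) this] show "\<exists>y. (half_map q has_real_derivative y) (at x) \<and> 0 < y" by metis
qed

lemma half_map_continuous:
  assumes "half_box C q"
  shows "continuous_on {0..half_radius C / 8} (half_map q)"
proof (rule continuous_at_imp_continuous_on, rule ballI)
  fix x assume "x \<in> {0..half_radius C / 8}"
  then have "\<bar>x\<bar> \<le> half_radius C / 8" by auto
  from half_map_deriv_pos[OF assms this] show "isCont (half_map q) x" by (metis DERIV_isCont)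
qed

text \<open>The threshold \<open>half_radius C / 16\<close> is the guaranteed lower bound of
  \<open>half_map\<close> at \<open>half_radius C / 8\<close>.\<close>

lemma half_map_surj:
  assumes "half_box C q" "0 < s" "s \<le> half_radius C / 16"
  obtains r where "0 < r" "r \<le> half_radius C / 8" "half_map q r = s"
proof -
  have \<delta>: "half_radius C > 0" using half_radius_pos[OF assms(1)] .
  have lb: "half_radius C / 8 / 2 \<le> half_map q (half_radius C / 8)"
    using half_map_bounds(1)[OF assms(1), of "half_radius C / 8"] \<delta> by simp
  have "\<exists>x\<ge>0. x \<le> half_radius C / 8 \<and> half_map q x = s"
  proof (rule IVT')
    show "half_map q 0 \<le> s" using assms(2) by (simp add: half_map_def)
    show "s \<le> half_map q (half_radius C / 8)" using lb assms(3) by linarith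
  qed (use \<delta> half_map_continuous[OF assms(1)] in auto)
  then obtain r where "r \<ge> 0" "r \<le> half_radius C / 8" "half_map q r = s" by blast
  moreover have "r \<noteq> 0" using calculation assms(2) by (auto simp: half_map_def)
  ultimately show thesis using that[of r] by simp
qed

section \<open>Focal values\<close>

text \<open>The antiderivative of \<open>abel2\<close> for D = 0. The summand M / 3 makes it vanish
  at 0, and its value at pi is 2 M / 3.\<close>

fun polar_alpha :: "half_params \<Rightarrow> real \<Rightarrow> real" where
  "polar_alpha (D, L, M, N, k) t = M / 3 + (2 * L + k) * ((cos t)\<^sup>2 * sin t) + (2 * L + 4 * N - k) / 3 * sin t ^ 3
     + M * (cos t * (sin t)\<^sup>2 - cos t ^ 3 / 3)"

lemma abel_D0:
  assumes "fst q = 0"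
  shows "abel1 q t = 0" "abel2 q t = polar_A q t + polar_B' q t" "abel3 q t = polar_A q t * polar_B q t"
  using assms by (cases q; simp add: abel1_def abel2_def abel3_def)+

lemma polar_alpha_deriv:
  assumes "fst q = 0"
  shows "(polar_alpha q has_real_derivative abel2 q t) (at t within S)"
proof -
  obtain L M N k where q: "q = (0, L, M, N, k)" using assms by (cases q) auto
  have "((\<lambda>t. M / 3 + (2 * L + k) * ((cos t)\<^sup>2 * sin t) + (2 * L + 4 * N - k) / 3 * sin t ^ 3
     + M * (cos t * (sin t)\<^sup>2 - cos t ^ 3 / 3)) has_real_derivative abel2 q t) (at t within S)"
    unfolding abel_D0[OF assms]
    unfolding q
    by (auto intro!: derivative_eq_intros simp: field_simps power2_eq_square power3_eq_cube)
  then show ?thesis by (simp add: q polar_alpha.simps[abs_def])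
qed

text \<open>Dividing the Abel equation by W^2 gives (1/W)' = - r \<open>abel2\<close> - r^2
  \<open>abel3\<close> W, and the first summand has the antiderivative
  \<open>polar_alpha\<close>.\<close>

lemma half_sol_inverse:
  assumes box: "half_box C q" and "fst q = 0" "0 < r" "r \<le> half_radius C" "t \<in> {0..pi}"
  shows "1 / Re (half_sol q t (of_real r)) = 1 - r * polar_alpha q t - r\<^sup>2 * integral {0..t} (\<lambda>u. abel3 q u * Re (half_sol q u (of_real r)))"
proof -
  define W where "W t = Re (half_sol q t (of_real r))" for t
  have pos: "W u \<ge> 1/2" if "u \<in> {0..pi}" for u
    using half_sol_Re_bounds(1)[OF box that, of r] assms by (simp add: W_def)
  have cW: "continuous_on {0..pi} W"
    unfolding W_def using half_sol_continuous[OF box, of "of_real r"] assms by (intro continuous_intros) auto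
  have ca: "continuous_on {0..pi} (abel3 q)"
    using abel.cont(3)[OF abel_half[OF box]] .
  define F where "F t = 1 / W t + r * polar_alpha q t + r\<^sup>2 * integral {0..t} (\<lambda>u. abel3 q u * W u)" for t
  have "\<exists>c. \<forall>u\<in>{0..pi}. F u = c"
  proof (rule has_derivative_zero_constant)
    fix u assume u: "u \<in> {0..pi}"
    have "(W has_real_derivative abel2 q u * r * (W u)\<^sup>2 + abel3 q u * r\<^sup>2 * (W u) ^ 3) (at u within {0..pi})"
      using half_sol_deriv[OF box u, of r] assms abel_D0(1)[OF assms(2)] by (simp add: W_def[abs_def])
    moreover have "((\<lambda>t. integral {0..t} (\<lambda>u. abel3 q u * W u)) has_real_derivative abel3 q u * W u) (at u within {0..pi})"
      by (intro integral_has_real_derivative continuous_intros ca cW u)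
    ultimately have "(F has_real_derivative
         - (abel2 q u * r * (W u)\<^sup>2 + abel3 q u * r\<^sup>2 * (W u) ^ 3) / (W u * W u) + r * abel2 q u + r\<^sup>2 * (abel3 q u * W u)) (at u within {0..pi})"
      unfolding F_def using pos[OF u] polar_alpha_deriv[OF assms(2), of u "{0..pi}"]
      by (auto intro!: derivative_eq_intros)
    moreover have "- (abel2 q u * r * (W u)\<^sup>2 + abel3 q u * r\<^sup>2 * (W u) ^ 3) / (W u * W u) + r * abel2 q u + r\<^sup>2 * (abel3 q u * W u) = 0"
      using pos[OF u] by (simp add: field_simps power2_eq_square power3_eq_cube)
    ultimately show "(F has_derivative (\<lambda>h. 0)) (at u within {0..pi})"
      by (simp add: has_field_derivative_def lambda_zero)
  qed simp
  then have "F t = F 0" using assms(5) by fastforce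
  also have "F 0 = 1"
  proof -
    have "W 0 = 1" using half_sol_0[OF box, of "of_real r"] assms by (simp add: W_def)
    moreover have "polar_alpha q 0 = 0" by (cases q) simp
    ultimately show ?thesis by (simp add: F_def)
  qed
  finally show ?thesis by (simp add: F_def W_def)
qed

text \<open>The numbers \<open>focal2\<close> and \<open>focal3\<close> are the coefficients of r^2
  and r^3 in 1 - 1/W at the angle pi; they come from inserting W = 1 + r \<open>polar_alpha\<close>
  + ... into the integral of \<open>abel3\<close> W.\<close>

definition focal2 :: "half_params \<Rightarrow> real" where
  "focal2 q = integral {0..pi} (abel3 q)"

definition focal3 :: "half_params \<Rightarrow> real" where
  "focal3 q = integral {0..pi} (\<lambda>t. abel3 q t * polar_alpha q t)"

lemma real_integral_bound:
  fixes f :: "real \<Rightarrow> real"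
  assumes "continuous_on {0..pi} f" "t \<in> {0..pi}" "\<And>u. u \<in> {0..pi} \<Longrightarrow> \<bar>f u\<bar> \<le> K"
  shows "\<bar>integral {0..t} f\<bar> \<le> 4 * K"
proof -
  have "norm (integral {0..t} f) \<le> K * (t - 0)"
    using assms by (intro integral_bound continuous_on_subset[OF assms(1)]) auto
  also have "\<dots> \<le> K * 4"
    using assms(2) assms(3)[OF assms(2)] pi_less_4 by (intro mult_left_mono) auto
  finally show ?thesis by simp
qed

text \<open>The estimate is bootstrapped: |W - 1| is of order r, the identity for 1/W then shows
  that W - 1 - r alpha is of order r^2, and inserting this into the integral of \<open>abel3\<close>
  W leaves an error of order r^4.\<close>

lemma half_sol_expansion:
  assumes box: "half_box C q" and D0: "fst q = 0"
  obtains K where "\<And>r. 0 < r \<Longrightarrow> r \<le> half_radius C \<Longrightarrow>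
    \<bar>1 / Re (half_sol q pi (of_real r)) - (1 - r * polar_alpha q pi - r\<^sup>2 * focal2 q - r ^ 3 * focal3 q)\<bar> \<le> K * r ^ 4"
proof -
  interpret abel "abel1 q" "abel2 q" "abel3 q" "100 * C\<^sup>2" by (rule abel_half[OF box])
  define Q where "Q = 100 * C\<^sup>2"
  have Q: "Q \<ge> 1" using bounds(4) by (simp add: Q_def)
  have a3: "\<bar>abel3 q t\<bar> \<le> Q" if "t \<in> {0..pi}" for t using bounds(3)[OF that] by (simp add: Q_def)
  have calpha: "continuous_on {0..pi} (polar_alpha q)"
    using polar_alpha_deriv[OF D0] by (meson DERIV_continuous continuous_on_eq_continuous_within)
  have alpha: "\<bar>polar_alpha q t\<bar> \<le> 4 * Q" if t: "t \<in> {0..pi}" for t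
  proof -
    have "(abel2 q has_integral polar_alpha q t - polar_alpha q 0) {0..t}"
      using t polar_alpha_deriv[OF D0] unfolding has_real_derivative_iff_has_vector_derivative
      by (intro fundamental_theorem_of_calculus) auto
    moreover have "polar_alpha q 0 = 0" by (cases q) simp
    ultimately have "polar_alpha q t = integral {0..t} (abel2 q)" by (simp add: integral_unique)
    also have "\<bar>\<dots>\<bar> \<le> 4 * Q"
      using t bounds(2) by (intro real_integral_bound cont) (auto simp: Q_def)
    finally show ?thesis .
  qed
  define K where "K = 4 * (Q * (32 * Q * (4 * Q) + 3/2 * (4 * (Q * (3/2)))))"
  show thesis
  proof (rule that[of K])
    fix r assume r: "0 < r" "r \<le> half_radius C"
    define W where "W t = Re (half_sol q t (of_real r))" for t
    have cW: "continuous_on {0..pi} W"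
      unfolding W_def using half_sol_continuous[OF box, of "of_real r"] r by (intro continuous_intros) auto
    have W: "\<bar>W t\<bar> \<le> 3/2" "W t \<ge> 1/2" if "t \<in> {0..pi}" for t
      using half_sol_Re_bounds[OF box that, of r] r by (auto simp: W_def)
    have W1: "\<bar>W t - 1\<bar> \<le> 32 * Q * r" if t: "t \<in> {0..pi}" for t
    proof -
      have "norm (half_sol q t (of_real r) - 1) \<le> 32 * (100 * C\<^sup>2) * norm (complex_of_real r)"
        unfolding half_sol_def using r t abel_D0(1)[OF D0]
        by (intro sol_minus_1_linear) (auto simp: rad_eq[OF box])
      moreover have "\<bar>W t - 1\<bar> \<le> norm (half_sol q t (of_real r) - 1)"
        unfolding W_def using abs_Re_le_cmod[of "half_sol q t (of_real r) - 1"] by simp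
      ultimately show ?thesis using r by (simp add: Q_def)
    qed
    define J where "J t = integral {0..t} (\<lambda>u. abel3 q u * W u)" for t
    have J: "\<bar>J t\<bar> \<le> 4 * (Q * (3/2))" if "t \<in> {0..pi}" for t
      unfolding J_def using that
      by (intro real_integral_bound abs_mult_le a3 W continuous_intros cont cW)
    have inv: "1 / W t = 1 - r * polar_alpha q t - r\<^sup>2 * J t" if "t \<in> {0..pi}" for t
      using half_sol_inverse[OF box D0 r that] by (simp add: W_def J_def)
    have W2: "\<bar>W t - 1 - r * polar_alpha q t\<bar> \<le> (32 * Q * (4 * Q) + 3/2 * (4 * (Q * (3/2)))) * r\<^sup>2" if t: "t \<in> {0..pi}" for t
    proof -
      \<comment> \<open>Multiplying the identity for 1/W by W expresses W - 1 - r alpha through W -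
        1, alpha, W and \<open>J\<close>, all already bounded.\<close>
      have "W t * (1 / W t) = 1" using W(2)[OF t] by simp
      then have "W t - 1 - r * polar_alpha q t = ((W t - 1) * polar_alpha q t) * r + (W t * J t) * r\<^sup>2"
        unfolding inv[OF t] by (simp add: algebra_simps)
      also have "\<bar>\<dots>\<bar> \<le> ((32 * Q * r) * (4 * Q)) * r + (3/2 * (4 * (Q * (3/2)))) * r\<^sup>2"
        by (intro abs_add_le abs_mult_le W1 W J alpha t) (use r in auto)
      finally show ?thesis by (simp add: algebra_simps power2_eq_square)
    qed
    have i: "(\<lambda>u. abel3 q u * W u) integrable_on {0..pi}" "abel3 q integrable_on {0..pi}"
      "(\<lambda>u. abel3 q u * polar_alpha q u) integrable_on {0..pi}"
      by (intro integrable_continuous_real continuous_intros cont cW calpha)+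
    have "J pi - focal2 q - r * focal3 q = integral {0..pi} (\<lambda>u. abel3 q u * W u - abel3 q u - r * (abel3 q u * polar_alpha q u))"
      unfolding J_def focal2_def focal3_def
      by (rule integral_unique[symmetric]) (intro has_integral_diff has_integral_mult_right integrable_integral i)
    also have "\<dots> = integral {0..pi} (\<lambda>u. abel3 q u * (W u - 1 - r * polar_alpha q u))"
      by (simp add: algebra_simps)
    also have "\<bar>\<dots>\<bar> \<le> 4 * (Q * ((32 * Q * (4 * Q) + 3/2 * (4 * (Q * (3/2)))) * r\<^sup>2))"
      by (intro real_integral_bound abs_mult_le a3 W2 continuous_intros cont cW calpha) auto
    finally have "\<bar>J pi - focal2 q - r * focal3 q\<bar> \<le> K * r\<^sup>2" by (simp add: K_def algebra_simps)
    then have "\<bar>r\<^sup>2 * (J pi - focal2 q - r * focal3 q)\<bar> \<le> r\<^sup>2 * (K * r\<^sup>2)"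
      unfolding abs_mult by (simp add: mult_left_mono)
    moreover have "1 / W pi - (1 - r * polar_alpha q pi - r\<^sup>2 * focal2 q - r ^ 3 * focal3 q)
       = - (r\<^sup>2 * (J pi - focal2 q - r * focal3 q))"
      using inv[of pi] by (simp add: algebra_simps power2_eq_square power3_eq_cube)
    ultimately show "\<bar>1 / Re (half_sol q pi (of_real r)) - (1 - r * polar_alpha q pi - r\<^sup>2 * focal2 q - r ^ 3 * focal3 q)\<bar> \<le> K * r ^ 4"
      unfolding W_def by (simp add: algebra_simps power2_eq_square power4_eq_xxxx)
  qed
qed

section \<open>Trigonometric integrals behind the focal values\<close>

lemma has_integral_cos_power_sin:
  "((\<lambda>t. cos t ^ n * sin t) has_integral (1 - (- 1) ^ Suc n) / (n + 1)) {0..pi}"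
proof -
  have "((\<lambda>t. cos t ^ n * sin t) has_integral - (cos pi ^ Suc n / (n + 1)) - (- (cos 0 ^ Suc n / (n + 1)))) {0..pi}"
  proof (rule fundamental_theorem_of_calculus)
    fix t :: real
    have "((\<lambda>t. cos t ^ Suc n) has_real_derivative (1 + real n) * (- sin t * cos t ^ n)) (at t within {0..pi})"
      by (rule DERIV_power_Suc) (rule has_field_derivative_at_within[OF DERIV_cos])
    from DERIV_minus[OF DERIV_cdivide[OF this, of "real (n + 1)"]]
    have "((\<lambda>t. - (cos t ^ Suc n / (n + 1))) has_real_derivative cos t ^ n * sin t) (at t within {0..pi})"
      by (rule DERIV_cong) (simp add: field_simps)
    then show "((\<lambda>t. - (cos t ^ Suc n / (n + 1))) has_vector_derivative cos t ^ n * sin t) (at t within {0..pi})"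
      by (simp add: has_real_derivative_iff_has_vector_derivative)
  qed simp
  then show ?thesis by (simp add: add_divide_distrib add.commute)
qed

lemma has_integral_cos_sin_squares:
  "((\<lambda>t. (cos t)\<^sup>2 * (sin t)\<^sup>2) has_integral pi / 8) {0..pi}" (is ?A)
  "((\<lambda>t. cos t ^ 4 * (sin t)\<^sup>2) has_integral pi / 16) {0..pi}" (is ?B)
proof -
  \<comment> \<open>The fractions are hidden behind ring constants, so that the derivative
    identities become polynomial identities modulo sin^2 + cos^2 = 1.\<close>
  define a b :: real where "a = 1/8" and "b = 1/48"
  then have a: "8 * a = 1" and b: "48 * b = 1" by simp_all
  let ?f = "\<lambda>t. a * t - a * (sin t * cos t * ((cos t)\<^sup>2 - (sin t)\<^sup>2))"
  have "((\<lambda>t. (cos t)\<^sup>2 * (sin t)\<^sup>2) has_integral ?f pi - ?f 0) {0..pi}"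
  proof (rule fundamental_theorem_of_calculus)
    fix t :: real
    have "a * 1 - a * ((sin t * (- sin t) + cos t * cos t) * ((cos t)\<^sup>2 - (sin t)\<^sup>2)
        + (- 4 * (cos t * sin t)) * (sin t * cos t)) = (cos t)\<^sup>2 * (sin t)\<^sup>2"
      using sin_cos_squared_add[of t] a by algebra
    then have "(?f has_real_derivative (cos t)\<^sup>2 * (sin t)\<^sup>2) (at t within {0..pi})"
      by (auto intro!: derivative_eq_intros simp: algebra_simps power2_eq_square)
    then show "(?f has_vector_derivative (cos t)\<^sup>2 * (sin t)\<^sup>2) (at t within {0..pi})"
      by (simp add: has_real_derivative_iff_has_vector_derivative)
  qed simp
  then show ?A by (simp add: a_def)
  let ?g = "\<lambda>t. 3 * b * t + 3 * b * (cos t * sin t) + 2 * b * (cos t ^ 3 * sin t) - 8 * b * (cos t ^ 5 * sin t)"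
  have "((\<lambda>t. cos t ^ 4 * (sin t)\<^sup>2) has_integral ?g pi - ?g 0) {0..pi}"
  proof (rule fundamental_theorem_of_calculus)
    fix t :: real
    have "3 * b + 3 * b * (cos t * cos t - sin t * sin t) + 2 * b * (cos t ^ 3 * cos t - 3 * (cos t)\<^sup>2 * sin t * sin t)
        - 8 * b * (cos t ^ 5 * cos t - 5 * cos t ^ 4 * sin t * sin t) = cos t ^ 4 * (sin t)\<^sup>2"
      using sin_cos_squared_add[of t] b by algebra
    then have "(?g has_real_derivative cos t ^ 4 * (sin t)\<^sup>2) (at t within {0..pi})"
      by (auto intro!: derivative_eq_intros simp: algebra_simps)
    then show "(?g has_vector_derivative cos t ^ 4 * (sin t)\<^sup>2) (at t within {0..pi})"
      by (simp add: has_real_derivative_iff_has_vector_derivative)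
  qed simp
  then show ?B by (simp add: b_def)
qed

lemma has_integral_reflect_0_pi:
  fixes f :: "real \<Rightarrow> real"
  assumes "(f has_integral I) {0..pi}"
  shows "((\<lambda>t. f (pi - t)) has_integral I) {0..pi}"
proof -
  have "((\<lambda>x. f (- 1 * x + pi)) has_integral (1 / \<bar>- 1\<bar> ^ DIM(real)) * I) ((\<lambda>x. (1 / - 1) * x + - ((1 / - 1) * pi)) ` cbox 0 pi)"
    using has_integral_affinity[of f I 0 pi "- 1" pi] assms by simp
  moreover have "(\<lambda>x. (1 / - 1) * x + - ((1 / - 1) * pi)) ` cbox 0 pi = {0..pi}"
  proof (intro equalityI subsetI)
    fix x assume "x \<in> {0..pi}"
    then show "x \<in> (\<lambda>x. (1 / - 1) * x + - ((1 / - 1) * pi)) ` cbox 0 pi"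
      by (intro image_eqI[of _ _ "pi - x"]) auto
  qed auto
  ultimately show ?thesis by (simp add: add.commute)
qed

text \<open>Averaging with the mirror image under t -> pi - t removes every term odd in
  \<open>cos t\<close> before integration.\<close>

lemma integral_symmetrize:
  fixes f :: "real \<Rightarrow> real"
  assumes "f integrable_on {0..pi}" "((\<lambda>t. (f t + f (pi - t)) / 2) has_integral J) {0..pi}"
  shows "integral {0..pi} f = J"
proof -
  obtain I where I: "(f has_integral I) {0..pi}" using assms(1) by blast
  have "((\<lambda>t. (f t + f (pi - t)) / 2) has_integral (I + I) / 2) {0..pi}"
    by (intro has_integral_divide has_integral_add I has_integral_reflect_0_pi)
  with assms(2) have "(I + I) / 2 = J" by (rule has_integral_unique[rotated])
  then show ?thesis using I by (simp add: integral_unique)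
qed

text \<open>After symmetrization only M cos^2 sin^2 ((2 L + k) cos^2 + (2 N - k) sin^2) remains.
  Both moments equal pi / 16, and therefore \<open>k\<close> cancels.\<close>

lemma focal2_value: "focal2 (0, L, M, N, k) = M * pi * (L + N) / 8"
  unfolding focal2_def
proof (rule integral_symmetrize)
  let ?q = "(0, L, M, N, k)"
  have a3: "abel3 ?q = (\<lambda>t. polar_A ?q t * polar_B ?q t)" using abel_D0(3)[of ?q] by auto
  show "abel3 ?q integrable_on {0..pi}"
    unfolding a3 by (intro integrable_continuous_real continuous_intros polar_continuous)
  have h: "((\<lambda>t. M * (2 * L + k) * (cos t ^ 4 * (sin t)\<^sup>2) + M * (2 * N - k) * ((cos t)\<^sup>2 * (sin t)\<^sup>2 - cos t ^ 4 * (sin t)\<^sup>2))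
      has_integral M * (2 * L + k) * (pi / 16) + M * (2 * N - k) * (pi / 8 - pi / 16)) {0..pi}"
    by (intro has_integral_add has_integral_mult_right has_integral_diff has_integral_cos_sin_squares)
  have e: "(abel3 ?q t + abel3 ?q (pi - t)) / 2 =
      M * (2 * L + k) * (cos t ^ 4 * (sin t)\<^sup>2) + M * (2 * N - k) * ((cos t)\<^sup>2 * (sin t)\<^sup>2 - cos t ^ 4 * (sin t)\<^sup>2)" for t
  proof -
    have "(abel3 ?q t + abel3 ?q (pi - t)) / 2 =
      M * (2 * L + k) * (cos t ^ 4 * (sin t)\<^sup>2) + M * (2 * N - k) * ((cos t)\<^sup>2 * (sin t)\<^sup>2 * (sin t)\<^sup>2)"
      unfolding a3 by (simp add: field_simps power2_eq_square power4_eq_xxxx)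
    also have "(cos t)\<^sup>2 * (sin t)\<^sup>2 * (sin t)\<^sup>2 = (cos t)\<^sup>2 * (sin t)\<^sup>2 - cos t ^ 4 * (sin t)\<^sup>2"
      using sin_cos_squared_add[of t] by algebra
    finally show ?thesis .
  qed
  have "M * (2 * L + k) * (pi / 16) + M * (2 * N - k) * (pi / 8 - pi / 16) = M * pi * (L + N) / 8"
    by (simp add: field_simps)
  with h show "((\<lambda>t. (abel3 ?q t + abel3 ?q (pi - t)) / 2) has_integral M * pi * (L + N) / 8) {0..pi}"
    by (simp only: e)
qed

text \<open>All but one factor of the sine are expanded in cosines, which leads back to
  \<open>has_integral_cos_power_sin\<close>; 315 is the common multiple of the denominators 3, 5, 7,
  9.\<close>

lemma has_integral_cos_sin_odd:
  "((\<lambda>t. cos t ^ 8 * sin t) has_integral 70/315) {0..pi}"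
  "((\<lambda>t. cos t ^ 6 * sin t ^ 3) has_integral 20/315) {0..pi}"
  "((\<lambda>t. cos t ^ 4 * sin t ^ 5) has_integral 16/315) {0..pi}"
  "((\<lambda>t. cos t ^ 2 * sin t ^ 7) has_integral 32/315) {0..pi}"
proof -
  note I = has_integral_cos_power_sin[of 2] has_integral_cos_power_sin[of 4] has_integral_cos_power_sin[of 6]
    has_integral_cos_power_sin[of 8]
  show "((\<lambda>t. cos t ^ 8 * sin t) has_integral 70/315) {0..pi}" using I(4) by simp
  have "((\<lambda>t. cos t ^ 6 * sin t - cos t ^ 8 * sin t) has_integral 20/315) {0..pi}"
    using has_integral_diff[OF I(3) I(4)] by simp
  moreover have "cos t ^ 6 * sin t - cos t ^ 8 * sin t = cos t ^ 6 * sin t ^ 3" for t :: real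
    using sin_cos_squared_add[of t] by algebra
  ultimately show "((\<lambda>t. cos t ^ 6 * sin t ^ 3) has_integral 20/315) {0..pi}" by simp
  have "((\<lambda>t. cos t ^ 4 * sin t - 2 * (cos t ^ 6 * sin t) + cos t ^ 8 * sin t) has_integral 16/315) {0..pi}"
    using has_integral_add[OF has_integral_diff[OF I(2) has_integral_mult_right[OF I(3), of 2]] I(4)] by simp
  moreover have "cos t ^ 4 * sin t - 2 * (cos t ^ 6 * sin t) + cos t ^ 8 * sin t = cos t ^ 4 * sin t ^ 5" for t :: real
    using sin_cos_squared_add[of t] by algebra
  ultimately show "((\<lambda>t. cos t ^ 4 * sin t ^ 5) has_integral 16/315) {0..pi}" by simp
  have "((\<lambda>t. cos t ^ 2 * sin t - 3 * (cos t ^ 4 * sin t) + (3 * (cos t ^ 6 * sin t) - cos t ^ 8 * sin t)) has_integral 32/315) {0..pi}"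
    using has_integral_add[OF has_integral_diff[OF I(1) has_integral_mult_right[OF I(2), of 3]]
        has_integral_diff[OF has_integral_mult_right[OF I(3), of 3] I(4)]] by simp
  moreover have "cos t ^ 2 * sin t - 3 * (cos t ^ 4 * sin t) + (3 * (cos t ^ 6 * sin t) - cos t ^ 8 * sin t) = cos t ^ 2 * sin t ^ 7" for t :: real
    using sin_cos_squared_add[of t] by algebra
  ultimately show "((\<lambda>t. cos t ^ 2 * sin t ^ 7) has_integral 32/315) {0..pi}" by simp
qed

text \<open>Both factors are split into parts even and odd under t -> pi - t; the average of the
  product is even times even plus odd times odd. \<open>e\<close> is the coefficient of sin^3 in
  \<open>polar_alpha\<close>, and \<open>P\<close> is that of cos^2 sin^2 in the odd part of
  \<open>abel3\<close> divided by cos sin.\<close>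

lemma focal3_value:
  fixes L M N k :: real
  defines "e \<equiv> (2 * L + 4 * N - k) / 3" and "P \<equiv> L * N + (N - k) * (L + k) + M\<^sup>2"
  shows "focal3 (0, L, M, N, k) = M / 3 * focal2 (0, L, M, N, k) + M / 315 * (
    20 * ((2 * L + k)\<^sup>2 + L * (L + k) - P / 3) + 16 * ((2 * L + k) * (e + 2 * N - k) + P - N * (N - k) / 3)
    + 32 * ((2 * N - k) * e + N * (N - k)) - 70 * (L * (L + k) / 3))"
  unfolding focal3_def
proof (rule integral_symmetrize)
  let ?q = "(0, L, M, N, k)"
  have a3: "abel3 ?q = (\<lambda>t. polar_A ?q t * polar_B ?q t)" using abel_D0(3)[of ?q] by auto
  have calpha: "continuous_on {0..pi} (polar_alpha ?q)"
    using polar_alpha_deriv[of ?q] by (meson DERIV_continuous continuous_on_eq_continuous_within fst_conv)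
  show "(\<lambda>t. abel3 ?q t * polar_alpha ?q t) integrable_on {0..pi}"
    unfolding a3 by (intro integrable_continuous_real continuous_intros polar_continuous calpha)
  define c6 c4 c2 c8 where c: "c6 = (2 * L + k)\<^sup>2 + L * (L + k) - P / 3"
    "c4 = (2 * L + k) * (e + 2 * N - k) + P - N * (N - k) / 3" "c2 = (2 * N - k) * e + N * (N - k)"
    "c8 = - (L * (L + k) / 3)"
  have h: "((\<lambda>t. M / 3 * (M * (2 * L + k) * (cos t ^ 4 * (sin t)\<^sup>2) + M * (2 * N - k) * ((cos t)\<^sup>2 * (sin t)\<^sup>2 - cos t ^ 4 * (sin t)\<^sup>2))
       + M * (c6 * (cos t ^ 6 * sin t ^ 3) + c4 * (cos t ^ 4 * sin t ^ 5) + c2 * (cos t ^ 2 * sin t ^ 7) + c8 * (cos t ^ 8 * sin t)))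
      has_integral M / 3 * (M * (2 * L + k) * (pi / 16) + M * (2 * N - k) * (pi / 8 - pi / 16))
       + M * (c6 * (20/315) + c4 * (16/315) + c2 * (32/315) + c8 * (70/315))) {0..pi}"
    by (intro has_integral_add has_integral_mult_right has_integral_diff has_integral_cos_sin_squares has_integral_cos_sin_odd)
  have e: "(abel3 ?q t * polar_alpha ?q t + abel3 ?q (pi - t) * polar_alpha ?q (pi - t)) / 2 =
      M / 3 * (M * (2 * L + k) * (cos t ^ 4 * (sin t)\<^sup>2) + M * (2 * N - k) * ((cos t)\<^sup>2 * (sin t)\<^sup>2 - cos t ^ 4 * (sin t)\<^sup>2))
       + M * (c6 * (cos t ^ 6 * sin t ^ 3) + c4 * (cos t ^ 4 * sin t ^ 5) + c2 * (cos t ^ 2 * sin t ^ 7) + c8 * (cos t ^ 8 * sin t))" for t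
  proof -
    define x y where xy: "x = cos t" "y = sin t"
    define E O1 where EO: "E = M * (x\<^sup>2 * y\<^sup>2 * ((2 * L + k) * x\<^sup>2 + (2 * N - k) * y\<^sup>2))"
      "O1 = x * y * (L * (L + k) * x ^ 4 + P * (x\<^sup>2 * y\<^sup>2) + N * (N - k) * y ^ 4)"
    define F G where FG: "F = (2 * L + k) * (x\<^sup>2 * y) + e * y ^ 3" "G = M * (x * y\<^sup>2 - x ^ 3 / 3)"
    have a: "abel3 ?q t = E + O1" "abel3 ?q (pi - t) = E - O1"
      unfolding a3 EO P_def by (simp_all add: xy algebra_simps power2_eq_square power4_eq_xxxx)
    have b: "polar_alpha ?q t = M / 3 + F + G" "polar_alpha ?q (pi - t) = M / 3 + F - G"
      unfolding FG e_def by (simp_all add: xy algebra_simps power2_eq_square)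
    have "(abel3 ?q t * polar_alpha ?q t + abel3 ?q (pi - t) * polar_alpha ?q (pi - t)) / 2 =
       M / 3 * E + (E * F + O1 * G)"
      unfolding a b by (simp add: field_simps)
    also have "E * F + O1 * G = M * (c6 * (x ^ 6 * y ^ 3) + c4 * (x ^ 4 * y ^ 5) + c2 * (x ^ 2 * y ^ 7) + c8 * (x ^ 8 * y))"
      unfolding EO FG c by (simp add: field_simps power_numeral_reduce)
    also have "E = M * (2 * L + k) * (x ^ 4 * y\<^sup>2) + M * (2 * N - k) * (x\<^sup>2 * y\<^sup>2 * y\<^sup>2)"
      unfolding EO by (simp add: algebra_simps power2_eq_square power4_eq_xxxx)
    also have "x\<^sup>2 * y\<^sup>2 * y\<^sup>2 = x\<^sup>2 * y\<^sup>2 - x ^ 4 * y\<^sup>2"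
      unfolding xy using sin_cos_squared_add[of t] by algebra
    finally show ?thesis unfolding xy .
  qed
  have v1: "M / 3 * (M * (2 * L + k) * (pi / 16) + M * (2 * N - k) * (pi / 8 - pi / 16)) = M / 3 * focal2 ?q"
    unfolding focal2_value by (simp add: field_simps)
  have v2: "M * (c6 * (20/315) + c4 * (16/315) + c2 * (32/315) + c8 * (70/315)) =
     M / 315 * (20 * c6 + 16 * c4 + 32 * c2 - 70 * (L * (L + k) / 3))"
    unfolding c(4) by (simp add: field_simps)
  from h show "((\<lambda>t. (abel3 ?q t * polar_alpha ?q t + abel3 ?q (pi - t) * polar_alpha ?q (pi - t)) / 2)
     has_integral M / 3 * focal2 ?q + M / 315 * (
    20 * ((2 * L + k)\<^sup>2 + L * (L + k) - P / 3) + 16 * ((2 * L + k) * (e + 2 * N - k) + P - N * (N - k) / 3)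
    + 32 * ((2 * N - k) * e + N * (N - k)) - 70 * (L * (L + k) / 3))) {0..pi}"
    unfolding e v1 v2 unfolding c .
qed

text \<open>The hypothesis makes \<open>focal2\<close> equal for both halves, and they share
  \<open>m\<close>, so the multiple of \<open>focal2\<close> and the terms cubic in \<open>m\<close>
  cancel. Eliminating \<open>n2\<close> leaves a polynomial identity.\<close>

lemma focal3_difference:
  assumes "2 * l + n1 + n2 = 0"
  shows "focal3 (0, - l, m, - n2, - 1) - focal3 (0, l, m, n1, 1) = 4/45 * m * (n2 - n1) * (n1 + n2 - 1)"
proof -
  have n2: "n2 = - 2 * l - n1" using assms by simp
  have f: "focal2 (0, - l, m, - n2, - 1) = focal2 (0, l, m, n1, 1)"
    unfolding focal2_value n2 by (simp add: field_simps)
  show ?thesis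
    unfolding focal3_value f unfolding n2 by (simp add: field_simps power2_eq_square)
qed

section \<open>The displacement series\<close>

lemma params_box_exists:
  assumes "\<bar>fst p\<bar> \<le> 1/64"
  obtains C where "params_box C p"
proof -
  obtain d l m1 m2 n1 n2 where p: "p = (d, l, m1, m2, n1, n2)" by (cases p)
  have "params_box (1 + \<bar>l\<bar> + \<bar>m1\<bar> + \<bar>m2\<bar> + \<bar>n1\<bar> + \<bar>n2\<bar>) p"
    using assms unfolding p params_box_def by (simp; intro conjI; linarith)
  then show thesis by (rule that)
qed

lemma tendsto_of_remainder:
  fixes g :: "real \<Rightarrow> real"
  assumes "\<delta> > 0" "\<And>r. 0 < r \<Longrightarrow> r \<le> \<delta> \<Longrightarrow> \<bar>g r - a * r ^ j\<bar> \<le> K * r ^ Suc j"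
  shows "((\<lambda>r. g r / r ^ j) \<longlongrightarrow> a) (at_right 0)"
proof -
  have "((\<lambda>r. g r / r ^ j - a) \<longlongrightarrow> 0) (at_right 0)"
  proof (rule tendsto_rabs_zero_cancel, rule tendsto_sandwich[of "\<lambda>_. 0" _ _ "\<lambda>r. K * r"])
    show "((\<lambda>r::real. K * r) \<longlongrightarrow> 0) (at_right 0)"
      by (rule tendsto_eq_intros refl)+ auto
    show "\<forall>\<^sub>F r in at_right 0. \<bar>g r / r ^ j - a\<bar> \<le> K * r"
      unfolding eventually_at_right_field
    proof (intro exI[of _ \<delta>] conjI allI impI)
      fix r :: real assume r: "0 < r" "r < \<delta>"
      have "g r / r ^ j - a = (g r - a * r ^ j) / r ^ j" using r by (simp add: field_simps)
      then have "\<bar>g r / r ^ j - a\<bar> = \<bar>g r - a * r ^ j\<bar> / r ^ j"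
        using r by (simp add: abs_divide)
      also have "\<dots> \<le> K * r ^ Suc j / r ^ j"
        using assms(2)[of r] r by (intro divide_right_mono) auto
      finally show "\<bar>g r / r ^ j - a\<bar> \<le> K * r" using r by (simp add: field_simps)
    qed fact
  qed auto
  from tendsto_add[OF this tendsto_const[of a]] show ?thesis by simp
qed

lemma half_sol_tendsto_1:
  assumes "half_box C q" "fst q = 0"
  shows "((\<lambda>r. Re (half_sol q pi (of_real r))) \<longlongrightarrow> 1) (at_right 0)"
proof -
  obtain K where K: "\<And>r. 0 < r \<Longrightarrow> r \<le> half_radius C \<Longrightarrow>
    \<bar>1 / Re (half_sol q pi (of_real r)) - (1 - r * polar_alpha q pi - r\<^sup>2 * focal2 q - r ^ 3 * focal3 q)\<bar> \<le> K * r ^ 4"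
    by (rule half_sol_expansion[OF assms]) (rule that)
  have "((\<lambda>r. (1 / Re (half_sol q pi (of_real r)) - (1 - r * polar_alpha q pi - r\<^sup>2 * focal2 q - r ^ 3 * focal3 q)) / r ^ 3) \<longlongrightarrow> 0) (at_right 0)"
    using K half_radius_pos[OF assms(1)] by (intro tendsto_of_remainder[of "half_radius C" _ _ _ K]) (auto simp: numeral_eq_Suc)
  then have "((\<lambda>r. (1 / Re (half_sol q pi (of_real r)) - (1 - r * polar_alpha q pi - r\<^sup>2 * focal2 q - r ^ 3 * focal3 q)) / r ^ 3 * r ^ 3
      + (1 - r * polar_alpha q pi - r\<^sup>2 * focal2 q - r ^ 3 * focal3 q)) \<longlongrightarrow> 0 * 0 ^ 3 + (1 - 0 * polar_alpha q pi - 0\<^sup>2 * focal2 q - 0 ^ 3 * focal3 q)) (at_right 0)"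
    by (intro tendsto_intros)
  then have "((\<lambda>r. 1 / Re (half_sol q pi (of_real r))) \<longlongrightarrow> 1) (at_right 0)"
  proof (rule Lim_transform_eventually[OF tendsto_eq_rhs])
    show "\<forall>\<^sub>F r in at_right 0. (1 / Re (half_sol q pi (of_real r)) - (1 - r * polar_alpha q pi - r\<^sup>2 * focal2 q - r ^ 3 * focal3 q)) / r ^ 3 * r ^ 3
      + (1 - r * polar_alpha q pi - r\<^sup>2 * focal2 q - r ^ 3 * focal3 q) = 1 / Re (half_sol q pi (of_real r))"
      using eventually_at_right_less[of 0] by eventually_elim simp
  qed simp
  from tendsto_inverse[OF this] show ?thesis by (simp add: inverse_eq_divide)
qed

section \<open>Leading coefficients of the displacement\<close>

context
  fixes C and l m1 m2 n1 n2 :: real and p :: params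
  assumes p: "p = (0, l, m1, m2, n1, n2)" and box: "params_box C p"
begin

text \<open>The difference of the two solutions is \<open>WU\<close> \<open>WL\<close>
  (1/\<open>WU\<close> - 1/\<open>WL\<close>), and the product tends to 1, so the leading term can
  be read off from the reciprocals. In the exponent j + 2, one factor r comes from the displacement
  and one from \<open>w\<close> being indexed from 0.\<close>

lemma displacement_leading_term:
  assumes "\<And>i. i < j \<Longrightarrow> w i = 0" and j: "j < 3"
    and w: "w = (\<lambda>i. if i = 0 then polar_alpha (0, - l, m2, - n2, - 1) pi - polar_alpha (0, l, m1, n1, 1) pi else if i = 1 then focal2 (0, - l, m2, - n2, - 1) - focal2 (0, l, m1, n1, 1) else focal3 (0, - l, m2, - n2, - 1) - focal3 (0, l, m1, n1, 1))"
  shows "((\<lambda>r. displacement p r / r ^ (j + 2)) \<longlongrightarrow> w j) (at_right 0)"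
proof -
  have b: "half_box C (0, l, m1, n1, 1)" "half_box C (0, - l, m2, - n2, - 1)" using box by (auto simp: p params_box_def)
  have \<delta>: "half_radius C > 0" using half_radius_pos[OF b(1)] .
  define WU WL where "WU r = Re (half_sol (0, l, m1, n1, 1) pi (of_real r))" and "WL r = Re (half_sol (0, - l, m2, - n2, - 1) pi (of_real r))" for r
  obtain K1 where K1: "\<And>r. 0 < r \<Longrightarrow> r \<le> half_radius C \<Longrightarrow>
    \<bar>1 / Re (half_sol (0, l, m1, n1, 1) pi (of_real r)) - (1 - r * polar_alpha (0, l, m1, n1, 1) pi - r\<^sup>2 * focal2 (0, l, m1, n1, 1) - r ^ 3 * focal3 (0, l, m1, n1, 1))\<bar> \<le> K1 * r ^ 4"
    by (rule half_sol_expansion[OF b(1)]) (simp, rule that)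
  note K1 = K1[folded WU_def]
  obtain K2 where K2: "\<And>r. 0 < r \<Longrightarrow> r \<le> half_radius C \<Longrightarrow>
    \<bar>1 / Re (half_sol (0, - l, m2, - n2, - 1) pi (of_real r)) - (1 - r * polar_alpha (0, - l, m2, - n2, - 1) pi - r\<^sup>2 * focal2 (0, - l, m2, - n2, - 1) - r ^ 3 * focal3 (0, - l, m2, - n2, - 1))\<bar> \<le> K2 * r ^ 4"
    by (rule half_sol_expansion[OF b(2)]) (simp, rule that)
  note K2 = K2[folded WL_def]
  have main: "\<bar>(1 / WU r - 1 / WL r) - (r * w 0 + r\<^sup>2 * w 1 + r ^ 3 * w 2)\<bar> \<le> (K1 + K2) * r ^ 4" if "0 < r" "r \<le> half_radius C" for r
  proof -
    have "(1 / WU r - 1 / WL r) - (r * w 0 + r\<^sup>2 * w 1 + r ^ 3 * w 2) =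
        (1 / WU r - (1 - r * polar_alpha (0, l, m1, n1, 1) pi - r\<^sup>2 * focal2 (0, l, m1, n1, 1) - r ^ 3 * focal3 (0, l, m1, n1, 1)))
      - (1 / WL r - (1 - r * polar_alpha (0, - l, m2, - n2, - 1) pi - r\<^sup>2 * focal2 (0, - l, m2, - n2, - 1) - r ^ 3 * focal3 (0, - l, m2, - n2, - 1)))"
      unfolding w by (simp add: algebra_simps)
    also have "\<bar>\<dots>\<bar> \<le> K1 * r ^ 4 + K2 * r ^ 4" by (intro abs_diff_le K1 K2 that)
    finally show ?thesis by (simp add: algebra_simps)
  qed
  define K where "K = \<bar>w 1\<bar> + \<bar>w 2\<bar> + \<bar>K1 + K2\<bar>"
  have "((\<lambda>r. (1 / WU r - 1 / WL r) / r ^ (j + 1)) \<longlongrightarrow> w j) (at_right 0)"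
  proof (rule tendsto_of_remainder[of "min 1 (half_radius C)" _ _ _ K])
    show "min 1 (half_radius C) > 0" using \<delta> by simp
    fix r assume r: "0 < r" "r \<le> min 1 (half_radius C)"
    have m: "\<bar>(1 / WU r - 1 / WL r) - (r * w 0 + r\<^sup>2 * w 1 + r ^ 3 * w 2)\<bar> \<le> (K1 + K2) * r ^ 4"
      using main[of r] r by simp
    have r1: "r ^ 4 \<le> r ^ 3" "r ^ 3 \<le> r\<^sup>2" "r ^ 4 \<le> r\<^sup>2" using r by (auto intro!: power_decreasing)
    have kk: "(K1 + K2) * r ^ 4 \<le> \<bar>K1 + K2\<bar> * r ^ 4" using r by (intro mult_right_mono) auto
    have k1: "\<bar>K1 + K2\<bar> * r ^ 4 \<le> \<bar>K1 + K2\<bar> * r ^ 3" "\<bar>K1 + K2\<bar> * r ^ 4 \<le> \<bar>K1 + K2\<bar> * r\<^sup>2"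
      "\<bar>w 2\<bar> * r ^ 3 \<le> \<bar>w 2\<bar> * r\<^sup>2"
      using r1 by (auto intro!: mult_left_mono)
    have k2: "\<bar>r\<^sup>2 * w 1\<bar> = \<bar>w 1\<bar> * r\<^sup>2" "\<bar>r ^ 3 * w 2\<bar> = \<bar>w 2\<bar> * r ^ 3" using r by (auto simp: abs_mult)
    consider "j = 0" | "j = 1" | "j = 2" using j by linarith
    then show "\<bar>(1 / WU r - 1 / WL r) - w j * r ^ (j + 1)\<bar> \<le> K * r ^ Suc (j + 1)"
    proof cases
      case 1
      have aux: "\<bar>G - (A + B + E)\<bar> \<le> k \<Longrightarrow> \<bar>B\<bar> = b' \<Longrightarrow> \<bar>E\<bar> = e \<Longrightarrow> \<bar>G - A\<bar> \<le> b' + e + k"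
        for G A B E k b' e :: real by linarith
      have "\<bar>(1 / WU r - 1 / WL r) - r * w 0\<bar> \<le> \<bar>w 1\<bar> * r\<^sup>2 + \<bar>w 2\<bar> * r ^ 3 + (K1 + K2) * r ^ 4"
        by (rule aux[OF m k2])
      also have "\<dots> \<le> \<bar>w 1\<bar> * r\<^sup>2 + \<bar>w 2\<bar> * r\<^sup>2 + \<bar>K1 + K2\<bar> * r\<^sup>2"
        using order_trans[OF kk k1(2)] k1(3) by simp
      finally have "\<bar>(1 / WU r - 1 / WL r) - w 0 * r\<bar> \<le> \<bar>w 1\<bar> * r\<^sup>2 + \<bar>w 2\<bar> * r\<^sup>2 + \<bar>K1 + K2\<bar> * r\<^sup>2"
        by (simp add: mult.commute)
      then show ?thesis unfolding 1 K_def by (simp add: algebra_simps power2_eq_square)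
    next
      case 2
      have "w 0 = 0" using assms(1)[of 0] 2 by simp
      then have m': "\<bar>(1 / WU r - 1 / WL r) - (r\<^sup>2 * w 1 + r ^ 3 * w 2)\<bar> \<le> (K1 + K2) * r ^ 4" using m by simp
      have aux: "\<bar>G - (A + B)\<bar> \<le> k \<Longrightarrow> \<bar>B\<bar> = b' \<Longrightarrow> \<bar>G - A\<bar> \<le> b' + k" for G A B k b' :: real
        by linarith
      have "\<bar>(1 / WU r - 1 / WL r) - r\<^sup>2 * w 1\<bar> \<le> \<bar>w 2\<bar> * r ^ 3 + (K1 + K2) * r ^ 4"
        by (rule aux[OF m' k2(2)])
      also have "\<dots> \<le> \<bar>w 2\<bar> * r ^ 3 + \<bar>K1 + K2\<bar> * r ^ 3"
        using order_trans[OF kk k1(1)] by simp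
      finally have "\<bar>(1 / WU r - 1 / WL r) - w 1 * r\<^sup>2\<bar> \<le> \<bar>w 2\<bar> * r ^ 3 + \<bar>K1 + K2\<bar> * r ^ 3"
        by (simp add: mult.commute)
      also have "\<dots> \<le> K * r ^ 3" unfolding K_def using r by (simp add: algebra_simps)
      finally show ?thesis unfolding 2 by (simp add: numeral_eq_Suc)
    next
      case 3
      have "w 0 = 0" "w 1 = 0" using assms(1)[of 0] assms(1)[of 1] 3 by simp_all
      then have "\<bar>(1 / WU r - 1 / WL r) - w 2 * r ^ 3\<bar> \<le> \<bar>K1 + K2\<bar> * r ^ 4"
        using m kk by (simp add: mult.commute[of "r ^ 3"])
      also have "\<dots> \<le> K * r ^ 4" unfolding K_def using r by (simp add: algebra_simps)
      finally show ?thesis unfolding 3 by (simp add: numeral_eq_Suc)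
    qed
  qed
  moreover have "(WU \<longlongrightarrow> 1) (at_right 0)" "(WL \<longlongrightarrow> 1) (at_right 0)"
    unfolding WU_def WL_def using half_sol_tendsto_1[OF b(1)] half_sol_tendsto_1[OF b(2)] by simp_all
  ultimately have "((\<lambda>r. WU r * WL r * ((1 / WU r - 1 / WL r) / r ^ (j + 1))) \<longlongrightarrow> 1 * 1 * w j) (at_right 0)"
    by (intro tendsto_mult)
  then show ?thesis
  proof (rule Lim_transform_eventually[OF tendsto_eq_rhs])
    show "\<forall>\<^sub>F r in at_right 0. WU r * WL r * ((1 / WU r - 1 / WL r) / r ^ (j + 1)) = displacement p r / r ^ (j + 2)"
      unfolding eventually_at_right_field
    proof (intro exI[of _ "half_radius C"] conjI allI impI)
      fix r assume r: "0 < r" "r < half_radius C"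
      have "WU r \<ge> 1/2" "WL r \<ge> 1/2"
        unfolding WU_def WL_def using half_sol_Re_bounds(1)[OF b(1), of pi r] half_sol_Re_bounds(1)[OF b(2), of pi r] r by simp_all
      then have nz: "WU r \<noteq> 0" "WL r \<noteq> 0" by auto
      have dd: "displacement p r = r * (WL r - WU r)"
        using displacement_eq(3)[OF box, of r] r by (simp add: disp_quot_def WU_def WL_def p)
      show "WU r * WL r * ((1 / WU r - 1 / WL r) / r ^ (j + 1)) = displacement p r / r ^ (j + 2)"
        unfolding dd using r nz by (simp add: field_simps)
    qed (use \<delta> in simp)
  qed simp
qed

end

lemma displacement_leading:
  fixes l m1 m2 n1 n2 :: real
  defines "p \<equiv> (0, l, m1, m2, n1, n2)"
  shows "((\<lambda>r. displacement p r / r ^ 2) \<longlongrightarrow> 2/3 * (m2 - m1)) (at_right 0)"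
    and "m1 = m2 \<Longrightarrow> ((\<lambda>r. displacement p r / r ^ 3) \<longlongrightarrow> - (m2 * pi * (2 * l + n1 + n2) / 8)) (at_right 0)"
    and "m1 = m2 \<Longrightarrow> 2 * l + n1 + n2 = 0 \<Longrightarrow>
      ((\<lambda>r. displacement p r / r ^ 4) \<longlongrightarrow> 4/45 * m2 * (n2 - n1) * (n1 + n2 - 1)) (at_right 0)"
proof -
  obtain C where box: "params_box C p" by (rule params_box_exists[of p]) (auto simp: p_def)
  have pp: "p = (0, l, m1, m2, n1, n2)" by (simp add: p_def)
  note L = displacement_leading_term[OF pp box _ _ refl]
  have a: "polar_alpha (0, - l, m2, - n2, - 1) pi - polar_alpha (0, l, m1, n1, 1) pi = 2/3 * (m2 - m1)"
    by (simp add: field_simps)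
  have b: "focal2 (0, - l, m2, - n2, - 1) - focal2 (0, l, m2, n1, 1) = - (m2 * pi * (2 * l + n1 + n2) / 8)"
    unfolding focal2_value by (simp add: field_simps)
  show "((\<lambda>r. displacement p r / r ^ 2) \<longlongrightarrow> 2/3 * (m2 - m1)) (at_right 0)"
    using L[of 0, unfolded a] by (simp add: numeral_2_eq_2)
  have a': "polar_alpha (0, - l, m2, - n2, - 1) pi - polar_alpha (0, l, m2, n1, 1) pi = 0" by simp
  assume m: "m1 = m2"
  show "((\<lambda>r. displacement p r / r ^ 3) \<longlongrightarrow> - (m2 * pi * (2 * l + n1 + n2) / 8)) (at_right 0)"
    using L[of 1, unfolded m a' b] by (simp add: numeral_3_eq_3)
  assume s: "2 * l + n1 + n2 = 0"
  have "((\<lambda>r. displacement p r / r ^ (2 + 2)) \<longlongrightarrow> (if (2::nat) = 0 then 0 else if (2::nat) = 1 then - (m2 * pi * (2 * l + n1 + n2) / 8)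
      else focal3 (0, - l, m2, - n2, - 1) - focal3 (0, l, m2, n1, 1))) (at_right 0)"
    by (rule L[of 2, unfolded m a' b]) (use s in \<open>auto simp: less_2_cases_iff\<close>)
  then show "((\<lambda>r. displacement p r / r ^ 4) \<longlongrightarrow> 4/45 * m2 * (n2 - n1) * (n1 + n2 - 1)) (at_right 0)"
    using focal3_difference[OF s, of m2] by simp
qed

text \<open>Once the lower coefficients vanish, D r / r^i tends to \<open>W i\<close>. Convergence
  of D r / r^j forces D r / r^k to 0 for k < j, which removes the lower coefficients by induction.
  Limits computed from the integrals thus apply to any series that
  \<open>weak_focus_of_order\<close> may supply.\<close>

lemma power_series_leading_coeff:
  fixes W :: "nat \<Rightarrow> real"
  assumes "\<epsilon> > 0" and sums: "\<And>r. 0 < r \<Longrightarrow> r < \<epsilon> \<Longrightarrow> (\<lambda>k. W k * r ^ k) sums D r"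
    and lim: "((\<lambda>r. D r / r ^ j) \<longlongrightarrow> c) (at_right 0)"
  shows "k < j \<Longrightarrow> W k = 0" and "W j = c"
proof -
  have coeff: "((\<lambda>r. D r / r ^ i) \<longlongrightarrow> W i) (at_right 0)" if z: "\<And>k. k < i \<Longrightarrow> W k = 0" for i
  proof -
    define h where "h x = (\<Sum>n. W (n + i) * x ^ n)" for x
    have shift: "(\<lambda>n. W (n + i) * r ^ n) sums (D r / r ^ i)" if r: "0 < r" "r < \<epsilon>" for r
    proof -
      have "(\<lambda>n. W (n + i) * r ^ (n + i)) sums D r"
        using sums_iff_shift[of "\<lambda>k. W k * r ^ k" i "D r"] sums[OF r] z by simp
      from sums_divide[OF this, of "r ^ i"] show ?thesis using r by (simp add: power_add)
    qed
    have "(h \<longlongrightarrow> W (0 + i)) (at 0)"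
    proof (rule powser_limit_0)
      show "0 < \<epsilon> / 2" using assms(1) by simp
      fix x :: real assume "norm x < \<epsilon> / 2"
      then have "summable (\<lambda>n. W (n + i) * x ^ n)"
        using assms(1) by (intro powser_inside[OF sums_summable[OF shift[of "\<epsilon> / 2"]]]) auto
      then show "(\<lambda>n. W (n + i) * x ^ n) sums h x" unfolding h_def by (rule summable_sums)
    qed
    then have "(h \<longlongrightarrow> W i) (at_right 0)" by (simp add: filterlim_at_split)
    then show ?thesis
    proof (rule Lim_transform_eventually)
      show "\<forall>\<^sub>F r in at_right 0. h r = D r / r ^ i"
        unfolding eventually_at_right_field
        using assms(1) shift by (intro exI[of _ \<epsilon>]) (auto simp: h_def sums_iff)
    qed
  qed
  have zero: "W k = 0" if "k < j" for k
    using that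
  proof (induction k rule: less_induct)
    case (less k)
    then have "((\<lambda>r. D r / r ^ k) \<longlongrightarrow> W k) (at_right 0)" by (intro coeff) auto
    moreover have "((\<lambda>r. D r / r ^ j * r ^ (j - k)) \<longlongrightarrow> c * 0 ^ (j - k)) (at_right 0)"
      by (intro tendsto_intros lim)
    then have "((\<lambda>r. D r / r ^ k) \<longlongrightarrow> c * 0 ^ (j - k)) (at_right 0)"
    proof (rule Lim_transform_eventually)
      show "\<forall>\<^sub>F r in at_right 0. D r / r ^ j * r ^ (j - k) = D r / r ^ k"
        using eventually_at_right_less[of 0]
        by eventually_elim (use less.prems in \<open>simp add: field_simps flip: power_add\<close>)
    qed
    ultimately have "W k = c * 0 ^ (j - k)" by (rule tendsto_unique[rotated]) simp
    then show ?case using less.prems by simp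
  qed
  then show "k < j \<Longrightarrow> W k = 0" .
  show "W j = c" using coeff[of j] zero lim by (intro tendsto_unique[of "at_right 0"]) auto
qed

lemma disp_quot_holomorphic:
  assumes "params_box C p"
  shows "disp_quot p holomorphic_on ball 0 (half_radius C)"
  unfolding disp_quot_def[abs_def] using assms
  by (intro holomorphic_intros half_sol_holomorphic) (auto simp: params_box_def)

text \<open>The displacement is r times \<open>disp_quot\<close>, so its coefficient with index
  \<open>Suc n\<close> is the Taylor coefficient of order n of the quotient.\<close>

lemma displacement_series_taylor:
  assumes "params_box C p"
  defines "W \<equiv> \<lambda>k. case k of 0 \<Rightarrow> 0 | Suc n \<Rightarrow> Re ((deriv ^^ n) (disp_quot p) 0 / fact n)"
  shows "displacement_series p W"
proof -
  define a where "a n = Re ((deriv ^^ n) (disp_quot p) 0 / fact n)" for n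
  have \<delta>: "half_radius C > 0" using assms(1) half_radius_pos unfolding params_box_def by blast
  have "(\<lambda>k. W k * r ^ k) sums displacement p r" if r: "0 < r" "r < half_radius C" for r
  proof -
    have "(\<lambda>n. (deriv ^^ n) (disp_quot p) 0 / fact n * (of_real r - 0) ^ n) sums disp_quot p (of_real r)"
      using r by (intro holomorphic_power_series[OF disp_quot_holomorphic[OF assms(1)]]) simp
    then have "(\<lambda>n. Re ((deriv ^^ n) (disp_quot p) 0 / fact n * of_real (r ^ n))) sums Re (disp_quot p (of_real r))"
      by (intro sums_Re) simp
    moreover have "Re (z * complex_of_real x) = Re z * x" for z x by simp
    ultimately have "(\<lambda>n. a n * r ^ n) sums Re (disp_quot p (of_real r))"
      unfolding a_def by (simp only:)
    then have "(\<lambda>n. r * (a n * r ^ n)) sums (r * Re (disp_quot p (of_real r)))" by (rule sums_mult)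
    then have "(\<lambda>n. W (Suc n) * r ^ Suc n) sums displacement p r"
      using displacement_eq(3)[OF assms(1) r(1)] r by (simp add: W_def a_def algebra_simps)
    then show ?thesis by (subst (asm) sums_Suc_iff) (simp add: W_def)
  qed
  then show ?thesis
    unfolding displacement_series_def using \<delta> displacement_eq(1)[OF assms(1)]
    by (intro conjI exI[of _ "half_radius C"]) (auto simp: W_def)
qed

lemma Tc_weak_focus_4:
  assumes "p \<in> Tc"
  shows "weak_focus_of_order p 4"
proof -
  obtain l m n1 n2 where p: "p = (0, l, m, m, n1, n2)" and s: "2 * l + n1 + n2 = 0" "m * (n1 - n2) * (n1 + n2 - 1) \<noteq> 0"
    using assms unfolding Tc_def by auto
  obtain C where "params_box C p" by (rule params_box_exists[of p]) (auto simp: p)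
  from displacement_series_taylor[OF this] obtain W where W: "displacement_series p W" by blast
  then obtain \<epsilon> where e: "\<epsilon> > 0" "\<And>r. 0 < r \<Longrightarrow> r < \<epsilon> \<Longrightarrow> (\<lambda>k. W k * r ^ k) sums displacement p r"
    unfolding displacement_series_def by auto
  have "((\<lambda>r. displacement p r / r ^ 4) \<longlongrightarrow> 4/45 * m * (n2 - n1) * (n1 + n2 - 1)) (at_right 0)"
    unfolding p using displacement_leading(3)[OF refl s(1), of m] by simp
  note c = power_series_leading_coeff[OF e this]
  have "W 4 \<noteq> 0" using c(2) s(2) by auto
  with c(1) W show ?thesis unfolding weak_focus_of_order_def by (intro conjI exI[of _ W]) (auto simp: p)
qed

section \<open>Centers\<close>

text \<open>For M = 0 the map x -> -x reverses time, so the half-return is an involution; being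
  strictly increasing, it is the identity. The divisor 12 keeps the image, at most 3/2 r, below
  \<open>half_radius C / 8\<close>, where monotonicity is available.\<close>

lemma half_map_reversible:
  assumes box: "half_box C (0, L, 0, N, k)" and r: "0 < r" "r \<le> half_radius C / 12"
  shows "half_map (0, L, 0, N, k) r = r"
proof -
  let ?q = "(0, L, 0, N, k)"
  define R where "R z = (- fst z, snd z)" for z :: "real \<times> real"
  have R: "bounded_linear R"
    unfolding R_def[abs_def]
    by (intro bounded_linear_Pair bounded_linear_minus bounded_linear_fst bounded_linear_snd)
  have RX: "half_field ?q (R z) = - R (half_field ?q z)" for z
    by (cases z) (simp add: R_def)
  have RS: "R ` {z. 0 < snd z} = {z. 0 < snd z}"
  proof -
    have "z \<in> R ` {z. 0 < snd z}" if "0 < snd z" for z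
      by (rule image_eqI[of _ _ "R z"]) (use that in \<open>simp_all add: R_def\<close>)
    then show ?thesis by (auto simp: R_def)
  qed
  have Rp: "R (v, 0) = (- v, 0)" for v by (simp add: R_def)
  define S where "S = half_map ?q r"
  have \<delta>: "half_radius C > 0" using half_radius_pos[OF box] .
  have S: "r / 2 \<le> S" "S \<le> 3/2 * r" using half_map_bounds[OF box r(1)] r(2) \<delta> by (simp_all add: S_def)
  then have S0: "S > 0" "S \<le> half_radius C / 8" using r \<delta> by linarith+
  have "half_return ?q r S" using half_return_iff_half_map[OF box r(1)] r(2) \<delta> by (simp add: S_def)
  then have "half_return ?q S r"
    unfolding half_return_def
    using orbit_arc_reversal[of "half_field ?q" "{z. 0 < snd z}" "(r, 0)" "(- S, 0)" R "half_field ?q", OF _ R RX]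
    by (simp add: RS Rp)
  then have SS: "half_map ?q S = r"
    using half_return_iff_half_map[OF box S0(1)] S0(2) \<delta> by simp
  have "\<not> S < r"
    using half_map_strict_mono[OF box _ _ , of S r] S0 r \<delta> SS by (auto simp: S_def)
  moreover have "\<not> r < S"
    using half_map_strict_mono[OF box _ _ , of r S] S0 r \<delta> SS by (auto simp: S_def)
  ultimately show ?thesis by (simp add: S_def)
qed

text \<open>The projective involution \<open>(x, y) \<mapsto> (x, - y) / (1 - y)\<close> exchanges the two half systems; it
  fixes the rays through the origin, so both sides have the same Abel equation.\<close>

lemma half_sol_involution:
  assumes "n1 + n2 = 1"
  shows "half_sol (0, - 1/2, m, n1, 1) = half_sol (0, 1/2, m, - n2, - 1)"
proof -
  have n2: "n2 = 1 - n1" using assms by simp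
  have "abel1 (0, - 1/2, m, n1, 1) = abel1 (0, 1/2, m, - n2, - 1)"
    by (rule ext) (simp add: abel_D0)
  moreover have "abel2 (0, - 1/2, m, n1, 1) = abel2 (0, 1/2, m, - n2, - 1)"
    by (rule ext) (simp add: abel_D0 n2 algebra_simps power2_eq_square)
  moreover have "abel3 (0, - 1/2, m, n1, 1) = abel3 (0, 1/2, m, - n2, - 1)"
    by (rule ext) (simp add: abel_D0 n2 algebra_simps)
  ultimately show ?thesis unfolding half_sol_def[abs_def] by simp
qed

text \<open>Substituting e = exp(b t / 2) s reduces e'' = b e' - c e to s'' =
  \<open>\<Delta>\<close> s, solved by a hyperbolic sine, by t or by a sine according to the sign of
  \<open>\<Delta>\<close>.\<close>

lemma linear_oscillator_exists:
  fixes b c :: real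
  obtains e e' where "\<And>t S. (e has_real_derivative e' t) (at t within S)"
    "\<And>t S. (e' has_real_derivative b * e' t - c * e t) (at t within S)" "e 0 = 0" "e' 0 = 1"
proof -
  define \<Delta> where "\<Delta> = b\<^sup>2 / 4 - c"
  obtain s s' :: "real \<Rightarrow> real" where s: "\<And>t S. (s has_real_derivative s' t) (at t within S)"
    "\<And>t S. (s' has_real_derivative \<Delta> * s t) (at t within S)" "s 0 = 0" "s' 0 = 1"
  proof -
    consider "\<Delta> > 0" | "\<Delta> = 0" | "\<Delta> < 0" by linarith
    then show thesis
    proof cases
      case 1
      define a where "a = sqrt \<Delta>"
      have a: "a * a = \<Delta>" "a \<noteq> 0" using 1 by (simp_all add: a_def)
      show thesis
        by (rule that[of "\<lambda>t. sinh (a * t) / a" "\<lambda>t. cosh (a * t)"])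
           (auto intro!: derivative_eq_intros simp: a field_simps simp flip: a(1))
    next
      case 2
      show thesis
        by (rule that[of "\<lambda>t. t" "\<lambda>t. 1"]) (auto intro!: derivative_eq_intros simp: 2)
    next
      case 3
      define a where "a = sqrt (- \<Delta>)"
      have a: "\<Delta> = - (a * a)" "a \<noteq> 0" using 3 by (simp_all add: a_def)
      show thesis
        by (rule that[of "\<lambda>t. sin (a * t) / a" "\<lambda>t. cos (a * t)"])
           (auto intro!: derivative_eq_intros simp: a field_simps)
    qed
  qed
  have c: "c = b\<^sup>2 / 4 - \<Delta>" by (simp add: \<Delta>_def)
  show thesis
  proof (rule that[of "\<lambda>t. exp (b / 2 * t) * s t" "\<lambda>t. exp (b / 2 * t) * (b / 2 * s t + s' t)"])
    fix t S
    show "((\<lambda>t. exp (b / 2 * t) * s t) has_real_derivative exp (b / 2 * t) * (b / 2 * s t + s' t)) (at t within S)"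
      by (auto intro!: derivative_eq_intros s simp: algebra_simps)
    show "((\<lambda>t. exp (b / 2 * t) * (b / 2 * s t + s' t)) has_real_derivative
        b * (exp (b / 2 * t) * (b / 2 * s t + s' t)) - c * (exp (b / 2 * t) * s t)) (at t within S)"
      unfolding c by (auto intro!: derivative_eq_intros s simp: field_simps power2_eq_square)
  qed (use s in auto)
qed

text \<open>For \<open>L = - N\<close> the quantities \<open>X = x (1 - k y)\<^sup>a\<close>, \<open>h = (1 - N y) (1 - k y)\<^sup>a\<close> with \<open>a = k L\<close> and
  \<open>Y = \<integral>\<^sub>0\<^sup>y u (1 - k u)\<^bsup>a - 1\<^esup> du\<close> satisfy the linear system \<open>X' = M X - h\<close>, \<open>h' = N (k - N) X\<close>, \<open>Y' = X\<close>
  with respect to \<open>\<integral> y dt\<close>. The system and its initial value are the same for both halves, and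
  \<open>Y\<close> vanishes only on the \<open>x\<close>-axis, so the half-return is the first return of \<open>Y\<close> to \<open>0\<close>.\<close>

lemma half_return_linear:
  fixes L M N k r s :: real
  assumes hr: "half_return (0, L, M, N, k) r s" and L: "L = - N" and k: "k * k = 1"
    and X: "\<And>t S. (X has_real_derivative M * X t - h t) (at t within S)" "X 0 = r"
    and h: "\<And>t S. (h has_real_derivative N * (k - N) * X t) (at t within S)" "h 0 = 1"
    and Y: "\<And>t B. t \<in> {0..B} \<Longrightarrow> (Y has_real_derivative X t) (at t within {0..B})" "Y 0 = 0"
  shows "\<exists>\<Sigma>>0. Y \<Sigma> = 0 \<and> (\<forall>t\<in>{0<..<\<Sigma>}. Y t > 0) \<and> X \<Sigma> = - s"
proof -
  obtain T \<gamma> where T: "T > 0" "solves (half_field (0, L, M, N, k)) \<gamma> T" "\<gamma> 0 = (r, 0)" "\<gamma> T = (- s, 0)"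
    and ypos: "\<forall>t\<in>{0<..<T}. snd (\<gamma> t) > 0"
    using hr unfolding half_return_def orbit_arc_iff by blast
  define x y where "x t = fst (\<gamma> t)" and "y t = snd (\<gamma> t)" for t
  let ?I = "{0..T}"
  have f: "half_field (0, L, M, N, k) (\<gamma> t) =
      (- y t + L * (x t)\<^sup>2 + M * x t * y t + N * (y t)\<^sup>2, x t * (1 - k * y t))" for t
    by (cases "\<gamma> t") (simp add: x_def y_def)
  have d: "(\<gamma> has_vector_derivative half_field (0, L, M, N, k) (\<gamma> t)) (at t within ?I)" if "t \<in> ?I" for t
    using T(2) that by (simp add: solves_def)
  have dx: "(x has_real_derivative - y t + L * (x t)\<^sup>2 + M * x t * y t + N * (y t)\<^sup>2) (at t within ?I)" if "t \<in> ?I" for t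
    using bounded_linear.has_vector_derivative[OF bounded_linear_fst d[OF that]]
    unfolding has_real_derivative_iff_has_vector_derivative x_def[symmetric] f by simp
  have dy: "(y has_real_derivative x t * (1 - k * y t)) (at t within ?I)" if "t \<in> ?I" for t
    using bounded_linear.has_vector_derivative[OF bounded_linear_snd d[OF that]]
    unfolding has_real_derivative_iff_has_vector_derivative y_def[symmetric] f by simp
  have cx: "continuous_on ?I x" and cy: "continuous_on ?I y"
    using dx dy by (meson DERIV_continuous continuous_on_eq_continuous_within)+
  have y0: "y 0 = 0" "y T = 0" "x 0 = r" "x T = - s" using T by (simp_all add: x_def y_def)
  have ynn: "y t \<ge> 0" if "t \<in> ?I" for t
  proof (cases "t = 0 \<or> t = T")
    case True
    then show ?thesis using y0 by auto
  next
    case False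
    then have "t \<in> {0<..<T}" using that by auto
    with ypos have "snd (\<gamma> t) > 0" by blast
    then show ?thesis by (simp add: y_def)
  qed
  define w where "w t = 1 - k * y t" for t
  have wpos: "w t > 0" if t: "t \<in> ?I" for t
  proof -
    \<comment> \<open>Since w' = - k x w, this product is constant. Hence the orbit never reaches
      the invariant line k y = 1, and real powers of \<open>w\<close> make sense.\<close>
    define E where "E t = w t * exp (k * integral {0..t} x)" for t
    have "\<exists>c. \<forall>t\<in>?I. E t = c"
    proof (rule has_derivative_zero_constant)
      fix t assume t: "t \<in> ?I"
      have "((\<lambda>t. integral {0..t} x) has_real_derivative x t) (at t within ?I)"
        by (rule integral_has_real_derivative[OF cx t])
      then have "(E has_real_derivative 0) (at t within ?I)"
        unfolding E_def w_def using dy[OF t] by (auto intro!: derivative_eq_intros simp: algebra_simps)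
      then show "(E has_derivative (\<lambda>h. 0)) (at t within ?I)"
        by (simp add: has_field_derivative_def lambda_zero)
    qed simp
    then have "E t = E 0" using t T(1) by fastforce
    then have "w t * exp (k * integral {0..t} x) > 0" by (simp add: E_def w_def y0)
    then show ?thesis by (simp add: zero_less_mult_iff)
  qed
  define a where "a = k * L"
  \<comment> \<open>Because k^2 = 1, the exponent k L leads to P' = - L x P, which cancels the term
    L x^2 in the derivative of \<open>X1\<close>.\<close>
  have ak: "a * k = L" by (simp add: a_def k mult.commute[of "k * L"] flip: mult.assoc)
  define P where "P t = w t powr a" for t
  have dw: "(w has_real_derivative - (k * (x t * w t))) (at t within ?I)" if "t \<in> ?I" for t
    unfolding w_def using dy[OF that] by (auto intro!: derivative_eq_intros)
  have dP: "(P has_real_derivative - (L * x t * P t)) (at t within ?I)" if t: "t \<in> ?I" for t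
  proof -
    have "(P has_real_derivative a * w t powr (a - 1) * - (k * (x t * w t))) (at t within ?I)"
      unfolding P_def by (rule DERIV_chain2[OF has_real_derivative_powr[OF wpos[OF t]] dw[OF t]])
    moreover have "a * w t powr (a - 1) * - (k * (x t * w t)) = - (a * k * x t * P t)"
      using wpos[OF t] by (simp add: P_def powr_diff)
    ultimately show ?thesis unfolding ak by (simp only:)
  qed
  define X1 h1 where "X1 t = x t * P t" and "h1 t = (1 - N * y t) * P t" for t
  have dX1: "(X1 has_real_derivative y t * (M * X1 t - h1 t)) (at t within ?I)" if t: "t \<in> ?I" for t
    unfolding X1_def h1_def
    by (rule DERIV_cong[OF DERIV_mult[OF dx[OF t] dP[OF t]]]) (simp add: algebra_simps power2_eq_square)
  have dh1: "(h1 has_real_derivative y t * (N * (k - N) * X1 t)) (at t within ?I)" if t: "t \<in> ?I" for t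
  proof -
    have "((\<lambda>t. 1 - N * y t) has_real_derivative - (N * (x t * (1 - k * y t)))) (at t within ?I)"
      using dy[OF t] by (auto intro!: derivative_eq_intros)
    from DERIV_mult[OF this dP[OF t]] show ?thesis
      unfolding X1_def h1_def by (rule DERIV_cong) (simp add: L algebra_simps)
  qed
  \<comment> \<open>The maximum of y on the arc. Up to this height 1 - k u stays positive, so the
    integrand \<open>g\<close> defining \<open>Y1\<close> is continuous on the whole range of
    y.\<close>
  obtain ym where ym: "ym \<ge> 0" "\<And>t. t \<in> ?I \<Longrightarrow> y t \<le> ym" "1 - k * ym > 0"
  proof -
    obtain t0 where "t0 \<in> ?I" "\<And>t. t \<in> ?I \<Longrightarrow> y t \<le> y t0"
      using continuous_attains_sup[of ?I y] cy T(1) by auto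
    then show thesis using that[of "y t0"] ynn[of t0] wpos[of t0] by (auto simp: w_def)
  qed
  have wpos': "1 - k * u > 0" if "u \<in> {0..ym}" for u
  proof (cases "k \<le> 0")
    case True
    then show ?thesis using that mult_nonpos_nonneg[of k u] by simp
  next
    case False
    then have "k * u \<le> k * ym" using that by (intro mult_left_mono) auto
    then show ?thesis using ym(3) by linarith
  qed
  define g where "g u = u * (1 - k * u) powr (a - 1)" for u
  have cg: "continuous_on {0..ym} g"
  proof -
    have "1 - k * u \<noteq> 0" if "u \<in> {0..ym}" for u using wpos'[OF that] by simp
    then show ?thesis unfolding g_def by (intro continuous_intros ballI)
  qed
  define G where "G v = integral {0..v} g" for v
  have dG: "(G has_real_derivative g v) (at v within {0..ym})" if "v \<in> {0..ym}" for v
    unfolding G_def by (rule integral_has_real_derivative[OF cg that])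
  have Gpos: "G v > 0" if "0 < v" "v \<le> ym" for v
  proof -
    have "\<exists>z\<in>{0<..<v}. G v - G 0 = (\<lambda>h. h * g z) (v - 0)"
    proof (rule mvt_simple[OF that(1)])
      fix u assume "0 \<le> u" "u \<le> v"
      then have "(G has_real_derivative g u) (at u within {0..v})"
        using that by (intro DERIV_subset[OF dG]) auto
      then show "(G has_derivative (\<lambda>h. h * g u)) (at u within {0..v})"
        by (simp add: has_field_derivative_def mult_commute_abs)
    qed
    then obtain z where z: "0 < z" "z < v" "G v = v * g z" by (auto simp: G_def)
    have "g z > 0" unfolding g_def using z that wpos'[of z] by simp
    then show ?thesis using z that by simp
  qed
  define Y1 where "Y1 t = G (y t)" for t
  have dY1: "(Y1 has_real_derivative y t * X1 t) (at t within ?I)" if t: "t \<in> ?I" for t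
  proof -
    have sub: "y ` ?I \<subseteq> {0..ym}" using ynn ym(2) by auto
    have "(G has_real_derivative g (y t)) (at (y t) within y ` ?I)"
      using ynn[OF t] ym(2)[OF t] by (intro DERIV_subset[OF dG sub]) auto
    from DERIV_image_chain[OF this dy[OF t]]
    have "(Y1 has_real_derivative g (y t) * (x t * (1 - k * y t))) (at t within ?I)"
      unfolding Y1_def by (simp add: o_def)
    moreover have "g (y t) * (x t * (1 - k * y t)) = y t * X1 t"
    proof -
      have "w t powr (a - 1) * w t = P t"
        unfolding P_def using wpos[OF t] by (simp add: powr_diff)
      moreover have "g (y t) * (x t * (1 - k * y t)) = y t * (x t * (w t powr (a - 1) * w t))"
        by (simp add: g_def w_def mult_ac)
      ultimately show ?thesis by (simp add: X1_def)
    qed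
    ultimately show ?thesis by simp
  qed
  \<comment> \<open>The new time; it increases strictly because y is positive inside the
    arc.\<close>
  define \<sigma> where "\<sigma> t = integral {0..t} y" for t
  have d\<sigma>: "(\<sigma> has_real_derivative y t) (at t within ?I)" if "t \<in> ?I" for t
    unfolding \<sigma>_def by (rule integral_has_real_derivative[OF cy that])
  have \<sigma>0: "\<sigma> 0 = 0" by (simp add: \<sigma>_def)
  have \<sigma>mono: "\<sigma> t < \<sigma> t'" if "0 \<le> t" "t < t'" "t' \<le> T" for t t'
  proof -
    have "\<exists>z\<in>{t<..<t'}. \<sigma> t' - \<sigma> t = (\<lambda>h. h * y z) (t' - t)"
    proof (rule mvt_simple[OF that(2)])
      fix u assume "t \<le> u" "u \<le> t'"
      then have "(\<sigma> has_real_derivative y u) (at u within {t..t'})"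
        using that by (intro DERIV_subset[OF d\<sigma>]) auto
      then show "(\<sigma> has_derivative (\<lambda>h. h * y u)) (at u within {t..t'})"
        by (simp add: has_field_derivative_def mult_commute_abs)
    qed
    then obtain z where z: "t < z" "z < t'" "\<sigma> t' - \<sigma> t = (t' - t) * y z" by auto
    have "y z > 0" using ypos z that by (auto simp: y_def)
    then have "(t' - t) * y z > 0" using that by simp
    then show ?thesis using z by linarith
  qed
  have c\<sigma>: "continuous_on ?I \<sigma>"
    using d\<sigma> by (meson DERIV_continuous continuous_on_eq_continuous_within)
  have \<sigma>le: "0 \<le> \<sigma> t" "\<sigma> t \<le> \<sigma> T" if "t \<in> ?I" for t
  proof -
    show "0 \<le> \<sigma> t" using \<sigma>mono[of 0 t] that \<sigma>0 by (cases "t = 0") auto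
    show "\<sigma> t \<le> \<sigma> T" using \<sigma>mono[of t T] that by (cases "t = T") auto
  qed
  have comp: "((\<lambda>t. F (\<sigma> t)) has_real_derivative F' * y t) (at t within ?I)"
    if t: "t \<in> ?I" and F: "(F has_real_derivative F') (at (\<sigma> t) within {0..\<sigma> T})" for F F' t
  proof -
    have "(F has_real_derivative F') (at (\<sigma> t) within \<sigma> ` ?I)"
      using \<sigma>le by (intro DERIV_subset[OF F]) auto
    from DERIV_image_chain[OF this d\<sigma>[OF t]] show ?thesis by (simp add: o_def)
  qed
  \<comment> \<open>Composing the linear solutions with \<open>\<sigma>\<close> and comparing in the
    original time avoids inverting \<open>\<sigma>\<close>. The differences solve a linear system
    with zero initial value and coefficients bounded through \<open>ym\<close>, so they
    vanish.\<close>
  define u1 u2 u3 where "u1 t = Y1 t - Y (\<sigma> t)" and "u2 t = X1 t - X (\<sigma> t)" and "u3 t = h1 t - h (\<sigma> t)" for t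
  define A where "A t = (y t * u2 t, y t * (M * u2 t - u3 t), y t * (N * (k - N) * u2 t))" for t
  have zero: "(u1 t, u2 t, u3 t) = 0" if t: "t \<in> ?I" for t
  proof (rule gronwall_zero[where u = "\<lambda>t. (u1 t, u2 t, u3 t)" and u' = A and T = T])
    fix t assume t: "t \<in> ?I"
    have s: "\<sigma> t \<in> {0..\<sigma> T}" using \<sigma>le[OF t] by simp
    have "(u1 has_real_derivative y t * u2 t) (at t within ?I)"
      unfolding u1_def u2_def
      by (rule DERIV_cong[OF DERIV_diff[OF dY1[OF t] comp[OF t Y(1)[OF s]]]]) (simp add: algebra_simps)
    moreover have "(u2 has_real_derivative y t * (M * u2 t - u3 t)) (at t within ?I)"
      unfolding u2_def u3_def
      by (rule DERIV_cong[OF DERIV_diff[OF dX1[OF t] comp[OF t X(1)]]]) (simp add: algebra_simps)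
    moreover have "(u3 has_real_derivative y t * (N * (k - N) * u2 t)) (at t within ?I)"
      unfolding u2_def u3_def
      by (rule DERIV_cong[OF DERIV_diff[OF dh1[OF t] comp[OF t h(1)]]]) (simp add: algebra_simps)
    ultimately show "((\<lambda>t. (u1 t, u2 t, u3 t)) has_vector_derivative A t) (at t within ?I)"
      unfolding A_def has_real_derivative_iff_has_vector_derivative by (intro has_vector_derivative_Pair)
    define n where "n = norm (u1 t, u2 t, u3 t)"
    have n: "\<bar>u2 t\<bar> \<le> n" "\<bar>u3 t\<bar> \<le> n"
      unfolding n_def using norm_snd_le[of "(u2 t, u3 t)" "u1 t"] norm_fst_le[of "u2 t" "u3 t"] norm_snd_le[of "u3 t" "u2 t"]
      by auto
    have yb: "\<bar>y t\<bar> \<le> ym" using ynn[OF t] ym(2)[OF t] by simp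
    have "norm (A t) \<le> \<bar>y t * u2 t\<bar> + (\<bar>y t * (M * u2 t - u3 t)\<bar> + \<bar>y t * (N * (k - N) * u2 t)\<bar>)"
      unfolding A_def
      using norm_Pair_le[of "y t * u2 t" "(y t * (M * u2 t - u3 t), y t * (N * (k - N) * u2 t))"]
        norm_Pair_le[of "y t * (M * u2 t - u3 t)" "y t * (N * (k - N) * u2 t)"] by simp
    also have "\<dots> \<le> ym * n + (ym * (\<bar>M\<bar> * n + n) + ym * (\<bar>N * (k - N)\<bar> * n))"
      by (intro add_mono abs_mult_le abs_diff_le yb n) auto
    finally show "norm (A t) \<le> ym * (2 + \<bar>M\<bar> + \<bar>N * (k - N)\<bar>) * norm (u1 t, u2 t, u3 t)"
      unfolding n_def[symmetric] by (simp add: algebra_simps)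
  next
    show "(u1 0, u2 0, u3 0) = 0"
      unfolding u1_def u2_def u3_def Y1_def X1_def h1_def P_def w_def
      by (simp add: y0 \<sigma>0 Y(2) X(2) h(2) G_def zero_prod_def)
  qed (rule t)
  have eq: "Y (\<sigma> t) = G (y t)" "X (\<sigma> t) = X1 t" if "t \<in> ?I" for t
    using zero[OF that] by (auto simp: u1_def u2_def Y1_def zero_prod_def)
  show ?thesis
  proof (intro exI conjI ballI)
    show "\<sigma> T > 0" using \<sigma>mono[of 0 T] T(1) \<sigma>0 by simp
    have TI: "T \<in> ?I" using T(1) by simp
    show "Y (\<sigma> T) = 0" using eq(1)[OF TI] y0 by (simp add: G_def)
    show "X (\<sigma> T) = - s" using eq(2)[OF TI] y0 by (simp add: X1_def P_def w_def)
    fix v assume v: "v \<in> {0<..<\<sigma> T}"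
    have "\<exists>t\<ge>0. t \<le> T \<and> \<sigma> t = v"
      by (rule IVT'[of \<sigma>]) (use v \<sigma>0 T(1) c\<sigma> in auto)
    then obtain t where t: "t \<in> ?I" "\<sigma> t = v" by auto
    then have "t \<noteq> 0" "t \<noteq> T" using v \<sigma>0 by auto
    then have "y t > 0" using ypos t by (auto simp: y_def)
    then show "Y v > 0" using eq(1)[OF t(1)] Gpos[of "y t"] ym(2)[OF t(1)] t(2) by simp
  qed
qed

text \<open>The coefficient N (k - N) is n (1 - n) for both halves, so one linear system with one
  initial value governs both. Its solution is written through \<open>e\<close>; both halves stop at
  the first positive zero of \<open>Y\<close> and therefore share the value of \<open>X\<close>
  there.\<close>

lemma half_return_linear_center:
  assumes "half_return (0, - n, m, n, 1) r s" "half_return (0, n, m, - n, - 1) r s'"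
  shows "s = s'"
proof -
  define c where "c = n * (1 - n)"
  obtain e e' where e: "\<And>t S. (e has_real_derivative e' t) (at t within S)"
    "\<And>t S. (e' has_real_derivative m * e' t - c * e t) (at t within S)" "e 0 = 0" "e' 0 = 1"
    by (rule linear_oscillator_exists[of m c]) (rule that)
  define X h Y where "X t = r * e' t - e t" and "h t = e' t - m * e t + r * c * e t"
    and "Y t = r * e t - integral {0..t} e" for t
  have X: "(X has_real_derivative m * X t - h t) (at t within S)" for t S
    unfolding X_def h_def by (auto intro!: derivative_eq_intros e simp: algebra_simps)
  have h: "(h has_real_derivative c * X t) (at t within S)" for t S
    unfolding X_def h_def by (auto intro!: derivative_eq_intros e simp: algebra_simps)
  have ce: "continuous_on S e" for S
    using e(1) by (meson DERIV_continuous continuous_on_eq_continuous_within)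
  have Y: "(Y has_real_derivative X t) (at t within {0..B})" if "t \<in> {0..B}" for t B
    unfolding Y_def X_def
    by (intro DERIV_diff DERIV_cmult e(1) integral_has_real_derivative[OF ce that])
  have c: "c = n * (1 - n)" "c = (- n) * (- 1 - (- n))" by (simp_all add: c_def algebra_simps)
  have i: "X 0 = r" "h 0 = 1" "Y 0 = 0" by (simp_all add: X_def h_def Y_def e)
  have "\<exists>\<Sigma>>0. Y \<Sigma> = 0 \<and> (\<forall>t\<in>{0<..<\<Sigma>}. Y t > 0) \<and> X \<Sigma> = - s"
    by (rule half_return_linear[OF assms(1) _ _ X i(1) h[unfolded c(1)] i(2) Y i(3)]) auto
  then obtain S1 where S1: "S1 > 0" "Y S1 = 0" "\<forall>t\<in>{0<..<S1}. Y t > 0" "X S1 = - s" by blast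
  have "\<exists>\<Sigma>>0. Y \<Sigma> = 0 \<and> (\<forall>t\<in>{0<..<\<Sigma>}. Y t > 0) \<and> X \<Sigma> = - s'"
    by (rule half_return_linear[OF assms(2) _ _ X i(1) h[unfolded c(2)] i(2) Y i(3)]) auto
  then obtain S2 where S2: "S2 > 0" "Y S2 = 0" "\<forall>t\<in>{0<..<S2}. Y t > 0" "X S2 = - s'" by blast
  have "\<not> S1 < S2"
  proof
    assume "S1 < S2"
    then have "Y S1 > 0" using S1(1) by (intro bspec[OF S2(3)]) simp
    then show False using S1(2) by simp
  qed
  moreover have "\<not> S2 < S1"
  proof
    assume "S2 < S1"
    then have "Y S2 > 0" using S2(1) by (intro bspec[OF S1(3)]) simp
    then show False using S2(2) by simp
  qed
  ultimately have "S1 = S2" by linarith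
  then show ?thesis using S1(4) S2(4) by simp
qed

lemma displacement_center:
  assumes "m = 0 \<or> 2 * l + n1 + n2 = 0 \<and> (n1 = n2 \<or> n1 + n2 = 1)"
  shows "\<forall>\<^sub>F r in at_right 0. displacement (0, l, m, m, n1, n2) r = 0"
proof -
  let ?p = "(0, l, m, m, n1, n2)"
  obtain C where box: "params_box C ?p" by (rule params_box_exists[of ?p]) auto
  have b: "half_box C (0, l, m, n1, 1)" "half_box C (0, - l, m, - n2, - 1)"
    using box by (auto simp: params_box_def)
  have \<delta>: "half_radius C > 0" using half_radius_pos[OF b(1)] .
  have "displacement ?p r = 0" if r: "0 < r" "r < half_radius C / 12" for r
  proof -
    have r': "r \<le> half_radius C" using r \<delta> by simp
    have D: "displacement ?p r = half_map (0, - l, m, - n2, - 1) r - half_map (0, l, m, n1, 1) r"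
      using displacement_eq(2)[OF box r(1) r'] by simp
    consider "m = 0" | "2 * l + n1 + n2 = 0" "n1 = n2" | "2 * l + n1 + n2 = 0" "n1 + n2 = 1"
      using assms by blast
    then show ?thesis
    proof cases
      case 1
      then show ?thesis unfolding D using half_map_reversible[of C _ _ _ r] b r by simp
    next
      case 2
      then have l: "l = - n1" by simp
      have "half_map (0, - n1, m, n1, 1) r = half_map (0, n1, m, - n1, - 1) r"
      proof (rule half_return_linear_center)
        show "half_return (0, - n1, m, n1, 1) r (half_map (0, - n1, m, n1, 1) r)"
          using half_return_iff_half_map[OF b(1) r(1) r'] by (simp add: l)
        show "half_return (0, n1, m, - n1, - 1) r (half_map (0, n1, m, - n1, - 1) r)"
          using half_return_iff_half_map[OF b(2) r(1) r'] 2(2) by (simp add: l)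
      qed
      then show ?thesis using D l 2(2) by simp
    next
      case 3
      \<comment> \<open>The two conditions force the value of \<open>l\<close> for which
        \<open>half_sol_involution\<close> is stated.\<close>
      then have l: "l = - 1/2" by simp
      have "half_map (0, l, m, n1, 1) r = half_map (0, - l, m, - n2, - 1) r"
        unfolding half_map_def l using half_sol_involution[OF 3(2), of m] by simp
      then show ?thesis using D by simp
    qed
  qed
  then show ?thesis unfolding eventually_at_right_field using \<delta> by (intro exI[of _ "half_radius C / 12"]) auto
qed

lemma weak_focus_order_le_4:
  assumes "weak_focus_of_order p q"
  shows "q \<le> 4"
proof (rule ccontr)
  assume "\<not> q \<le> 4"
  obtain W where W: "fst p = 0" "displacement_series p W" "\<forall>k. 1 \<le> k \<and> k < q \<longrightarrow> W k = 0" "W q \<noteq> 0"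
    using assms unfolding weak_focus_of_order_def by blast
  obtain l m1 m2 n1 n2 where p: "p = (0, l, m1, m2, n1, n2)" using W(1) by (cases p) auto
  obtain \<epsilon> where e: "\<epsilon> > 0" "\<And>r. 0 < r \<Longrightarrow> r < \<epsilon> \<Longrightarrow> (\<lambda>k. W k * r ^ k) sums displacement p r"
    using W(2) unfolding displacement_series_def by auto
  have c: "W j = x" if "((\<lambda>r. displacement p r / r ^ j) \<longlongrightarrow> x) (at_right 0)" for j x
    by (rule power_series_leading_coeff(2)[OF e(1) _ that]) (rule e(2))
  have W0: "W 2 = 0" "W 3 = 0" "W 4 = 0" using W(3) \<open>\<not> q \<le> 4\<close> by simp_all
  have "W 2 = 2/3 * (m2 - m1)" by (rule c[unfolded p, OF displacement_leading(1)])
  with W0 have m: "m1 = m2" by simp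
  have "W 3 = - (m2 * pi * (2 * l + n1 + n2) / 8)" by (rule c[unfolded p, OF displacement_leading(2)[OF m]])
  with W0 have w3: "m2 = 0 \<or> 2 * l + n1 + n2 = 0" by simp
  have "W 4 = 4/45 * m2 * (n2 - n1) * (n1 + n2 - 1)" if "2 * l + n1 + n2 = 0"
    by (rule c[unfolded p, OF displacement_leading(3)[OF m that]])
  with W0 w3 have "m2 = 0 \<or> 2 * l + n1 + n2 = 0 \<and> (n1 = n2 \<or> n1 + n2 = 1)" by auto
  \<comment> \<open>At a center the displacement vanishes identically near 0, which annihilates the
    coefficient of order \<open>q\<close> too.\<close>
  from displacement_center[OF this] have "\<forall>\<^sub>F r in at_right 0. displacement p r = 0" by (simp add: p m)
  then have "((\<lambda>r. displacement p r / r ^ q) \<longlongrightarrow> 0) (at_right 0)"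
    by (intro tendsto_eventually) (auto elim: eventually_mono)
  then have "W q = 0" by (rule c)
  with W(4) show False by simp
qed

section \<open>Global solutions\<close>

definition global_solution :: "('a::real_normed_vector \<Rightarrow> 'a) \<Rightarrow> (real \<Rightarrow> 'a) \<Rightarrow> bool" where
  "global_solution X g \<longleftrightarrow> (\<forall>t. (g has_vector_derivative X (g t)) (at t))"

lemma solves_concat:
  assumes "solves X \<alpha> S" "solves X \<beta> T" "\<alpha> S = \<beta> 0" "0 \<le> S" "0 \<le> T"
  shows "solves X (\<lambda>t. if t \<le> S then \<alpha> t else \<beta> (t - S)) (S + T)"
  unfolding solves_def
proof
  fix t assume t: "t \<in> {0..S + T}"
  have c: "{0..S} \<union> (closure {0..S} \<inter> closure {S..S + T}) = {0..S}"
    "{S..S + T} \<union> (closure {0..S} \<inter> closure {S..S + T}) = {S..S + T}"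
    using assms(4,5) by auto
  have "((\<lambda>t. if t \<in> {0..S} then \<alpha> t else \<beta> (t - S)) has_vector_derivative
      (if t \<in> {0..S} then X (\<alpha> t) else X (\<beta> (t - S)))) (at t within {0..S + T})"
  proof (rule has_vector_derivative_If_within_closures[where T = "{S..S + T}"], unfold c)
    show "t \<in> {0..S} \<union> {S..S + T}" "{0..S + T} = {0..S} \<union> {S..S + T}" using t assms(4,5) by auto
    show "(\<alpha> has_vector_derivative X (\<alpha> t)) (at t within {0..S})" if "t \<in> {0..S}"
      using assms(1) that by (simp add: solves_def)
    show "((\<lambda>t. \<beta> (t - S)) has_vector_derivative X (\<beta> (t - S))) (at t within {S..S + T})" if "t \<in> {S..S + T}"
    proof -
      have "(\<beta> has_vector_derivative X (\<beta> (t - S))) (at (t - S) within (\<lambda>t. t - S) ` {S..S + T})"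
        using assms(2) that by (auto simp: solves_def)
      then have "((\<beta> \<circ> (\<lambda>t. t - S)) has_vector_derivative 1 *\<^sub>R X (\<beta> (t - S))) (at t within {S..S + T})"
        by (intro vector_diff_chain_within) (auto intro!: derivative_eq_intros)
      then show ?thesis by (simp add: o_def)
    qed
  qed (use assms(3) in auto)
  then have "((\<lambda>t. if t \<le> S then \<alpha> t else \<beta> (t - S)) has_vector_derivative
      (if t \<in> {0..S} then X (\<alpha> t) else X (\<beta> (t - S)))) (at t within {0..S + T})"
    by (rule has_vector_derivative_transform[rotated 2]) (use t in auto)
  moreover have "(if t \<in> {0..S} then X (\<alpha> t) else X (\<beta> (t - S))) = X (if t \<le> S then \<alpha> t else \<beta> (t - S))"
    using t by auto
  ultimately show "((\<lambda>t. if t \<le> S then \<alpha> t else \<beta> (t - S)) has_vector_derivative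
      X (if t \<le> S then \<alpha> t else \<beta> (t - S))) (at t within {0..S + T})"
    by simp
qed

text \<open>The curve is repeated by means of \<open>frac\<close>. Differentiability is in question
  only at multiples of \<open>T\<close>; around each of them the extension is a translate of two
  consecutive copies, \<open>\<delta>\<close>, which \<open>solves_concat\<close> shows to be a
  solution.\<close>

lemma periodic_extension:
  assumes g: "solves X \<gamma> T" "T > 0" "\<gamma> T = \<gamma> 0"
  obtains g where "global_solution X g" "\<And>t. g (t + T) = g t" "\<And>t. t \<in> {0..T} \<Longrightarrow> g t = \<gamma> t" "range g = \<gamma> ` {0..T}"
proof -
  define g where "g t = \<gamma> (T * frac (t / T))" for t
  define \<delta> where "\<delta> t = (if t \<le> T then \<gamma> t else \<gamma> (t - T))" for t
  have \<delta>: "solves X \<delta> (T + T)"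
    unfolding \<delta>_def using solves_concat[OF g(1,1)] g by simp
  have g\<delta>: "g u = \<delta> (u - (n - 1) * T)" if u: "(of_int n - 1) * T < u" "u < (of_int n + 1) * T" for u and n :: int
  proof (cases "u < n * T")
    case True
    then have "\<lfloor>u / T\<rfloor> = n - 1" using u g(2) by (intro floor_unique) (auto simp: field_simps)
    then have "g u = \<gamma> (T * (u / T - of_int (n - 1)))" by (simp only: g_def frac_def)
    moreover have "T * (u / T - of_int (n - 1)) = u - (n - 1) * T" using g(2) by (simp add: field_simps)
    moreover have "u - (n - 1) * T \<le> T" using True by (simp add: algebra_simps)
    ultimately show ?thesis by (simp add: \<delta>_def)
  next
    case False
    then have f: "\<lfloor>u / T\<rfloor> = n" using u g(2) by (intro floor_unique) (auto simp: field_simps)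
    have "T * (u / T - of_int n) = u - n * T" using g(2) by (simp add: field_simps)
    with f have gu: "g u = \<gamma> (u - n * T)" by (simp add: g_def frac_def)
    show ?thesis
    proof (cases "u = n * T")
      case True
      then show ?thesis using gu g(3) by (simp add: \<delta>_def algebra_simps)
    next
      case False
      then have "\<not> u - (n - 1) * T \<le> T" using \<open>\<not> u < n * T\<close> by (simp add: algebra_simps)
      then show ?thesis using gu by (simp add: \<delta>_def algebra_simps)
    qed
  qed
  show thesis
  proof (rule that)
    show "global_solution X g"
      unfolding global_solution_def
    proof
      fix t :: real
      define n where "n = \<lfloor>t / T\<rfloor>"
      have "n \<le> t / T" "t / T < n + 1" by (simp_all add: n_def)
      then have n: "(of_int n - 1) * T < t" "t < (of_int n + 1) * T" using g(2) by (auto simp: field_simps)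
      define I where "I = {(of_int n - 1) * T<..<(of_int n + 1) * T}"
      have "((\<lambda>u. u - (n - 1) * T) ` I) \<subseteq> {0..T + T}" unfolding I_def by (auto simp: algebra_simps)
      moreover have "(\<delta> has_vector_derivative X (\<delta> (t - (n - 1) * T))) (at (t - (n - 1) * T) within {0..T + T})"
        using \<delta> n unfolding solves_def by (auto simp: algebra_simps)
      ultimately have "(\<delta> has_vector_derivative X (\<delta> (t - (n - 1) * T))) (at (t - (n - 1) * T) within (\<lambda>u. u - (n - 1) * T) ` I)"
        by (rule has_vector_derivative_within_subset[rotated])
      then have "((\<delta> \<circ> (\<lambda>u. u - (n - 1) * T)) has_vector_derivative 1 *\<^sub>R X (\<delta> (t - (n - 1) * T))) (at t within I)"
        by (intro vector_diff_chain_within) (auto intro!: derivative_eq_intros)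
      then have "((\<lambda>u. \<delta> (u - (n - 1) * T)) has_vector_derivative X (g t)) (at t within I)"
        using g\<delta>[OF n] by (simp add: o_def)
      then have "(g has_vector_derivative X (g t)) (at t within I)"
        by (rule has_vector_derivative_transform[rotated 2]) (use n g\<delta> in \<open>auto simp: I_def\<close>)
      moreover have "at t within I = at t" by (rule at_within_open) (use n in \<open>auto simp: I_def\<close>)
      ultimately show "(g has_vector_derivative X (g t)) (at t)" by simp
    qed
    show "g (t + T) = g t" for t
    proof -
      have "(t + T) / T = t / T + 1" using g(2) by (simp add: field_simps)
      then show ?thesis by (simp add: g_def frac_1_eq)
    qed
    show gI: "g t = \<gamma> t" if "t \<in> {0..T}" for t
    proof (cases "t = T")
      case True
      then show ?thesis using g by (simp add: g_def)
    next
      case False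
      then have "frac (t / T) = t / T" using that g(2) by (simp add: frac_eq field_simps)
      then show ?thesis using g(2) by (simp add: g_def)
    qed
    show "range g = \<gamma> ` {0..T}"
    proof
      have "T * frac (t / T) \<in> {0..T}" for t
        using g(2) frac_ge_0[of "t / T"] less_imp_le[OF frac_lt_1[of "t / T"]] by (simp add: mult_left_le)
      then show "range g \<subseteq> \<gamma> ` {0..T}" unfolding g_def by blast
      show "\<gamma> ` {0..T} \<subseteq> range g" using gI by (metis image_subsetI rangeI)
    qed
  qed
qed

lemma global_solution_solves:
  assumes "global_solution X g"
  shows "solves X (\<lambda>t. g (a + t)) T" "solves (\<lambda>z. - X z) (\<lambda>t. g (a - t)) T"
proof -
  have d: "(g has_vector_derivative X (g t)) (at t)" for t using assms by (simp add: global_solution_def)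
  have "((g \<circ> (\<lambda>t. a + t)) has_vector_derivative 1 *\<^sub>R X (g (a + t))) (at t)" for t
    by (rule vector_diff_chain_at) (auto intro!: derivative_eq_intros d)
  then show "solves X (\<lambda>t. g (a + t)) T"
    unfolding solves_def by (auto simp: o_def intro: has_vector_derivative_at_within)
  have "((g \<circ> (\<lambda>t. a - t)) has_vector_derivative (- 1) *\<^sub>R X (g (a - t))) (at t)" for t
    by (rule vector_diff_chain_at) (auto intro!: derivative_eq_intros d)
  then show "solves (\<lambda>z. - X z) (\<lambda>t. g (a - t)) T"
    unfolding solves_def by (auto simp: o_def intro: has_vector_derivative_at_within)
qed

lemma locally_lipschitz_uminus: "locally_lipschitz X \<Longrightarrow> locally_lipschitz (\<lambda>z. - X z)"
  unfolding locally_lipschitz_def by (simp add: norm_minus_commute)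

text \<open>Forward uniqueness carries membership from the start of the arc to its end, and
  uniqueness for the time-reversed field carries it back.\<close>

lemma arc_endpoints_in_range:
  fixes X :: "'a::real_inner \<Rightarrow> 'a"
  assumes X: "locally_lipschitz X" and g: "global_solution X g" and \<gamma>: "solves X \<gamma> T" "0 \<le> T"
  shows "\<gamma> 0 \<in> range g \<longleftrightarrow> \<gamma> T \<in> range g"
proof
  assume "\<gamma> 0 \<in> range g"
  then obtain a where a: "\<gamma> 0 = g a" by auto
  have "\<gamma> T = g (a + T)"
    by (rule solves_unique[OF X \<gamma>(1) global_solution_solves(1)[OF g]]) (use a \<gamma>(2) in auto)
  then show "\<gamma> T \<in> range g" by simp
next
  assume "\<gamma> T \<in> range g"
  then obtain a where a: "\<gamma> T = g a" by auto
  have "\<gamma> (T - T) = g (a - T)"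
    by (rule solves_unique[OF locally_lipschitz_uminus[OF X] solves_time_reversed[OF \<gamma>(1)] global_solution_solves(2)[OF g]])
       (use a \<gamma>(2) in auto)
  then show "\<gamma> 0 \<in> range g" by simp
qed

lemma global_solution_range_eq:
  fixes X :: "'a::real_inner \<Rightarrow> 'a"
  assumes X: "locally_lipschitz X" and g: "global_solution X g" "global_solution X f" and "g a = f b"
  shows "range g = range f"
proof -
  have sub: "range g \<subseteq> range f" if "global_solution X g" "global_solution X f" "g a = f b" for g f a b
  proof
    fix z assume "z \<in> range g"
    then obtain t where z: "z = g t" by auto
    show "z \<in> range f"
    proof (cases "a \<le> t")
      case True
      have "g (a + (t - a)) = f (b + (t - a))"
        by (rule solves_unique[OF X global_solution_solves(1)[OF that(1)] global_solution_solves(1)[OF that(2)], where T = "t - a"])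
           (use True that(3) in auto)
      then show ?thesis using z by simp
    next
      case False
      have "g (a - (a - t)) = f (b - (a - t))"
        by (rule solves_unique[OF locally_lipschitz_uminus[OF X] global_solution_solves(2)[OF that(1)]
              global_solution_solves(2)[OF that(2)], where T = "a - t"])
           (use False that(3) in auto)
      then show ?thesis using z by simp
    qed
  qed
  show ?thesis using sub[OF g assms(4)] sub[OF g(2,1) assms(4)[symmetric]] by blast
qed

lemma pw_upper_arc:
  assumes "params_box C p" "0 < r" "r \<le> half_radius C"
  obtains T \<gamma> R where "T > 0" "solves (pw_field p) \<gamma> T" "\<gamma> 0 = (r, 0)" "\<gamma> T = (- half_map (upper_half p) r, 0)"
    "continuous_on {0..pi} R" "\<And>t. t \<in> {0..pi} \<Longrightarrow> 0 < R t \<and> R t \<le> 4 * r" "R 0 = r" "R pi = half_map (upper_half p) r"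
    "\<gamma> ` {0..T} = (\<lambda>t. (R t * cos t, R t * sin t)) ` {0..pi}"
proof -
  have b: "half_box C (upper_half p)" using assms(1) by (simp add: params_box_def)
  obtain T \<gamma> R where T: "T > 0" "solves (half_field (upper_half p)) \<gamma> T" "\<gamma> 0 = (r, 0)" "\<gamma> T = (- half_map (upper_half p) r, 0)"
    "\<And>t. t \<in> {0<..<T} \<Longrightarrow> snd (\<gamma> t) > 0"
    "continuous_on {0..pi} R" "\<And>t. t \<in> {0..pi} \<Longrightarrow> 0 < R t \<and> R t \<le> 4 * r" "R 0 = r" "R pi = half_map (upper_half p) r"
    "\<gamma> ` {0..T} = (\<lambda>t. (R t * cos t, R t * sin t)) ` {0..pi}"
    by (rule half_arc_exists[OF b assms(2,3)]) (rule that)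
  have "solves (pw_field p) \<gamma> T"
  proof (rule solves_cong[OF T(2)])
    fix t assume "t \<in> {0..T}"
    then have "t = 0 \<or> t = T \<or> t \<in> {0<..<T}" by auto
    then have "snd (\<gamma> t) \<ge> 0" using T(3,4) T(5)[of t] by auto
    then show "half_field (upper_half p) (\<gamma> t) = pw_field p (\<gamma> t)"
      by (simp add: pw_field_upper upper_field_eq_half)
  qed
  then show thesis by (rule that[OF T(1) _ T(3,4) T(6-10)])
qed

lemma pw_lower_arc:
  assumes "params_box C p" "0 < r" "r \<le> half_radius C"
  obtains T \<gamma> R where "T > 0" "solves (pw_field p) \<gamma> T" "\<gamma> 0 = (- half_map (lower_half p) r, 0)" "\<gamma> T = (r, 0)"
    "continuous_on {0..pi} R" "\<And>t. t \<in> {0..pi} \<Longrightarrow> 0 < R t \<and> R t \<le> 4 * r" "R 0 = r" "R pi = half_map (lower_half p) r"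
    "\<gamma> ` {0..T} = (\<lambda>t. (R t * cos t, - (R t * sin t))) ` {0..pi}"
proof -
  have b: "half_box C (lower_half p)" using assms(1) by (simp add: params_box_def)
  obtain T \<gamma> R where T: "T > 0" "solves (half_field (lower_half p)) \<gamma> T" "\<gamma> 0 = (r, 0)" "\<gamma> T = (- half_map (lower_half p) r, 0)"
    "\<And>t. t \<in> {0<..<T} \<Longrightarrow> snd (\<gamma> t) > 0"
    "continuous_on {0..pi} R" "\<And>t. t \<in> {0..pi} \<Longrightarrow> 0 < R t \<and> R t \<le> 4 * r" "R 0 = r" "R pi = half_map (lower_half p) r"
    "\<gamma> ` {0..T} = (\<lambda>t. (R t * cos t, R t * sin t)) ` {0..pi}"
    by (rule half_arc_exists[OF b assms(2,3)]) (rule that)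
  define \<beta> where "\<beta> t = reflect (\<gamma> (T - t))" for t
  have "solves (lower_field p) \<beta> T"
    unfolding \<beta>_def
    by (rule solves_reversal[where R = reflect and Y = "lower_field p", OF T(2) bounded_linear_reflect])
       (rule lower_field_reflect')
  then have "solves (pw_field p) \<beta> T"
  proof (rule solves_cong)
    fix t assume "t \<in> {0..T}"
    then have "T - t = 0 \<or> T - t = T \<or> T - t \<in> {0<..<T}" by auto
    then have "snd (\<gamma> (T - t)) \<ge> 0" using T(3,4) T(5)[of "T - t"] by auto
    then show "lower_field p (\<beta> t) = pw_field p (\<beta> t)"
      by (simp add: pw_field_lower \<beta>_def)
  qed
  moreover have "\<beta> ` {0..T} = (\<lambda>t. (R t * cos t, - (R t * sin t))) ` {0..pi}"
  proof -
    have "\<beta> ` {0..T} = reflect ` \<gamma> ` (\<lambda>t. T - t) ` {0..T}" unfolding \<beta>_def[abs_def] image_image ..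
    also have "(\<lambda>t. T - t) ` {0..T} = {0..T}" by (simp add: image_diff_atLeastAtMost)
    finally show ?thesis unfolding T(10) image_image reflect_def fst_conv snd_conv .
  qed
  moreover have "\<beta> 0 = (- half_map (lower_half p) r, 0)" "\<beta> T = (r, 0)"
    using T(3,4) by (simp_all add: \<beta>_def)
  ultimately show thesis by (intro that[OF T(1) _ _ _ T(6-9)])
qed

section \<open>Rotation of orbits around the origin\<close>

fun cross_product :: "real \<times> real \<Rightarrow> real \<times> real \<Rightarrow> real" where
  "cross_product (x, y) (u, v) = x * v - y * u"

text \<open>The cross product is |z|^2 times the angular velocity. In this disc the quadratic terms
  contribute at most |z|^2 / 2500 and the term with \<open>D\<close> at most |z|^2 / 64.\<close>

lemma half_field_rotates:
  assumes "half_box C q" "norm z \<le> half_radius C"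
  shows "cross_product z (half_field q z) \<ge> (norm z)\<^sup>2 / 2"
proof -
  obtain D L M N k where q: "q = (D, L, M, N, k)" by (cases q)
  have b: "\<bar>D\<bar> \<le> 1/64" "\<bar>L\<bar> \<le> C" "\<bar>M\<bar> \<le> C" "\<bar>N\<bar> \<le> C" "\<bar>k\<bar> \<le> C" "1 \<le> C"
    using assms q by auto
  obtain x y where z: "z = (x, y)" by (cases z)
  define n where "n = norm z"
  have nn: "n\<^sup>2 = x\<^sup>2 + y\<^sup>2" by (simp add: n_def z norm_Pair)
  have xn: "\<bar>x\<bar> \<le> n" "\<bar>y\<bar> \<le> n" unfolding n_def z using norm_fst_le[of x y] norm_snd_le[of y x] by simp_all
  have nC: "n \<le> 1 / (10000 * C)" using assms(2) half_radius_le[OF assms(1)] by (simp add: n_def)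
  have "\<bar>D * (x * y)\<bar> \<le> 1/64 * (n * n)" by (intro abs_mult_le b xn)
  moreover have "\<bar>y * ((L + k) * (x * x) + M * (x * y) + N * (y * y))\<bar> \<le>
      1 / (10000 * C) * ((C + C) * (n * n) + C * (n * n) + C * (n * n))"
    by (intro abs_mult_le abs_add_le b xn order_trans[OF xn(2) nC])
  moreover have "1 / (10000 * C) * ((C + C) * (n * n) + C * (n * n) + C * (n * n)) = n\<^sup>2 / 2500"
    using b(6) by (simp add: field_simps power2_eq_square)
  moreover have "cross_product z (half_field q z) = n\<^sup>2 - D * (x * y) - y * ((L + k) * (x * x) + M * (x * y) + N * (y * y))"
    unfolding nn by (simp add: q z algebra_simps power2_eq_square)
  moreover have "n\<^sup>2 \<ge> 0" by simp
  ultimately show ?thesis unfolding n_def[symmetric] power2_eq_square abs_le_iff by linarith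
qed

lemma pw_field_rotates:
  assumes "params_box C p" "norm z \<le> half_radius C"
  shows "cross_product z (pw_field p z) \<ge> (norm z)\<^sup>2 / 2"
proof (cases "snd z > 0")
  case True
  then show ?thesis
    using half_field_rotates[of C "upper_half p" z] assms
    by (simp add: pw_field_upper upper_field_eq_half params_box_def)
next
  case False
  have "cross_product (reflect z) (half_field (lower_half p) (reflect z)) = cross_product z (lower_field p z)"
    unfolding lower_field_reflect by (cases z; cases "lower_field p z") (simp add: reflect_def)
  then show ?thesis
    using half_field_rotates[of C "lower_half p" "reflect z"] assms False
    by (simp add: pw_field_lower params_box_def)
qed

text \<open>Otherwise -z would avoid the branch cut of \<open>Ln\<close>, so its argument
  \<open>f\<close> would be differentiable for all time, lie between -pi and pi, and grow at a rate
  of at least 1/2. Over a time 8 pi it would gain 4 pi.\<close>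

lemma global_solution_hits_positive_axis:
  assumes box: "params_box C p" and g: "global_solution (pw_field p) g"
    and small: "\<And>t. norm (g t) \<le> half_radius C" "\<And>t. g t \<noteq> 0"
  shows "\<exists>t a. 0 < a \<and> g t = (a, 0)"
proof (rule ccontr)
  assume no: "\<not> ?thesis"
  define z where "z t = Complex (fst (g t)) (snd (g t))" for t
  define z' where "z' t = Complex (fst (pw_field p (g t))) (snd (pw_field p (g t)))" for t
  have d: "(z has_vector_derivative z' t) (at t)" for t
  proof -
    have b: "bounded_linear (\<lambda>w. of_real (fst w) + \<i> * of_real (snd w) :: complex)"
      by (intro bounded_linear_add bounded_linear_compose[OF bounded_linear_of_real]
          bounded_linear_compose[OF bounded_linear_mult_right] bounded_linear_fst bounded_linear_snd)
    have "(g has_vector_derivative pw_field p (g t)) (at t)" using g by (simp add: global_solution_def)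
    from bounded_linear.has_vector_derivative[OF b this]
    show ?thesis unfolding z_def z'_def Complex_eq .
  qed
  have nz: "z t \<noteq> 0" for t using small(2)[of t] by (auto simp: z_def complex_eq_iff prod_eq_iff)
  have slit: "- z t \<notin> \<real>\<^sub>\<le>\<^sub>0" for t
  proof
    assume "- z t \<in> \<real>\<^sub>\<le>\<^sub>0"
    then have "snd (g t) = 0" "fst (g t) \<ge> 0" by (auto simp: z_def complex_nonpos_Reals_iff)
    moreover have "fst (g t) \<noteq> 0" using small(2)[of t] \<open>snd (g t) = 0\<close> by (auto simp: prod_eq_iff)
    ultimately have "0 < fst (g t) \<and> g t = (fst (g t), 0)" by (simp add: prod_eq_iff)
    with no show False by blast
  qed
  define f where "f t = Im (Ln (- z t))" for t
  have df: "(f has_real_derivative Im (z' t / z t)) (at t)" for t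
  proof -
    have "((\<lambda>t. - z t) has_vector_derivative - z' t) (at t)" by (intro has_vector_derivative_minus d)
    from field_vector_diff_chain_at[OF this has_field_derivative_Ln[OF slit]]
    have "((\<lambda>t. Ln (- z t)) has_vector_derivative - z' t * inverse (- z t)) (at t)" by (simp add: o_def)
    from bounded_linear.has_vector_derivative[OF bounded_linear_Im this]
    show ?thesis unfolding f_def by (simp add: has_real_derivative_iff_has_vector_derivative divide_inverse)
  qed
  have rot: "Im (z' t / z t) \<ge> 1/2" for t
  proof -
    have n: "(norm (g t))\<^sup>2 > 0" using small(2)[of t] by simp
    obtain x y where xy: "g t = (x, y)" by (cases "g t")
    obtain u v where uv: "pw_field p (x, y) = (u, v)" by (cases "pw_field p (x, y)")
    have "Im (z' t / z t) = cross_product (g t) (pw_field p (g t)) / (norm (g t))\<^sup>2"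
      unfolding z_def z'_def xy uv by (simp add: Im_divide norm_Pair mult.commute)
    also have "\<dots> \<ge> ((norm (g t))\<^sup>2 / 2) / (norm (g t))\<^sup>2"
      by (intro divide_right_mono pw_field_rotates[OF box small(1)]) simp
    finally show ?thesis using n by simp
  qed
  have "f (8 * pi) \<ge> f 0 + 4 * pi"
  proof -
    have "\<exists>c. 0 < c \<and> c < 8 * pi \<and> f (8 * pi) - f 0 = (8 * pi - 0) * Im (z' c / z c)"
      by (rule MVT2) (use df in auto)
    then obtain c where "f (8 * pi) - f 0 = 8 * pi * Im (z' c / z c)" by auto
    moreover have "8 * pi * (1/2) \<le> 8 * pi * Im (z' c / z c)" using rot[of c] by (intro mult_left_mono) auto
    ultimately show ?thesis by linarith
  qed
  moreover have "\<bar>f t\<bar> \<le> pi" for t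
    unfolding f_def using nz[of t] Im_Ln_le_pi[of "- z t"] mpi_less_Im_Ln[of "- z t"] by auto
  from this[of 0] this[of "8 * pi"] have "f (8 * pi) \<le> pi" "f 0 \<ge> - pi" by auto
  ultimately show False using pi_gt_zero by linarith
qed

section \<open>Limit cycles from zeros of the displacement map\<close>

text \<open>With \<open>\<rho> z\<close> the radius of the curve in the direction of z, points off
  the curve lie in one of the disjoint open sets |z| < rho and |z| > rho. The component of the
  origin is trapped in the first, which is bounded.\<close>

lemma inside_star_shaped_curve:
  fixes R1 R2 :: "real \<Rightarrow> real"
  assumes R: "continuous_on {0..pi} R1" "continuous_on {0..pi} R2" "R1 0 = R2 0" "R1 pi = R2 pi"
    and pos: "\<And>t. t \<in> {0..pi} \<Longrightarrow> 0 < R1 t" "\<And>t. t \<in> {0..pi} \<Longrightarrow> 0 < R2 t"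
    and K: "K = (\<lambda>t. (R1 t * cos t, R1 t * sin t)) ` {0..pi} \<union> (\<lambda>t. (R2 t * cos t, - (R2 t * sin t))) ` {0..pi}"
  shows "(0, 0) \<in> inside K"
proof -
  \<comment> \<open>The unsigned angle in [0, pi] serves both half planes, so no branch of the
    argument is needed; the two radial functions agree where the half planes meet.\<close>
  define \<theta> where "\<theta> z = arccos (fst z / norm z)" for z :: "real \<times> real"
  define \<rho> where "\<rho> z = (if snd z \<le> 0 then R2 (\<theta> z) else R1 (\<theta> z))" for z
  have b: "-1 \<le> fst z / norm z" "fst z / norm z \<le> 1" if "z \<noteq> 0" for z :: "real \<times> real"
    using that norm_fst_le[of "fst z" "snd z"] by (auto simp: field_simps abs_le_iff)
  have \<theta>: "\<theta> z \<in> {0..pi}" "cos (\<theta> z) = fst z / norm z" if "z \<noteq> 0" for z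
    unfolding \<theta>_def using b[OF that] arccos_bounded by (auto simp: cos_arccos)
  have sn: "\<bar>snd z\<bar> = norm z * sin (\<theta> z)" if "z \<noteq> 0" for z
  proof -
    have "(norm z * sin (\<theta> z))\<^sup>2 = (norm z)\<^sup>2 * (1 - (fst z / norm z)\<^sup>2)"
      by (simp add: power_mult_distrib sin_squared_eq \<theta>(2)[OF that])
    also have "\<dots> = (norm z)\<^sup>2 - (fst z)\<^sup>2" using that by (simp add: field_simps)
    also have "\<dots> = (snd z)\<^sup>2" by (simp add: norm_prod_def)
    finally have "\<bar>norm z * sin (\<theta> z)\<bar> = \<bar>snd z\<bar>" by (metis power2_eq_iff abs_eq_iff)
    moreover have "norm z * sin (\<theta> z) \<ge> 0" using \<theta>(1)[OF that] sin_ge_zero[of "\<theta> z"] by simp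
    ultimately show ?thesis by simp
  qed
  have c\<theta>: "continuous_on (- {0}) \<theta>"
    unfolding \<theta>_def by (intro continuous_on_arccos continuous_intros) (use b in auto)
  have c: "continuous_on S (\<lambda>z. F (\<theta> z))" if "continuous_on {0..pi} F" "S \<subseteq> - {0}" for F :: "real \<Rightarrow> real" and S
    by (rule continuous_on_compose2[OF that(1) continuous_on_subset[OF c\<theta> that(2)]])
       (use that(2) in \<open>blast intro: \<theta>(1)\<close>)
  have c\<rho>: "continuous_on (- {0}) \<rho>"
    unfolding \<rho>_def
  proof (rule continuous_on_cases_le)
    fix z :: "real \<times> real" assume z: "z \<in> - {0}" "snd z = 0"
    then have "sin (\<theta> z) = 0" using sn[of z] by auto
    then have "\<theta> z = 0 \<or> \<theta> z = pi"
      using \<theta>(1)[of z] z sin_gt_zero[of "\<theta> z"] by (cases "\<theta> z = 0 \<or> \<theta> z = pi") auto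
    then show "R2 (\<theta> z) = R1 (\<theta> z)" using R(3,4) by auto
  qed (auto intro!: c R continuous_intros)
  define A where "A = {z. z \<noteq> 0 \<and> norm z < \<rho> z}"
  define B where "B = {z. z \<noteq> 0 \<and> \<rho> z < norm z}"
  have open_less: "open {z. z \<noteq> 0 \<and> f z < h z}"
    if fh: "continuous_on (- {0}) f" "continuous_on (- {0}) h" for f h :: "real \<times> real \<Rightarrow> real"
  proof -
    obtain O1 where "open O1" "O1 \<inter> - {0} = {z \<in> - {0}. f z < h z}"
      using open_Collect_less_Int[OF fh] by blast
    moreover have "{z. z \<noteq> 0 \<and> f z < h z} = {z \<in> - {0}. f z < h z}" by auto
    ultimately show ?thesis by (metis open_Int open_Compl closed_singleton)
  qed
  have oA: "open A" unfolding A_def by (intro open_less c\<rho> continuous_intros)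
  have oB: "open B" unfolding B_def by (intro open_less c\<rho> continuous_intros)
  obtain m where m: "m > 0" "\<And>t. t \<in> {0..pi} \<Longrightarrow> m \<le> R1 t" "\<And>t. t \<in> {0..pi} \<Longrightarrow> m \<le> R2 t"
  proof -
    obtain s1 where "s1 \<in> {0..pi}" "\<And>t. t \<in> {0..pi} \<Longrightarrow> R1 s1 \<le> R1 t"
      using continuous_attains_inf[of "{0..pi}" R1] R(1) by auto
    moreover obtain s2 where "s2 \<in> {0..pi}" "\<And>t. t \<in> {0..pi} \<Longrightarrow> R2 s2 \<le> R2 t"
      using continuous_attains_inf[of "{0..pi}" R2] R(2) by auto
    ultimately show thesis using that[of "min (R1 s1) (R2 s2)"] pos by (auto simp: min_le_iff_disj)
  qed
  obtain J where J: "\<And>t. t \<in> {0..pi} \<Longrightarrow> R1 t \<le> J" "\<And>t. t \<in> {0..pi} \<Longrightarrow> R2 t \<le> J"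
  proof -
    have "\<exists>x\<in>{0..pi}. \<forall>y\<in>{0..pi}. R1 y \<le> R1 x" "\<exists>x\<in>{0..pi}. \<forall>y\<in>{0..pi}. R2 y \<le> R2 x"
      by (rule continuous_attains_sup; use R in simp)+
    then obtain s1 s2 where "\<forall>y\<in>{0..pi}. R1 y \<le> R1 s1" "\<forall>y\<in>{0..pi}. R2 y \<le> R2 s2" by blast
    then show thesis using that[of "max (R1 s1) (R2 s2)"] by (auto simp: le_max_iff_disj)
  qed
  \<comment> \<open>Directions are meaningless at the origin, so a small ball around it is added by
    hand.\<close>
  define A' where "A' = ball 0 m \<union> A"
  have mA: "norm z < \<rho> z" if "z \<noteq> 0" "norm z < m" for z
    using that m(2,3)[OF \<theta>(1)[OF that(1)]] by (auto simp: \<rho>_def)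
  have disj: "A' \<inter> B = {}"
    unfolding A'_def A_def B_def using mA by fastforce
  have onK: "z \<in> K" if z: "z \<noteq> 0" "norm z = \<rho> z" for z
  proof (cases "snd z \<le> 0")
    case True
    then have "z = (R2 (\<theta> z) * cos (\<theta> z), - (R2 (\<theta> z) * sin (\<theta> z)))"
      using z sn[OF z(1)] \<theta>(2)[OF z(1)] by (auto simp: \<rho>_def prod_eq_iff)
    then show ?thesis unfolding K using \<theta>(1)[OF z(1)] by blast
  next
    case False
    then have "z = (R1 (\<theta> z) * cos (\<theta> z), R1 (\<theta> z) * sin (\<theta> z))"
      using z sn[OF z(1)] \<theta>(2)[OF z(1)] by (auto simp: \<rho>_def prod_eq_iff)
    then show ?thesis unfolding K using \<theta>(1)[OF z(1)] by blast
  qed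
  have z0: "0 \<notin> K"
  proof -
    have nz: "R * cos t \<noteq> 0 \<or> R * sin t \<noteq> 0" if "0 < R" for R t :: real
      using that sin_zero_abs_cos_one[of t] by auto
    show ?thesis
    proof
      assume "0 \<in> K"
      then consider t where "t \<in> {0..pi}" "(0, 0) = (R1 t * cos t, R1 t * sin t)"
        | t where "t \<in> {0..pi}" "(0, 0) = (R2 t * cos t, - (R2 t * sin t))"
        unfolding K zero_prod_def by blast
      then show False
      proof cases
        case (1 t)
        then show False using nz[OF pos(1)[OF 1(1)], of t] by simp
      next
        case (2 t)
        then show False using nz[OF pos(2)[OF 2(1)], of t] by simp
      qed
    qed
  qed
  let ?C = "connected_component_set (- K) 0"
  have "?C \<subseteq> A' \<union> B"
  proof
    fix z assume "z \<in> ?C"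
    then have "z \<notin> K" using connected_component_in by fastforce
    then have "z = 0 \<or> norm z < \<rho> z \<or> \<rho> z < norm z" using onK[of z] by linarith
    then show "z \<in> A' \<union> B" unfolding A'_def A_def B_def using m(1) by auto
  qed
  moreover have "open A'" unfolding A'_def using oA by auto
  moreover have "0 \<in> ?C" "0 \<in> A'" using z0 m(1) by (auto simp: A'_def)
  ultimately have "B \<inter> ?C = {}"
    using connectedD[OF connected_connected_component, of A' B "- K" 0] oB disj by blast
  then have "?C \<subseteq> A'" using \<open>?C \<subseteq> A' \<union> B\<close> by blast
  moreover have "bounded A'"
  proof (rule boundedI)
    fix z assume "z \<in> A'"
    then have "z = 0 \<or> norm z < \<rho> z" unfolding A'_def A_def using mA[of z] by auto
    moreover have "\<rho> z \<le> J" if "z \<noteq> 0" using J[OF \<theta>(1)[OF that]] by (simp add: \<rho>_def)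
    ultimately show "norm z \<le> max J 0" by fastforce
  qed
  ultimately have "bounded ?C" by (meson bounded_subset)
  then show ?thesis using z0 by (simp add: inside_def zero_prod_def)
qed

text \<open>The orbit is glued from the two half arcs. A competing periodic orbit near it has to
  cross the positive axis; its outermost crossing is forced to be a zero of the displacement, and
  within \<open>\<eta>\<close> of \<open>r\<close> there is no other zero.\<close>

lemma cycle_from_zero:
  assumes box: "params_box C p" and r: "0 < r" "r \<le> half_radius C / 200"
    and zero: "half_map (upper_half p) r = half_map (lower_half p) r"
    and iso: "0 < \<eta>" "\<eta> < r" "\<And>x. \<bar>x - r\<bar> < \<eta> \<Longrightarrow> half_map (upper_half p) x = half_map (lower_half p) x \<Longrightarrow> x = r"
  obtains \<Gamma> where "crossing_limit_cycle p \<Gamma>" "(0, 0) \<in> inside \<Gamma>" "\<Gamma> \<subseteq> cball 0 (4 * r)"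
    "\<And>x. 0 < x \<Longrightarrow> (x, 0) \<in> \<Gamma> \<longleftrightarrow> x = r"
proof -
  have b: "half_box C (upper_half p)" "half_box C (lower_half p)"
    using box by (auto simp: params_box_def)
  have \<delta>: "half_radius C > 0" using half_radius_pos[OF b(1)] .
  have r': "r \<le> half_radius C" using r \<delta> by simp
  define S1 S2 where "S1 = half_map (upper_half p)" and "S2 = half_map (lower_half p)"
  define s where "s = S1 r"
  have s: "s = S2 r" "s > 0"
    using zero half_map_bounds(1)[OF b(1) r(1) r'] r(1) by (auto simp: s_def S1_def S2_def)
  obtain T1 \<gamma>1 R1 where U: "T1 > 0" "solves (pw_field p) \<gamma>1 T1" "\<gamma>1 0 = (r, 0)" "\<gamma>1 T1 = (- S1 r, 0)"
    "continuous_on {0..pi} R1" "\<And>t. t \<in> {0..pi} \<Longrightarrow> 0 < R1 t \<and> R1 t \<le> 4 * r" "R1 0 = r" "R1 pi = S1 r"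
    "\<gamma>1 ` {0..T1} = (\<lambda>t. (R1 t * cos t, R1 t * sin t)) ` {0..pi}"
    by (rule pw_upper_arc[OF box r(1) r', folded S1_def]) (rule that)
  obtain T2 \<gamma>2 R2 where V: "T2 > 0" "solves (pw_field p) \<gamma>2 T2" "\<gamma>2 0 = (- S2 r, 0)" "\<gamma>2 T2 = (r, 0)"
    "continuous_on {0..pi} R2" "\<And>t. t \<in> {0..pi} \<Longrightarrow> 0 < R2 t \<and> R2 t \<le> 4 * r" "R2 0 = r" "R2 pi = S2 r"
    "\<gamma>2 ` {0..T2} = (\<lambda>t. (R2 t * cos t, - (R2 t * sin t))) ` {0..pi}"
    by (rule pw_lower_arc[OF box r(1) r', folded S2_def]) (rule that)
  define T \<gamma> where "T = T1 + T2" and "\<gamma> t = (if t \<le> T1 then \<gamma>1 t else \<gamma>2 (t - T1))" for t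
  have j: "\<gamma>1 T1 = \<gamma>2 0" using U(4) V(3) s by (simp add: s_def)
  have \<gamma>: "solves (pw_field p) \<gamma> T"
    unfolding T_def \<gamma>_def using solves_concat[OF U(2) V(2) j] U(1) V(1) by simp
  have "T > 0" using U(1) V(1) by (simp add: T_def)
  moreover have "\<gamma> T = \<gamma> 0" using U(1,3) V(1,4) by (simp add: T_def \<gamma>_def)
  ultimately obtain g where g: "global_solution (pw_field p) g" "\<And>t. g (t + T) = g t" "\<And>t. t \<in> {0..T} \<Longrightarrow> g t = \<gamma> t"
    "range g = \<gamma> ` {0..T}"
    by (rule periodic_extension[OF \<gamma>]) (rule that)
  define \<Gamma> where "\<Gamma> = range g"
  have img: "\<Gamma> = \<gamma>1 ` {0..T1} \<union> \<gamma>2 ` {0..T2}"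
  proof -
    have "{0..T} = {0..T1} \<union> (\<lambda>t. t + T1) ` {0..T2}"
      using U(1) V(1) by (auto simp: T_def image_add_atLeastAtMost)
    then have "\<Gamma> = \<gamma> ` {0..T1} \<union> (\<lambda>t. \<gamma> (t + T1)) ` {0..T2}"
      unfolding \<Gamma>_def g(4) by (simp only: image_Un image_image)
    moreover have "\<gamma> ` {0..T1} = \<gamma>1 ` {0..T1}" by (rule image_cong) (auto simp: \<gamma>_def)
    moreover have "(\<lambda>t. \<gamma> (t + T1)) ` {0..T2} = \<gamma>2 ` {0..T2}"
      by (rule image_cong) (use j in \<open>auto simp: \<gamma>_def\<close>)
    ultimately show ?thesis by simp
  qed
  note K = img[unfolded U(9) V(9)]
  have inside: "(0, 0) \<in> inside \<Gamma>"
    by (rule inside_star_shaped_curve[OF U(5) V(5) _ _ _ _ K]) (use U(6-8) V(6-8) s in \<open>auto simp: s_def\<close>)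
  have nrm: "0 < norm z \<and> norm z \<le> 4 * r" if "z \<in> \<Gamma>" for z
  proof -
    have n: "norm (R * cos t, R * sin t) = R" "norm (R * cos t, - (R * sin t)) = R" if "0 < R" for R t :: real
    proof -
      have "(R * cos t)\<^sup>2 + (R * sin t)\<^sup>2 = R\<^sup>2 * ((sin t)\<^sup>2 + (cos t)\<^sup>2)"
        by (simp only: power_mult_distrib distrib_left add.commute)
      then have "(R * cos t)\<^sup>2 + (R * sin t)\<^sup>2 = R\<^sup>2" by simp
      then show "norm (R * cos t, R * sin t) = R" "norm (R * cos t, - (R * sin t)) = R"
        using that by (simp_all only: norm_Pair real_norm_def power2_abs power2_minus real_sqrt_abs abs_of_pos)
    qed
    from that consider t where "t \<in> {0..pi}" "z = (R1 t * cos t, R1 t * sin t)"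
      | t where "t \<in> {0..pi}" "z = (R2 t * cos t, - (R2 t * sin t))"
      unfolding K by blast
    then show ?thesis
    proof cases
      case 1
      then show ?thesis using U(6)[OF 1(1)] by (simp add: n)
    next
      case 2
      then show ?thesis using V(6)[OF 2(1)] by (simp add: n)
    qed
  qed
  have axis: "(x, 0) \<in> \<Gamma> \<longleftrightarrow> x = r" if x: "0 < x" for x
  proof
    assume "(x, 0) \<in> \<Gamma>"
    then consider t where "t \<in> {0..pi}" "(x, 0) = (R1 t * cos t, R1 t * sin t)"
      | t where "t \<in> {0..pi}" "(x, 0) = (R2 t * cos t, - (R2 t * sin t))"
      unfolding K by blast
    then obtain t where t: "t \<in> {0..pi}" "sin t = 0" and xt: "x = R1 t * cos t \<or> x = R2 t * cos t"
    proof cases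
      case (1 t)
      then show ?thesis using U(6)[OF 1(1)] by (intro that[of t]) auto
    next
      case (2 t)
      then show ?thesis using V(6)[OF 2(1)] by (intro that[of t]) auto
    qed
    have "t = 0 \<or> t = pi"
      using t sin_gt_zero[of t] by (cases "t = 0 \<or> t = pi") auto
    moreover have "t \<noteq> pi" using xt x U(8) V(8) s by (auto simp: s_def)
    ultimately show "x = r" using xt U(7) V(7) by auto
  next
    assume "x = r"
    moreover have "g 0 = (r, 0)" using g(3)[of 0] \<open>T > 0\<close> U(1,3) by (simp add: \<gamma>_def)
    ultimately show "(x, 0) \<in> \<Gamma>" unfolding \<Gamma>_def by (metis rangeI)
  qed
  have rG: "(r, 0) \<in> \<Gamma>" using axis r(1) by blast
  have sG: "(- s, 0) \<in> \<Gamma>" unfolding img using U(1,4) by (auto simp: s_def intro!: image_eqI[of _ _ T1])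
  have per: "periodic_orbit p \<Gamma>"
    unfolding periodic_orbit_def
  proof (rule exI[of _ g], rule exI[of _ T], intro conjI)
    show "\<exists>t. g t \<noteq> g 0"
    proof (rule ccontr)
      assume "\<nexists>t. g t \<noteq> g 0"
      then have "\<Gamma> = {g 0}" unfolding \<Gamma>_def by auto
      then have "(r, 0) = g 0" "(- s, 0) = g 0" using rG sG by blast+
      then have "(r, 0 :: real) = (- s, 0)" by (rule trans[OF _ sym])
      then show False using r(1) s(2) by simp
    qed
  qed (use \<open>T > 0\<close> g(1,2) \<Gamma>_def in \<open>auto simp: global_solution_def\<close>)
  \<comment> \<open>The removed part of the nonnegative axis contains the origin, since
    \<open>\<eta>\<close> < \<open>r\<close>. The divisor 32 keeps the images of crossings under the
    half maps, at most 3/2 times larger, in the range of \<open>half_map_surj\<close>.\<close>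
  define N where "N = ball (0 :: real \<times> real) (half_radius C / 32) - {z. snd z = 0 \<and> 0 \<le> fst z \<and> \<eta> \<le> \<bar>fst z - r\<bar>}"
  have oN: "open N"
    unfolding N_def
    by (intro open_Diff open_ball closed_Collect_conj closed_Collect_eq closed_Collect_le continuous_intros)
  have GN: "\<Gamma> \<subseteq> N"
  proof
    fix z assume z: "z \<in> \<Gamma>"
    have "norm z < half_radius C / 32" using nrm[OF z] r \<delta> by linarith
    moreover have "fst z = r" if "snd z = 0" "0 \<le> fst z"
    proof -
      have "fst z \<noteq> 0" using nrm[OF z] that(1) by (auto simp: norm_prod_def)
      then show ?thesis using axis[of "fst z"] that z by (metis less_eq_real_def prod.collapse)
    qed
    ultimately show "z \<in> N" unfolding N_def using iso(1) by auto
  qed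
  have uniq: "\<Gamma>' = \<Gamma>" if per': "periodic_orbit p \<Gamma>'" and sub: "\<Gamma>' \<subseteq> N" for \<Gamma>'
  proof -
    obtain f T' where f: "T' > 0" "global_solution (pw_field p) f" "\<And>t. f (t + T') = f t" "\<Gamma>' = range f"
      using per' unfolding periodic_orbit_def global_solution_def by blast
    have fN: "f t \<in> N" for t using sub f(4) by auto
    have f0: "f t \<noteq> 0" for t
      using fN[of t] iso(2) by (auto simp: N_def)
    have fsmall: "norm (f t) \<le> half_radius C" for t
      using fN[of t] \<delta> by (auto simp: N_def)
    obtain t0 a0 where a0: "0 < a0" "f t0 = (a0, 0)"
      using global_solution_hits_positive_axis[OF box f(2) fsmall f0] by blast
    have compact: "compact \<Gamma>'"
    proof -
      have "range f = f ` {0..T'}"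
      proof
        show "range f \<subseteq> f ` {0..T'}"
        proof
          fix z assume "z \<in> range f"
          then obtain t where t: "z = f t" by auto
          have shift: "f (u + of_int n * T') = f u" for u and n :: int
          proof (induction n rule: int_induct[where k = 0])
            case (step1 i)
            then show ?case using f(3)[of "u + of_int i * T'"] by (simp add: algebra_simps)
          next
            case (step2 i)
            then show ?case using f(3)[of "u + of_int (i - 1) * T'"] by (simp add: algebra_simps)
          qed simp
          define u where "u = t - of_int \<lfloor>t / T'\<rfloor> * T'"
          have "u \<in> {0..T'}"
            using floor_divide_lower[OF f(1), of t] floor_divide_upper[OF f(1), of t]
            by (simp add: u_def algebra_simps)
          moreover have "f u = f t" using shift[of u "\<lfloor>t / T'\<rfloor>"] by (simp add: u_def)
          ultimately show "z \<in> f ` {0..T'}" using t by (metis imageI)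
        qed
      qed auto
      moreover have "continuous_on {0..T'} f"
        using f(2) unfolding global_solution_def
        by (meson has_vector_derivative_continuous continuous_at_imp_continuous_on)
      ultimately show ?thesis unfolding f(4) by (simp add: compact_continuous_image)
    qed
    \<comment> \<open>Crossings with the nonnegative axis; compactness of the orbit provides an
      outermost one, \<open>a\<close>.\<close>
    define P where "P = \<Gamma>' \<inter> {z. snd z = 0 \<and> 0 \<le> fst z}"
    have "compact P"
      unfolding P_def
      by (intro compact_Int_closed compact closed_Collect_conj closed_Collect_eq closed_Collect_le continuous_intros)
    moreover have "(a0, 0) \<in> P" using a0 f(4) by (auto simp: P_def) (metis rangeI)
    ultimately have "\<exists>z\<in>P. \<forall>w\<in>P. fst w \<le> fst z"
      by (intro continuous_attains_sup continuous_intros) auto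
    then obtain z where z: "z \<in> P" "\<And>w. w \<in> P \<Longrightarrow> fst w \<le> fst z" by blast
    define a where "a = fst z"
    have za: "z = (a, 0)" using z(1) by (auto simp: P_def a_def prod_eq_iff)
    have aG: "(a, 0) \<in> range f" using z(1) za f(4) by (simp add: P_def)
    have amax: "x \<le> a" if "0 \<le> x" "(x, 0) \<in> range f" for x
      using z(2)[of "(x, 0)"] that f(4) by (simp add: P_def a_def)
    have a: "0 < a" using amax[of a0] a0 by (metis less_imp_le less_le_trans rangeI)
    have aN: "(a, 0) \<in> N" using aG fN by auto
    have "\<bar>a - r\<bar> < \<eta>" using aN a by (auto simp: N_def)
    have "a < half_radius C / 32" using aN a by (auto simp: N_def norm_Pair)
    then have a': "a \<le> half_radius C" "a \<le> half_radius C / 8" "3/2 * a \<le> half_radius C / 16" using \<delta> by auto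
    have up: "(x, 0) \<in> range f \<longleftrightarrow> (- S1 x, 0) \<in> range f" if x: "0 < x" "x \<le> half_radius C" for x
    proof -
      obtain T3 \<gamma>3 where "T3 > 0" "solves (pw_field p) \<gamma>3 T3" "\<gamma>3 0 = (x, 0)" "\<gamma>3 T3 = (- S1 x, 0)"
        by (rule pw_upper_arc[OF box x, folded S1_def]) (rule that)
      then show ?thesis using arc_endpoints_in_range[OF pw_field_lipschitz f(2), of \<gamma>3 T3] by simp
    qed
    have low: "(x, 0) \<in> range f \<longleftrightarrow> (- S2 x, 0) \<in> range f" if x: "0 < x" "x \<le> half_radius C" for x
    proof -
      obtain T3 \<gamma>3 where "T3 > 0" "solves (pw_field p) \<gamma>3 T3" "\<gamma>3 0 = (- S2 x, 0)" "\<gamma>3 T3 = (x, 0)"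
        by (rule pw_lower_arc[OF box x, folded S2_def]) (rule that)
      then show ?thesis using arc_endpoints_in_range[OF pw_field_lipschitz f(2), of \<gamma>3 T3] by simp
    qed
    have S1a: "0 < S1 a" "S1 a \<le> half_radius C / 16" and S2a: "0 < S2 a" "S2 a \<le> half_radius C / 16"
      using half_map_bounds[OF b(1) a a'(1)] half_map_bounds[OF b(2) a a'(1)] a a'(3) by (auto simp: S1_def S2_def)
    \<comment> \<open>The orbit also passes through the point \<open>x\<close> with
      \<open>S2 x = S1 a\<close>. As \<open>a\<close> is outermost, x <= a, and \<open>S2\<close> is
      increasing. Exchanging the roles of the halves gives the converse inequality.\<close>
    have "S1 a \<le> S2 a"
    proof -
      obtain x where x: "0 < x" "x \<le> half_radius C / 8" "S2 x = S1 a"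
        by (rule half_map_surj[OF b(2) S1a, folded S2_def]) (rule that)
      have "(x, 0) \<in> range f" using low[of x] x up[OF a a'(1)] aG \<delta> by simp
      then have "x \<le> a" using amax x(1) by simp
      then have "S2 x \<le> S2 a"
        using half_map_strict_mono[OF b(2), of x a] x(1) a'(2) by (cases "x = a") (auto simp: S2_def)
      then show ?thesis using x(3) by simp
    qed
    moreover have "S2 a \<le> S1 a"
    proof -
      obtain x where x: "0 < x" "x \<le> half_radius C / 8" "S1 x = S2 a"
        by (rule half_map_surj[OF b(1) S2a, folded S1_def]) (rule that)
      have "(x, 0) \<in> range f" using up[of x] x low[OF a a'(1)] aG \<delta> by simp
      then have "x \<le> a" using amax x(1) by simp
      then have "S1 x \<le> S1 a"
        using half_map_strict_mono[OF b(1), of x a] x(1) a'(2) by (cases "x = a") (auto simp: S1_def)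
      then show ?thesis using x(3) by simp
    qed
    ultimately have "a = r"
      using iso(3)[OF \<open>\<bar>a - r\<bar> < \<eta>\<close>] by (simp add: S1_def S2_def)
    then have "(r, 0) \<in> range f" using aG by simp
    then obtain t1 where t1: "(r, 0) = f t1" by (rule rangeE)
    from rG obtain t2 where "(r, 0) = g t2" unfolding \<Gamma>_def by (rule rangeE)
    with t1 have "f t1 = g t2" by simp
    from global_solution_range_eq[OF pw_field_lipschitz f(2) g(1) this] show ?thesis
      by (simp add: f(4) \<Gamma>_def)
  qed
  have "crossing_limit_cycle p \<Gamma>"
    unfolding crossing_limit_cycle_def
  proof (intro conjI per exI[of _ N] oN GN allI impI ballI)
    show "\<Gamma>' = \<Gamma>" if "periodic_orbit p \<Gamma>' \<and> \<Gamma>' \<subseteq> N" for \<Gamma>' using uniq that by blast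
    fix z assume z: "z \<in> \<Gamma>" "snd z = 0"
    then obtain x where x: "z = (x, 0)" "x \<noteq> 0" using nrm[OF z(1)] by (cases z) auto
    have "snd (upper_field p z) = x" "snd (lower_field p z) = x" unfolding x(1) by (cases p; simp)+
    then show "0 < snd (upper_field p z) * snd (lower_field p z)" using x(2) by (auto simp: zero_less_mult_iff)
  qed
  moreover have "\<Gamma> \<subseteq> cball 0 (4 * r)" using nrm by auto
  ultimately show thesis by (rule that[OF _ inside _ axis])
qed

section \<open>Dependence on the parameters\<close>

lemma abel_coeffs_continuous:
  "continuous_on ({q. \<bar>fst q\<bar> \<le> 1/64} \<times> {0..pi}) (\<lambda>x. abel1 (fst x) (snd x))"
  "continuous_on ({q. \<bar>fst q\<bar> \<le> 1/64} \<times> {0..pi}) (\<lambda>x. abel2 (fst x) (snd x))"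
  "continuous_on ({q. \<bar>fst q\<bar> \<le> 1/64} \<times> {0..pi}) (\<lambda>x. abel3 (fst x) (snd x))"
proof -
  let ?S = "{q :: half_params. \<bar>fst q\<bar> \<le> 1/64} \<times> {0..pi}"
  have A: "polar_A q t = cos t * (fst (snd q) * (cos t)\<^sup>2 + fst (snd (snd q)) * cos t * sin t
      + (fst (snd (snd (snd q))) - snd (snd (snd (snd q)))) * (sin t)\<^sup>2)" for q t
    by (cases q) simp
  have B: "polar_B q t = sin t * ((fst (snd q) + snd (snd (snd (snd q)))) * (cos t)\<^sup>2 + fst (snd (snd q)) * cos t * sin t
      + fst (snd (snd (snd q))) * (sin t)\<^sup>2)" for q t
    by (cases q) simp
  have B': "polar_B' q t = (fst (snd q) + snd (snd (snd (snd q)))) * (cos t * (cos t)\<^sup>2 - 2 * (cos t * (sin t)\<^sup>2))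
     + fst (snd (snd q)) * (2 * ((cos t)\<^sup>2 * sin t) - sin t * (sin t)\<^sup>2)
     + fst (snd (snd (snd q))) * (3 * ((sin t)\<^sup>2 * cos t))" for q t
    by (cases q) simp
  have D: "polar_D q t = 1 - fst q * (cos t * sin t)" "polar_D' q t = - fst q * ((cos t)\<^sup>2 - (sin t)\<^sup>2)" for q t
    by (cases q, simp)+
  have c: "continuous_on ?S (\<lambda>x. polar_A (fst x) (snd x))" "continuous_on ?S (\<lambda>x. polar_B (fst x) (snd x))"
    "continuous_on ?S (\<lambda>x. polar_B' (fst x) (snd x))" "continuous_on ?S (\<lambda>x. polar_D (fst x) (snd x))"
    "continuous_on ?S (\<lambda>x. polar_D' (fst x) (snd x))"
    unfolding A B B' D by (intro continuous_intros)+
  have nz: "polar_D (fst x) (snd x) \<noteq> 0" if "x \<in> ?S" for x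
  proof -
    have "\<bar>fst (fst x) * (cos (snd x) * sin (snd x))\<bar> \<le> 1/64 * (1 * 1)"
      using that by (intro abs_mult_le abs_cos_le_one abs_sin_le_one) auto
    then show ?thesis unfolding D by auto
  qed
  show "continuous_on ?S (\<lambda>x. abel1 (fst x) (snd x))" "continuous_on ?S (\<lambda>x. abel2 (fst x) (snd x))"
    "continuous_on ?S (\<lambda>x. abel3 (fst x) (snd x))"
    unfolding abel1_def abel2_def abel3_def by (intro continuous_intros c ballI nz; assumption)+
qed

text \<open>A tube argument over the compact interval [0, pi] makes the coefficients uniformly close
  in the angle, and \<open>abel_sol_dependence\<close> converts this into closeness uniform in
  \<open>\<rho>\<close>.\<close>

lemma half_sol_dependence:
  assumes box: "half_box C q0" and "e > 0"
  obtains X where "open X" "q0 \<in> X"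
    "\<And>q \<rho>. q \<in> X \<Longrightarrow> half_box C q \<Longrightarrow> norm \<rho> \<le> half_radius C \<Longrightarrow> norm (half_sol q pi \<rho> - half_sol q0 pi \<rho>) \<le> e"
proof -
  let ?U = "{q :: half_params. \<bar>fst q\<bar> \<le> 1/64}"
  have inU: "half_box C q \<Longrightarrow> q \<in> ?U" for q by (cases q) auto
  have e: "e / 16 > 0" using assms by simp
  obtain X1 where X1: "q0 \<in> X1" "open X1" "\<forall>x\<in>X1 \<inter> ?U. \<forall>t\<in>{0..pi}. dist (abel1 (fst (x, t)) (snd (x, t))) (abel1 (fst (q0, t)) (snd (q0, t))) \<le> e / 16"
    by (rule continuous_on_prod_compactE[OF abel_coeffs_continuous(1) _ inU[OF box] e]) auto
  obtain X2 where X2: "q0 \<in> X2" "open X2" "\<forall>x\<in>X2 \<inter> ?U. \<forall>t\<in>{0..pi}. dist (abel2 (fst (x, t)) (snd (x, t))) (abel2 (fst (q0, t)) (snd (q0, t))) \<le> e / 16"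
    by (rule continuous_on_prod_compactE[OF abel_coeffs_continuous(2) _ inU[OF box] e]) auto
  obtain X3 where X3: "q0 \<in> X3" "open X3" "\<forall>x\<in>X3 \<inter> ?U. \<forall>t\<in>{0..pi}. dist (abel3 (fst (x, t)) (snd (x, t))) (abel3 (fst (q0, t)) (snd (q0, t))) \<le> e / 16"
    by (rule continuous_on_prod_compactE[OF abel_coeffs_continuous(3) _ inU[OF box] e]) auto
  show thesis
  proof (rule that[of "X1 \<inter> X2 \<inter> X3"])
    fix q \<rho> assume q: "q \<in> X1 \<inter> X2 \<inter> X3" "half_box C q" and \<rho>: "norm (\<rho> :: complex) \<le> half_radius C"
    have "norm (half_sol q pi \<rho> - half_sol q0 pi \<rho>) \<le> 16 * (e / 16)"
      unfolding half_sol_def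
    proof (rule abel_sol_dependence[OF abel_half[OF q(2)] abel_half[OF box]])
      fix t assume t: "t \<in> {0..pi}"
      show "\<bar>abel1 q t - abel1 q0 t\<bar> \<le> e / 16" "\<bar>abel2 q t - abel2 q0 t\<bar> \<le> e / 16" "\<bar>abel3 q t - abel3 q0 t\<bar> \<le> e / 16"
        using X1(3) X2(3) X3(3) q(1) inU[OF q(2)] t unfolding dist_real_def fst_conv snd_conv by blast+
    qed (use \<rho> in \<open>auto simp: half_radius_def\<close>)
    then show "norm (half_sol q pi \<rho> - half_sol q0 pi \<rho>) \<le> e" by simp
  qed (use X1 X2 X3 in auto)
qed

lemma halves_continuous:
  "continuous_on UNIV upper_half" "continuous_on UNIV lower_half"
proof -
  have eqs: "upper_half = (\<lambda>p. (fst p, fst (snd p), fst (snd (snd p)), fst (snd (snd (snd (snd p)))), 1))"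
    "lower_half = (\<lambda>p. (- fst p, - fst (snd p), fst (snd (snd (snd p))), - snd (snd (snd (snd (snd p)))), - 1))"
    by (auto intro!: ext)
  show "continuous_on UNIV upper_half" unfolding eqs(1) by (intro continuous_intros)
  show "continuous_on UNIV lower_half" unfolding eqs(2) by (intro continuous_intros)
qed

lemma disp_quot_dependence:
  assumes box: "params_box C p0" and "e > 0"
  obtains X where "open X" "p0 \<in> X"
    "\<And>p \<rho>. p \<in> X \<Longrightarrow> params_box C p \<Longrightarrow> norm \<rho> \<le> half_radius C \<Longrightarrow> norm (disp_quot p \<rho> - disp_quot p0 \<rho>) \<le> e"
proof -
  have b: "half_box C (upper_half p0)" "half_box C (lower_half p0)" using box by (auto simp: params_box_def)
  have e: "e / 2 > 0" using assms by simp
  obtain X1 where X1: "open X1" "upper_half p0 \<in> X1"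
    "\<And>q \<rho>. q \<in> X1 \<Longrightarrow> half_box C q \<Longrightarrow> norm \<rho> \<le> half_radius C \<Longrightarrow> norm (half_sol q pi \<rho> - half_sol (upper_half p0) pi \<rho>) \<le> e / 2"
    by (rule half_sol_dependence[OF b(1) e]) (rule that)
  obtain X2 where X2: "open X2" "lower_half p0 \<in> X2"
    "\<And>q \<rho>. q \<in> X2 \<Longrightarrow> half_box C q \<Longrightarrow> norm \<rho> \<le> half_radius C \<Longrightarrow> norm (half_sol q pi \<rho> - half_sol (lower_half p0) pi \<rho>) \<le> e / 2"
    by (rule half_sol_dependence[OF b(2) e]) (rule that)
  show thesis
  proof (rule that[of "upper_half -` X1 \<inter> lower_half -` X2"])
    show "open (upper_half -` X1 \<inter> lower_half -` X2)"
      using halves_continuous X1(1) X2(1) by (intro open_Int open_vimage) auto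
    fix p \<rho> assume p: "p \<in> upper_half -` X1 \<inter> lower_half -` X2" "params_box C p" and \<rho>: "norm (\<rho> :: complex) \<le> half_radius C"
    have 1: "norm (half_sol (upper_half p) pi \<rho> - half_sol (upper_half p0) pi \<rho>) \<le> e / 2"
      by (rule X1(3)) (use p \<rho> in \<open>auto simp: params_box_def\<close>)
    have 2: "norm (half_sol (lower_half p) pi \<rho> - half_sol (lower_half p0) pi \<rho>) \<le> e / 2"
      by (rule X2(3)) (use p \<rho> in \<open>auto simp: params_box_def\<close>)
    have "disp_quot p \<rho> - disp_quot p0 \<rho> = (half_sol (lower_half p) pi \<rho> - half_sol (lower_half p0) pi \<rho>)
       - (half_sol (upper_half p) pi \<rho> - half_sol (upper_half p0) pi \<rho>)" by (simp add: disp_quot_def)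
    also have "norm \<dots> \<le> e / 2 + e / 2" by (rule order_trans[OF norm_triangle_ineq4 add_mono[OF 2 1]])
    finally show "norm (disp_quot p \<rho> - disp_quot p0 \<rho>) \<le> e" by simp
  qed (use X1 X2 in auto)
qed

lemma params_box_neighbourhood:
  assumes "fst p0 = 0"
  obtains C X where "open X" "p0 \<in> X" "\<And>p. p \<in> X \<Longrightarrow> params_box C p"
proof -
  obtain l0 m1 m2 n1 n2 where p0: "p0 = (0, l0, m1, m2, n1, n2)" using assms by (cases p0) auto
  define C where "C = 2 + \<bar>l0\<bar> + \<bar>m1\<bar> + \<bar>m2\<bar> + \<bar>n1\<bar> + \<bar>n2\<bar>"
  define X where "X = {p :: params. \<bar>fst p\<bar> < 1/64 \<and> \<bar>fst (snd p)\<bar> < C \<and> \<bar>fst (snd (snd p))\<bar> < C \<and>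
    \<bar>fst (snd (snd (snd p)))\<bar> < C \<and> \<bar>fst (snd (snd (snd (snd p))))\<bar> < C \<and> \<bar>snd (snd (snd (snd (snd p))))\<bar> < C}"
  show thesis
  proof (rule that[of X C])
    show "open X" unfolding X_def by (intro open_Collect_conj open_Collect_less continuous_intros)
    show "p0 \<in> X" unfolding X_def p0 C_def by (simp; intro conjI; linarith)
    have C: "1 \<le> C" by (simp add: C_def)
    show "params_box C p" if "p \<in> X" for p
      using that C by (cases p) (simp add: X_def params_box_def)
  qed
qed

text \<open>At rho = 0 the equation is linear and W \<open>polar_D\<close> has derivative D cos^2 W.
  Hence D W \<open>polar_D\<close> increases from D at angle 0 to D W at angle pi.\<close>

lemma half_sol_at_0_sign:
  assumes box: "half_box C q" and D: "fst q \<noteq> 0"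
  shows "fst q * (Re (half_sol q pi 0) - 1) > 0"
proof -
  have \<delta>: "half_radius C > 0" using half_radius_pos[OF box] .
  define D where "D = fst q"
  define W where "W t = Re (half_sol q t 0)" for t
  define v where "v t = D * (W t * polar_D q t)" for t
  have W: "W t \<ge> 1/2" if "t \<in> {0..pi}" for t
    using half_sol_Re_bounds(1)[OF box that, of 0] \<delta> by (simp add: W_def)
  have dW: "(W has_real_derivative abel1 q t * W t) (at t within {0..pi})" if "t \<in> {0..pi}" for t
    using half_sol_deriv[OF box that, of 0] \<delta> by (simp add: W_def[abs_def])
  have dv: "(v has_real_derivative D\<^sup>2 * (cos t)\<^sup>2 * W t) (at t within {0..pi})" if t: "t \<in> {0..pi}" for t
  proof -
    have "polar_D q t \<noteq> 0" using polar_bounds(5)[OF box, of t] by simp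
    then have "D * (abel1 q t * W t * polar_D q t + polar_D' q t * W t) = D\<^sup>2 * (cos t)\<^sup>2 * W t"
      by (simp add: abel1_def D_def field_simps power2_eq_square)
    with DERIV_cmult[OF DERIV_mult[OF dW[OF t] polar_deriv(2)[of q]], of D]
    show ?thesis unfolding v_def by simp
  qed
  have mvt: "\<exists>z. a < z \<and> z < b \<and> v b - v a = (b - a) * (D\<^sup>2 * (cos z)\<^sup>2 * W z)" if "0 \<le> a" "a < b" "b \<le> pi" for a b
  proof -
    have "\<exists>z\<in>{a<..<b}. v b - v a = (\<lambda>h. h * (D\<^sup>2 * (cos z)\<^sup>2 * W z)) (b - a)"
    proof (rule mvt_simple[OF that(2)])
      fix u assume "a \<le> u" "u \<le> b"
      then have "(v has_real_derivative D\<^sup>2 * (cos u)\<^sup>2 * W u) (at u within {a..b})"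
        using that by (intro DERIV_subset[OF dv]) auto
      then show "(v has_derivative (\<lambda>h. h * (D\<^sup>2 * (cos u)\<^sup>2 * W u))) (at u within {a..b})"
        by (simp add: has_field_derivative_def mult_commute_abs)
    qed
    then show ?thesis by auto
  qed
  \<comment> \<open>Splitting at pi / 4 keeps the intermediate point away from the zero of the
    cosine at pi / 2, so that the first increment is strict.\<close>
  obtain z1 where z1: "0 < z1" "z1 < pi / 4" "v (pi / 4) - v 0 = (pi / 4 - 0) * (D\<^sup>2 * (cos z1)\<^sup>2 * W z1)"
    using mvt[of 0 "pi / 4"] by auto
  have "cos z1 > 0" using z1 by (intro cos_gt_zero) auto
  then have 1: "v (pi / 4) - v 0 > 0" unfolding z1(3)
    using W[of z1] z1 D by (intro mult_pos_pos) (auto simp: D_def)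
  obtain z2 where z2: "pi / 4 < z2" "z2 < pi" "v pi - v (pi / 4) = (pi - pi / 4) * (D\<^sup>2 * (cos z2)\<^sup>2 * W z2)"
    using mvt[of "pi / 4" pi] by auto
  have 2: "v pi - v (pi / 4) \<ge> 0" unfolding z2(3)
    using W[of z2] z2 by (intro mult_nonneg_nonneg) auto
  have "v 0 = D" "v pi = D * W pi"
    using half_sol_0[OF box, of 0] \<delta> by (cases q; simp add: v_def W_def)+
  then show ?thesis using 1 2 by (simp add: D_def W_def algebra_simps)
qed

text \<open>The lower half system carries the parameter -d, so both solutions contribute to the
  quotient with the sign opposite to d.\<close>

lemma disp_quot_at_0_sign:
  assumes "params_box C p" "fst p \<noteq> 0"
  shows "fst p * Re (disp_quot p 0) < 0"
proof -
  have b: "half_box C (upper_half p)" "half_box C (lower_half p)" using assms(1) by (auto simp: params_box_def)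
  have "fst (upper_half p) = fst p" "fst (lower_half p) = - fst p" by (cases p; simp)+
  then show ?thesis
    using half_sol_at_0_sign[OF b(1)] half_sol_at_0_sign[OF b(2)] assms(2) by (simp add: disp_quot_def algebra_simps)
qed

text \<open>Cauchy's inequality for the third derivative of the difference on a disc of radius
  \<open>\<delta> / 2\<close>, which still lies in the domain; the 6 is the factorial of 3.\<close>

lemma deriv3_stability:
  assumes hol: "f holomorphic_on ball 0 \<delta>" "g holomorphic_on ball 0 \<delta>" and "\<delta> > 0"
    and close: "\<And>z. norm z < \<delta> \<Longrightarrow> norm (g z - f z) \<le> e" and x: "norm x \<le> \<delta> / 4"
  shows "norm ((deriv ^^ 3) g x - (deriv ^^ 3) f x) \<le> 6 * e / (\<delta> / 2) ^ 3"
proof -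
  have sub: "cball x (\<delta> / 2) \<subseteq> ball 0 \<delta>"
  proof
    fix z assume "z \<in> cball x (\<delta> / 2)"
    then have "norm (z - x) \<le> \<delta> / 2" by (simp add: dist_norm norm_minus_commute)
    then have "norm z \<le> \<delta> / 2 + \<delta> / 4" using norm_triangle_ineq[of "z - x" x] x by simp
    then show "z \<in> ball 0 \<delta>" using \<open>\<delta> > 0\<close> by simp
  qed
  have xb: "x \<in> ball 0 \<delta>" using x \<open>\<delta> > 0\<close> by simp
  have "norm ((deriv ^^ 3) (\<lambda>w. g w - f w) x) \<le> fact 3 * e / (\<delta> / 2) ^ 3"
  proof (rule Cauchy_inequality)
    show "(\<lambda>w. g w - f w) holomorphic_on ball x (\<delta> / 2)"
      using sub ball_subset_cball by (intro holomorphic_intros holomorphic_on_subset[OF hol(1)] holomorphic_on_subset[OF hol(2)]) blast+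
    show "continuous_on (cball x (\<delta> / 2)) (\<lambda>w. g w - f w)"
      by (intro continuous_intros holomorphic_on_imp_continuous_on holomorphic_on_subset[OF hol(1) sub] holomorphic_on_subset[OF hol(2) sub])
    fix z assume "norm (x - z) = \<delta> / 2"
    then have "z \<in> cball x (\<delta> / 2)" by (simp add: dist_norm)
    then have "norm z < \<delta>" using sub by auto
    then show "norm (g z - f z) \<le> e" by (rule close)
  qed (use \<open>\<delta> > 0\<close> in simp)
  moreover have "(deriv ^^ 3) (\<lambda>w. g w - f w) x = (deriv ^^ 3) g x - (deriv ^^ 3) f x"
    by (rule higher_deriv_diff[OF hol(2,1) open_ball xb])
  ultimately show ?thesis by (simp add: fact_numeral)
qed

text \<open>Rolle's theorem puts two zeros of the first derivative strictly between the three zeros.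
  A multiple zero would add a third one, and two further applications would give a zero of the third
  derivative.\<close>

lemma three_zeros_simple:
  fixes F :: "nat \<Rightarrow> real \<Rightarrow> real"
  assumes der: "\<And>k x. 0 < x \<Longrightarrow> x < b \<Longrightarrow> (F k has_real_derivative F (Suc k) x) (at x)"
    and F3: "\<And>x. 0 < x \<Longrightarrow> x < b \<Longrightarrow> F 3 x \<noteq> 0"
    and z: "0 < x" "x < y" "y < z" "z < b" "F 0 x = 0" "F 0 y = 0" "F 0 z = 0"
  shows "F 1 x \<noteq> 0" "F 1 y \<noteq> 0" "F 1 z \<noteq> 0"
proof -
  have rolle: "\<exists>w. u < w \<and> w < v \<and> F (Suc k) w = 0" if "0 < u" "u < v" "v < b" "F k u = 0" "F k v = 0" for k u v
  proof -
    have "\<exists>w. u < w \<and> w < v \<and> F k v - F k u = (v - u) * F (Suc k) w"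
      by (rule MVT2[OF that(2)]) (use that in \<open>auto intro!: der\<close>)
    then show ?thesis using that by auto
  qed
  have no3: False if h: "0 < u" "u < v" "v < w" "w < b" "F 1 u = 0" "F 1 v = 0" "F 1 w = 0" for u v w
  proof -
    obtain s where s: "u < s" "s < v" "F (Suc 1) s = 0" using rolle[of u v 1] h by auto
    obtain t where t: "v < t" "t < w" "F (Suc 1) t = 0" using rolle[of v w 1] h by auto
    obtain r where "s < r" "r < t" "F (Suc (Suc 1)) r = 0" using rolle[of s t "Suc 1"] h s t by auto
    then show False using F3[of r] h s t by (simp add: numeral_3_eq_3)
  qed
  obtain s where s: "x < s" "s < y" "F 1 s = 0" using rolle[of x y 0] z by auto
  obtain t where t: "y < t" "t < z" "F 1 t = 0" using rolle[of y z 0] z by auto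
  show "F 1 x \<noteq> 0" using no3[of x s t] z s t by auto
  show "F 1 y \<noteq> 0" using no3[of s y t] z s t by auto
  show "F 1 z \<noteq> 0" using no3[of s t z] z s t by auto
qed

section \<open>Small perturbations and signs\<close>

lemma path_enters_open:
  fixes h :: "real \<Rightarrow> params"
  assumes "open V" "h 0 \<in> V" "continuous_on UNIV h"
  obtains \<epsilon> where "\<epsilon> > 0" "\<And>t. \<bar>t\<bar> < \<epsilon> \<Longrightarrow> h t \<in> V"
proof -
  have "open (h -` V)" by (rule open_vimage[OF assms(1)]) (use assms(3) in auto)
  then obtain \<epsilon> where "\<epsilon> > 0" "ball 0 \<epsilon> \<subseteq> h -` V" using assms(2) by (meson openE vimageI2)
  then show thesis using that[of \<epsilon>] by (auto simp: subset_iff dist_real_def)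
qed

lemma limit_sign:
  fixes f :: "real \<Rightarrow> real"
  assumes "((\<lambda>r. f r / r ^ j) \<longlongrightarrow> c) (at_right 0)" "s * c > 0" "b > 0"
  obtains r where "0 < r" "r < b" "s * f r > 0"
proof -
  have "((\<lambda>r. s * (f r / r ^ j)) \<longlongrightarrow> s * c) (at_right 0)" by (intro tendsto_intros assms(1))
  from order_tendstoD(1)[OF this assms(2)]
  have "\<forall>\<^sub>F r in at_right 0. 0 < s * (f r / r ^ j) \<and> r < b \<and> 0 < r"
    using eventually_at_right_less[of 0] assms(3)
    by (intro eventually_conj) (auto simp: eventually_at_right_field)
  then obtain r where r: "0 < s * (f r / r ^ j)" "r < b" "0 < r"
    using eventually_happens[of _ "at_right (0::real)"] by auto
  then have "s * f r > 0" by (simp add: zero_less_divide_iff zero_less_mult_iff)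
  with r that show thesis by blast
qed

section \<open>Unfolding\<close>

lemma isCont_Re_of_real_0:
  assumes "f holomorphic_on ball 0 \<delta>" "\<delta> > 0"
  shows "isCont (\<lambda>x. Re (f (of_real x))) 0"
proof -
  have "continuous_on {- \<delta><..<\<delta>} (\<lambda>x. f (of_real x))"
    by (rule continuous_on_compose2[OF holomorphic_on_imp_continuous_on[OF assms(1)]]) (auto intro!: continuous_intros)
  then have "continuous_on {- \<delta><..<\<delta>} (\<lambda>x. Re (f (of_real x)))" by (intro continuous_intros)
  then show ?thesis using assms(2) by (simp add: continuous_on_eq_continuous_at)
qed

lemma displacement_deriv:
  assumes "params_box C p" "0 < x" "x < half_radius C"
  defines "F \<equiv> \<lambda>k x. Re ((deriv ^^ k) (disp_quot p) (of_real x))"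
  shows "(F k has_real_derivative F (Suc k) x) (at x)"
    and "(displacement p has_real_derivative F 0 x + x * F 1 x) (at x)"
proof -
  have dF: "(F k has_real_derivative F (Suc k) x) (at x)" for k
  proof -
    have "(deriv ^^ k) (disp_quot p) holomorphic_on ball 0 (half_radius C)"
      by (intro holomorphic_higher_deriv disp_quot_holomorphic assms(1)) simp
    then have "((deriv ^^ k) (disp_quot p) has_field_derivative (deriv ^^ Suc k) (disp_quot p) (of_real x)) (at (of_real x))"
      using assms(2,3) by (auto intro: holomorphic_derivI)
    from bounded_linear.has_vector_derivative[OF bounded_linear_Re has_vector_derivative_real_field[OF this]]
    show ?thesis unfolding F_def by (simp add: has_real_derivative_iff_has_vector_derivative)
  qed
  then show "(F k has_real_derivative F (Suc k) x) (at x)" .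
  have "((\<lambda>x. x * F 0 x) has_real_derivative 1 * F 0 x + F (Suc 0) x * x) (at x)"
    by (rule DERIV_mult[OF DERIV_ident dF])
  then have "(displacement p has_real_derivative 1 * F 0 x + F (Suc 0) x * x) (at x)"
  proof (rule has_field_derivative_transform_within_open[where S = "{0<..<half_radius C}"])
    show "y * F 0 y = displacement p y" if "y \<in> {0<..<half_radius C}" for y
      using displacement_eq(3)[OF assms(1), of y] that by (simp add: F_def)
  qed (use assms(2,3) in auto)
  then show "(displacement p has_real_derivative F 0 x + x * F 1 x) (at x)" by (simp add: mult.commute)
qed

text \<open>The difference quotient at \<open>r\<close> has a nonzero limit; this single fact
  supplies both the isolation of the zero and its multiplicity 1.\<close>

lemma simple_zero_cycle:
  assumes box: "params_box C p" and r: "0 < r" "r \<le> half_radius C / 200"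
    and zero: "displacement p r = 0" and simple: "(displacement p has_real_derivative D) (at r)" "D \<noteq> 0"
  obtains \<Gamma> where "crossing_limit_cycle p \<Gamma>" "(0, 0) \<in> inside \<Gamma>" "\<Gamma> \<subseteq> cball 0 (4 * r)"
    "\<And>x. 0 < x \<Longrightarrow> (x, 0) \<in> \<Gamma> \<longleftrightarrow> x = r" "cycle_mult p \<Gamma> 1"
proof -
  have \<delta>: "half_radius C > 0" using box half_radius_pos unfolding params_box_def by blast
  have lim: "((\<lambda>\<rho>. displacement p \<rho> / (\<rho> - r) ^ 1) \<longlongrightarrow> D) (at r)"
    using simple(1) zero unfolding has_field_derivative_iff by simp
  have "\<forall>\<^sub>F \<rho> in at r. displacement p \<rho> / (\<rho> - r) ^ 1 \<noteq> 0"
    using tendsto_imp_eventually_ne[OF lim simple(2)] .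
  then obtain \<eta>0 where \<eta>0: "\<eta>0 > 0" "\<And>x. x \<noteq> r \<Longrightarrow> \<bar>x - r\<bar> < \<eta>0 \<Longrightarrow> displacement p x \<noteq> 0"
    unfolding eventually_at dist_real_def by auto
  define \<eta> where "\<eta> = min \<eta>0 (r / 2)"
  have eq: "displacement p x = half_map (lower_half p) x - half_map (upper_half p) x" if "0 < x" "x \<le> half_radius C" for x
    by (rule displacement_eq(2)[OF box that])
  have r': "r \<le> half_radius C" using r \<delta> by simp
  obtain \<Gamma> where \<Gamma>: "crossing_limit_cycle p \<Gamma>" "(0, 0) \<in> inside \<Gamma>" "\<Gamma> \<subseteq> cball 0 (4 * r)"
    "\<And>x. 0 < x \<Longrightarrow> (x, 0) \<in> \<Gamma> \<longleftrightarrow> x = r"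
  proof (rule cycle_from_zero[OF box r])
    show "half_map (upper_half p) r = half_map (lower_half p) r" using eq[OF r(1) r'] zero by simp
    show "0 < \<eta>" "\<eta> < r" using \<eta>0(1) r(1) by (auto simp: \<eta>_def)
    show "x = r" if x: "\<bar>x - r\<bar> < \<eta>" "half_map (upper_half p) x = half_map (lower_half p) x" for x
    proof (rule ccontr)
      assume "x \<noteq> r"
      then have "displacement p x \<noteq> 0" using \<eta>0(2)[of x] x(1) by (simp add: \<eta>_def)
      moreover have "0 < x" "x \<le> half_radius C" using x(1) r \<delta> unfolding \<eta>_def by linarith+
      ultimately show False using eq[of x] x(2) by simp
    qed
  qed (rule that)
  have "\<forall>\<^sub>F \<rho> in nhds r. \<rho> \<in> {0<..<half_radius C}"
    using r \<delta> by (intro eventually_nhds_in_open) auto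
  then have "\<forall>\<^sub>F \<rho> in nhds r. displacement_defined p \<rho>"
    by (rule eventually_mono) (use displacement_eq(1)[OF box] in auto)
  then have "displacement_zero_mult p r 1"
    unfolding displacement_zero_mult_def using zero lim simple(2) by auto
  then have "cycle_mult p \<Gamma> 1"
    unfolding cycle_mult_def using r(1) \<Gamma>(4) by blast
  with \<Gamma> show thesis by (rule that)
qed

lemma sign_change_zero:
  assumes box: "params_box C p" and ab: "0 < a" "a < b" "b < half_radius C"
    and "s * displacement p a > 0" "s * displacement p b < 0"
  obtains z where "a < z" "z < b" "displacement p z = 0"
proof -
  have "continuous_on {a..b} (\<lambda>x. - (s * displacement p x))"
    using ab by (intro continuous_intros continuous_at_imp_continuous_on ballI DERIV_isCont[OF displacement_deriv(2)[OF box]]) auto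
  then obtain z where z: "a \<le> z" "z \<le> b" "- (s * displacement p z) = 0"
    using IVT'[of "\<lambda>x. - (s * displacement p x)" a 0 b] assms by auto
  have "z \<noteq> a" "z \<noteq> b" "s \<noteq> 0" using z assms by auto
  then show thesis using that[of z] z by auto
qed

lemma sign_persists:
  assumes "open V" "p0 \<in> V" "\<And>p. p \<in> V \<Longrightarrow> params_box C p" and x: "0 < x" "x \<le> half_radius C"
    and pos: "s * displacement p0 x > 0"
  obtains V' where "open V'" "p0 \<in> V'" "V' \<subseteq> V" "\<And>p. p \<in> V' \<Longrightarrow> s * displacement p x > 0"
proof -
  \<comment> \<open>Chosen so that an error \<open>e\<close> in \<open>disp_quot\<close> changes
    \<open>s\<close> times the displacement at \<open>x\<close> by at most half of its
    value.\<close>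
  define e where "e = s * displacement p0 x / (2 * (\<bar>s\<bar> * x))"
  have s: "s \<noteq> 0" using pos by auto
  then have e: "e > 0" using pos x by (simp add: e_def)
  obtain X where X: "open X" "p0 \<in> X"
    "\<And>p \<rho>. p \<in> X \<Longrightarrow> params_box C p \<Longrightarrow> norm \<rho> \<le> half_radius C \<Longrightarrow> norm (disp_quot p \<rho> - disp_quot p0 \<rho>) \<le> e"
    by (rule disp_quot_dependence[OF assms(3)[OF assms(2)] e]) (rule that)
  show thesis
  proof (rule that[of "V \<inter> X"])
    fix p assume p: "p \<in> V \<inter> X"
    have "norm (disp_quot p (of_real x) - disp_quot p0 (of_real x)) \<le> e"
      using X(3)[of p "of_real x"] assms(3) p x by simp
    then have "\<bar>Re (disp_quot p (of_real x)) - Re (disp_quot p0 (of_real x))\<bar> \<le> e"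
      using abs_Re_le_cmod[of "disp_quot p (of_real x) - disp_quot p0 (of_real x)"] by simp
    then have "\<bar>(s * x) * (Re (disp_quot p (of_real x)) - Re (disp_quot p0 (of_real x)))\<bar> \<le> (\<bar>s\<bar> * x) * e"
      using x by (intro abs_mult_le) (auto simp: abs_mult)
    also have "\<dots> = s * displacement p0 x / 2" using s x by (simp add: e_def)
    finally have "\<bar>s * displacement p x - s * displacement p0 x\<bar> \<le> s * displacement p0 x / 2"
      using displacement_eq(3)[OF assms(3) x, of p] displacement_eq(3)[OF assms(3) x, of p0] p assms(2)
      by (simp add: algebra_simps)
    then show "s * displacement p x > 0" using pos by linarith
  qed (use assms(1,2) X in auto)
qed

lemma Tc_unfolds:
  assumes "p0 \<in> Tc"
  shows "unfolds_cycles p0 3"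
  unfolding unfolds_cycles_def
proof (intro allI impI)
  fix U :: "(real \<times> real) set" and V :: "params set"
  assume UV: "open U \<and> (0, 0) \<in> U \<and> open V \<and> p0 \<in> V"
  obtain l m n1 n2 where p0: "p0 = (0, l, m, m, n1, n2)" and T: "2 * l + n1 + n2 = 0" "m * (n1 - n2) * (n1 + n2 - 1) \<noteq> 0"
    using assms unfolding Tc_def by auto
  define c where "c = 4/45 * m * (n2 - n1) * (n1 + n2 - 1)"
  have c: "c \<noteq> 0" "m \<noteq> 0" using T(2) by (auto simp: c_def)
  have lim0: "((\<lambda>r. displacement p0 r / r ^ 4) \<longlongrightarrow> c) (at_right 0)"
    unfolding p0 c_def by (rule displacement_leading(3)[OF refl T(1)])
  obtain C X0 where X0: "open X0" "p0 \<in> X0" "\<And>p. p \<in> X0 \<Longrightarrow> params_box C p"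
    by (rule params_box_neighbourhood[of p0]) (auto simp: p0)
  have box0: "params_box C p0" using X0 by blast
  define \<delta> where "\<delta> = half_radius C"
  have \<delta>: "\<delta> > 0" using box0 half_radius_pos unfolding params_box_def \<delta>_def by blast
  define F where "F p k x = Re ((deriv ^^ k) (disp_quot p) (of_real x))" for p k and x :: real
  \<comment> \<open>The coefficient W_4 is the third Taylor coefficient of the quotient, so its
    third derivative at 0 is 6 times W_4.\<close>
  have F30: "F p0 3 0 = 6 * c"
  proof -
    obtain \<epsilon> where e: "\<epsilon> > 0" "\<And>r. 0 < r \<Longrightarrow> r < \<epsilon> \<Longrightarrow>
        (\<lambda>k. (case k of 0 \<Rightarrow> 0 | Suc n \<Rightarrow> Re ((deriv ^^ n) (disp_quot p0) 0 / fact n)) * r ^ k) sums displacement p0 r"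
      using displacement_series_taylor[OF box0] unfolding displacement_series_def by auto
    have "(case 4 of 0 \<Rightarrow> 0 | Suc n \<Rightarrow> Re ((deriv ^^ n) (disp_quot p0) 0 / fact n)) = c"
      by (rule power_series_leading_coeff(2)[OF e(1) _ lim0]) (rule e(2))
    moreover have "(4 :: nat) = Suc 3" "fact 3 = (6 :: complex)" by (simp_all add: fact_numeral)
    ultimately have "Re ((deriv ^^ 3) (disp_quot p0) 0 / 6) = c" by (simp only: nat.case)
    then show ?thesis by (simp add: F_def)
  qed
  have "isCont (F p0 3) 0"
    unfolding F_def
    by (rule isCont_Re_of_real_0[OF holomorphic_higher_deriv[OF disp_quot_holomorphic[OF box0]]])
       (use \<delta> in \<open>simp_all add: \<delta>_def\<close>)
  then obtain b0 where b0: "b0 > 0" "\<And>x. \<bar>x\<bar> < b0 \<Longrightarrow> \<bar>F p0 3 x - 6 * c\<bar> < \<bar>c\<bar>"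
    using c(1) F30 unfolding continuous_at_eps_delta dist_real_def
    by (metis diff_zero zero_less_abs_iff)
  obtain u where u: "u > 0" "ball 0 u \<subseteq> U"
    using UV by (metis openE zero_prod_def)
  \<comment> \<open>The three bounds serve, in turn, the third derivative at \<open>p0\<close>, the
    radius required by \<open>cycle_from_zero\<close>, and containment in \<open>U\<close> of the
    cycles, which lie within distance 4 b of the origin.\<close>
  define b where "b = min (min b0 (\<delta> / 200)) (u / 4)"
  have b: "0 < b" "b \<le> b0" "b \<le> \<delta> / 200" "4 * b \<le> u" using b0(1) \<delta> u(1) by (auto simp: b_def)
  \<comment> \<open>Makes the bound of \<open>deriv3_stability\<close> equal to |c|, so that on
    \<open>V0\<close> the third derivative stays within 2 |c| of 6 c.\<close>
  define e where "e = \<bar>c\<bar> * (\<delta> / 2) ^ 3 / 6"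
  have e: "e > 0" using c(1) \<delta> by (simp add: e_def)
  obtain X1 where X1: "open X1" "p0 \<in> X1"
    "\<And>p \<rho>. p \<in> X1 \<Longrightarrow> params_box C p \<Longrightarrow> norm \<rho> \<le> half_radius C \<Longrightarrow> norm (disp_quot p \<rho> - disp_quot p0 \<rho>) \<le> e"
    by (rule disp_quot_dependence[OF box0 e]) (rule that)
  define V0 where "V0 = V \<inter> X0 \<inter> X1"
  have V0: "open V0" "p0 \<in> V0" "\<And>p. p \<in> V0 \<Longrightarrow> params_box C p" using UV X0 X1 by (auto simp: V0_def)
  have F3: "F p 3 x \<noteq> 0" if p: "p \<in> V0" and x: "0 < x" "x < b" for p x
  proof -
    have "norm ((deriv ^^ 3) (disp_quot p) (of_real x) - (deriv ^^ 3) (disp_quot p0) (of_real x)) \<le> 6 * e / (\<delta> / 2) ^ 3"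
    proof (rule deriv3_stability)
      show "disp_quot p0 holomorphic_on ball 0 \<delta>" "disp_quot p holomorphic_on ball 0 \<delta>"
        unfolding \<delta>_def using V0(3)[OF p] box0 by (auto intro: disp_quot_holomorphic)
      show "norm (disp_quot p z - disp_quot p0 z) \<le> e" if "norm z < \<delta>" for z
        using X1(3)[of p z] p V0(3)[OF p] that by (simp add: V0_def \<delta>_def)
    qed (use \<delta> x b in auto)
    also have "\<dots> = \<bar>c\<bar>" using \<delta> by (simp add: e_def)
    finally have "\<bar>F p 3 x - F p0 3 x\<bar> \<le> \<bar>c\<bar>"
      unfolding F_def using abs_Re_le_cmod[of "(deriv ^^ 3) (disp_quot p) (of_real x) - (deriv ^^ 3) (disp_quot p0) (of_real x)"]
      by simp
    moreover have "\<bar>F p0 3 x - 6 * c\<bar> < \<bar>c\<bar>" using b0(2)[of x] x b by simp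
    ultimately show ?thesis using c(1) by linarith
  qed
  \<comment> \<open>This sign normalizes the construction: the displacement is made to have the
    signs s, -s, s, -s at points x1 > x2 > x3 > x4.\<close>
  define s where "s = sgn c"
  have s: "s * c > 0" "s * s = 1" "s \<noteq> 0" using c(1) by (auto simp: s_def sgn_if)
  have b\<delta>: "b \<le> half_radius C" using b \<delta> by (simp add: \<delta>_def)

  obtain x1 where x1: "0 < x1" "x1 < b" "s * displacement p0 x1 > 0"
    by (rule limit_sign[OF lim0 s(1) b(1)]) (rule that)
  obtain V1 where V1: "open V1" "p0 \<in> V1" "V1 \<subseteq> V0" "\<And>p. p \<in> V1 \<Longrightarrow> s * displacement p x1 > 0"
    by (rule sign_persists[OF V0 _ _ x1(3)]) (use x1 b\<delta> that in auto)

  \<comment> \<open>Moving \<open>l\<close> by t s m gives W_3 = - s m^2 t pi / 4, of sign -s. The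
    parameter is fixed before \<open>x2\<close> is chosen, and all later perturbations stay in a
    neighbourhood where the earlier signs persist.\<close>
  define h1 where "h1 t = (0 :: real, l + t * (s * m), m, m, n1, n2)" for t
  obtain \<epsilon>1 where "\<epsilon>1 > 0" "\<And>t. \<bar>t\<bar> < \<epsilon>1 \<Longrightarrow> h1 t \<in> V1"
    by (rule path_enters_open[OF V1(1), of h1]) (use V1(2) in \<open>auto simp: h1_def p0 intro!: continuous_intros\<close>)
  then obtain t1 where t1: "t1 > 0" "h1 t1 \<in> V1" by (metis abs_of_pos field_lbound_gt_zero less_trans dense)
  define l1 where "l1 = l + t1 * (s * m)"
  define p1 where "p1 = (0 :: real, l1, m, m, n1, n2)"
  have p1: "p1 \<in> V1" using t1(2) by (simp add: h1_def p1_def l1_def)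
  have lim1: "((\<lambda>r. displacement p1 r / r ^ 3) \<longlongrightarrow> - (m * pi * (2 * l1 + n1 + n2) / 8)) (at_right 0)"
    unfolding p1_def by (rule displacement_leading(2)[OF refl])
  have "(- s) * - (m * pi * (2 * l1 + n1 + n2) / 8) = (s * s) * (m * m) * (t1 * pi / 4)"
  proof -
    have "2 * l1 + n1 + n2 = 2 * t1 * (s * m)" using T(1) by (simp add: l1_def)
    then show ?thesis by (simp only:) (simp add: field_simps)
  qed
  also have "\<dots> > 0" using s(2) c(2) t1(1) by (auto simp: zero_less_mult_iff)
  finally have s1: "(- s) * - (m * pi * (2 * l1 + n1 + n2) / 8) > 0" .
  obtain x2 where x2: "0 < x2" "x2 < x1" "(- s) * displacement p1 x2 > 0"
    by (rule limit_sign[OF lim1 s1 x1(1)]) (rule that)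
  have V1b: "\<And>p. p \<in> V1 \<Longrightarrow> params_box C p" using V0(3) V1(3) by blast
  obtain V2 where V2: "open V2" "p1 \<in> V2" "V2 \<subseteq> V1" "\<And>p. p \<in> V2 \<Longrightarrow> (- s) * displacement p x2 > 0"
    by (rule sign_persists[OF V1(1) p1 V1b _ _ x2(3)]) (use x1 x2 b\<delta> that in auto)

  \<comment> \<open>Moving only the first of the two equal parameters by -t s gives W_2 = 2/3 t s,
    of sign s.\<close>
  define h2 where "h2 t = (0 :: real, l1, m + t * (- s), m, n1, n2)" for t
  obtain \<epsilon>2 where "\<epsilon>2 > 0" "\<And>t. \<bar>t\<bar> < \<epsilon>2 \<Longrightarrow> h2 t \<in> V2"
    by (rule path_enters_open[OF V2(1), of h2]) (use V2(2) in \<open>auto simp: h2_def p1_def intro!: continuous_intros\<close>)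
  then obtain t2 where t2: "t2 > 0" "h2 t2 \<in> V2" by (metis abs_of_pos field_lbound_gt_zero less_trans dense)
  define m1 where "m1 = m + t2 * (- s)"
  define p2 where "p2 = (0 :: real, l1, m1, m, n1, n2)"
  have p2: "p2 \<in> V2" using t2(2) by (simp add: h2_def p2_def m1_def)
  have lim2: "((\<lambda>r. displacement p2 r / r ^ 2) \<longlongrightarrow> 2/3 * (m - m1)) (at_right 0)"
    unfolding p2_def by (rule displacement_leading(1))
  have "s * (2/3 * (m - m1)) = (s * s) * (2/3 * t2)" by (simp add: m1_def)
  also have "\<dots> > 0" using s(2) t2(1) by simp
  finally have s2: "s * (2/3 * (m - m1)) > 0" .
  obtain x3 where x3: "0 < x3" "x3 < x2" "s * displacement p2 x3 > 0"
    by (rule limit_sign[OF lim2 s2 x2(1)]) (rule that)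
  have V2b: "\<And>p. p \<in> V2 \<Longrightarrow> params_box C p" using V1b V2(3) by blast
  obtain V3 where V3: "open V3" "p2 \<in> V3" "V3 \<subseteq> V2" "\<And>p. p \<in> V3 \<Longrightarrow> s * displacement p x3 > 0"
    by (rule sign_persists[OF V2(1) p2 V2b _ _ x3(3)]) (use x1 x2 x3 b\<delta> that in auto)

  \<comment> \<open>The trace parameter d = t s gives W_1 the sign -s, by
    \<open>disp_quot_at_0_sign\<close>.\<close>
  define h3 where "h3 t = (t * s, l1, m1, m, n1, n2)" for t
  obtain \<epsilon>3 where "\<epsilon>3 > 0" "\<And>t. \<bar>t\<bar> < \<epsilon>3 \<Longrightarrow> h3 t \<in> V3"
    by (rule path_enters_open[OF V3(1), of h3]) (use V3(2) in \<open>auto simp: h3_def p2_def intro!: continuous_intros\<close>)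
  then obtain t3 where t3: "t3 > 0" "h3 t3 \<in> V3" by (metis abs_of_pos field_lbound_gt_zero less_trans dense)
  define q where "q = h3 t3"
  have q3: "q \<in> V3" using t3(2) by (simp add: q_def)
  have q0: "q \<in> V0" using q3 V1(3) V2(3) V3(3) by blast
  have qbox: "params_box C q" by (rule V0(3)[OF q0])
  have fq: "fst q = t3 * s" by (simp add: q_def h3_def)
  have "t3 * (s * Re (disp_quot q 0)) < 0"
    using disp_quot_at_0_sign[OF qbox] t3(1) s(3) unfolding fq by (simp add: mult.assoc)
  then have "s * Re (disp_quot q 0) < 0" using t3(1) by (simp add: mult_less_0_iff)
  then have s3: "(- s) * Re (disp_quot q 0) > 0" by simp
  have "((\<lambda>r. displacement q r / r ^ 1) \<longlongrightarrow> Re (disp_quot q 0)) (at_right 0)"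
  proof (rule Lim_transform_eventually)
    have "isCont (\<lambda>x. Re (disp_quot q (of_real x))) 0"
      using isCont_Re_of_real_0[OF disp_quot_holomorphic[OF qbox]] \<delta> by (simp add: \<delta>_def)
    then have "((\<lambda>x. Re (disp_quot q (of_real x))) \<longlongrightarrow> Re (disp_quot q (of_real 0))) (at 0)" by (simp add: isCont_def)
    then show "((\<lambda>x. Re (disp_quot q (of_real x))) \<longlongrightarrow> Re (disp_quot q 0)) (at_right 0)"
      by (simp add: filterlim_at_split)
    show "\<forall>\<^sub>F r in at_right 0. Re (disp_quot q (of_real r)) = displacement q r / r ^ 1"
      unfolding eventually_at_right_field
      using \<delta> displacement_eq(3)[OF qbox] by (intro exI[of _ \<delta>]) (auto simp: \<delta>_def)
  qed
  from limit_sign[OF this s3 x3(1)]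
  obtain x4 where x4: "0 < x4" "x4 < x3" "(- s) * displacement q x4 > 0" by blast
  have signs: "s * displacement q x1 > 0" "(- s) * displacement q x2 > 0" "s * displacement q x3 > 0"
    using V1(4) V2(4) V3(4) V2(3) V3(3) q3 by blast+
  obtain z1 where z1: "x4 < z1" "z1 < x3" "displacement q z1 = 0"
    by (rule sign_change_zero[OF qbox x4(1,2) _ x4(3)]) (use signs x1 x2 x3 b \<delta> that in \<open>auto simp: \<delta>_def\<close>)
  obtain z2 where z2: "x3 < z2" "z2 < x2" "displacement q z2 = 0"
    by (rule sign_change_zero[OF qbox x3(1,2) _ signs(3)]) (use signs x1 x2 x3 b \<delta> that in \<open>auto simp: \<delta>_def\<close>)
  obtain z3 where z3: "x2 < z3" "z3 < x1" "displacement q z3 = 0"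
    by (rule sign_change_zero[OF qbox x2(1,2) _ signs(2)]) (use signs x1 x2 x3 b \<delta> that in \<open>auto simp: \<delta>_def\<close>)
  have z: "0 < z1" "z1 < z2" "z2 < z3" "z3 < b" using z1 z2 z3 x1 x4 by auto
  have F0: "F q 0 x = 0" if "0 < x" "x < b" "displacement q x = 0" for x
    using displacement_eq(3)[OF qbox that(1)] that b\<delta> by (simp add: F_def)
  have dF: "(F q k has_real_derivative F q (Suc k) x) (at x)" if "0 < x" "x < b" for k x
    unfolding F_def using displacement_deriv(1)[OF qbox that(1)] that b\<delta> by simp
  have F1: "F q 1 z1 \<noteq> 0" "F q 1 z2 \<noteq> 0" "F q 1 z3 \<noteq> 0"
    using three_zeros_simple[of b "F q", OF dF F3[OF q0] z] F0 z z1(3) z2(3) z3(3) by auto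
  have cyc: "\<exists>\<Gamma>. crossing_limit_cycle q \<Gamma> \<and> (0, 0) \<in> inside \<Gamma> \<and> \<Gamma> \<subseteq> U \<and> (\<forall>x>0. (x, 0) \<in> \<Gamma> \<longleftrightarrow> x = r) \<and> cycle_mult q \<Gamma> 1"
    if r: "0 < r" "r < b" "displacement q r = 0" "F q 1 r \<noteq> 0" for r
  proof -
    have d: "(displacement q has_real_derivative F q 0 r + r * F q 1 r) (at r)"
      unfolding F_def using displacement_deriv(2)[OF qbox r(1)] r(2) b\<delta> by simp
    obtain \<Gamma> where \<Gamma>: "crossing_limit_cycle q \<Gamma>" "(0, 0) \<in> inside \<Gamma>" "\<Gamma> \<subseteq> cball 0 (4 * r)"
      "\<And>x. 0 < x \<Longrightarrow> (x, 0) \<in> \<Gamma> \<longleftrightarrow> x = r" "cycle_mult q \<Gamma> 1"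
    proof (rule simple_zero_cycle[OF qbox r(1) _ r(3) d])
      show "r \<le> half_radius C / 200" using r(2) b(3) by (simp add: \<delta>_def)
      show "F q 0 r + r * F q 1 r \<noteq> 0" using F0[OF r(1-3)] r(1,4) by simp
    qed (rule that)
    have "cball 0 (4 * r) \<subseteq> ball (0 :: real \<times> real) u" using r(2) b(4) by auto
    then have "\<Gamma> \<subseteq> U" using \<Gamma>(3) u(2) by blast
    with \<Gamma> show ?thesis by blast
  qed
  have "0 < z2" "0 < z3" "z1 < b" "z2 < b" using z by auto
  obtain \<Gamma>1 where \<Gamma>1: "crossing_limit_cycle q \<Gamma>1" "(0, 0) \<in> inside \<Gamma>1" "\<Gamma>1 \<subseteq> U" "\<forall>x>0. (x, 0) \<in> \<Gamma>1 \<longleftrightarrow> x = z1" "cycle_mult q \<Gamma>1 1"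
    using cyc[OF z(1) \<open>z1 < b\<close> z1(3) F1(1)] by blast
  obtain \<Gamma>2 where \<Gamma>2: "crossing_limit_cycle q \<Gamma>2" "(0, 0) \<in> inside \<Gamma>2" "\<Gamma>2 \<subseteq> U" "\<forall>x>0. (x, 0) \<in> \<Gamma>2 \<longleftrightarrow> x = z2" "cycle_mult q \<Gamma>2 1"
    using cyc[OF \<open>0 < z2\<close> \<open>z2 < b\<close> z2(3) F1(2)] by blast
  obtain \<Gamma>3 where \<Gamma>3: "crossing_limit_cycle q \<Gamma>3" "(0, 0) \<in> inside \<Gamma>3" "\<Gamma>3 \<subseteq> U" "\<forall>x>0. (x, 0) \<in> \<Gamma>3 \<longleftrightarrow> x = z3" "cycle_mult q \<Gamma>3 1"
    using cyc[OF \<open>0 < z3\<close> z(4) z3(3) F1(3)] by blast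
  have "(z1, 0) \<in> \<Gamma>1" "(z1, 0) \<notin> \<Gamma>2" "(z1, 0) \<notin> \<Gamma>3" "(z2, 0) \<in> \<Gamma>2" "(z2, 0) \<notin> \<Gamma>3"
    using \<Gamma>1(4) \<Gamma>2(4) \<Gamma>3(4) z \<open>0 < z2\<close> by auto
  then have ne: "\<Gamma>1 \<noteq> \<Gamma>2" "\<Gamma>1 \<noteq> \<Gamma>3" "\<Gamma>2 \<noteq> \<Gamma>3" by auto
  have "has_cycles_in q U 3"
    unfolding has_cycles_in_def
  proof (intro exI conjI)
    show "finite {\<Gamma>1, \<Gamma>2, \<Gamma>3}" by simp
    show "\<forall>\<Gamma>\<in>{\<Gamma>1, \<Gamma>2, \<Gamma>3}. crossing_limit_cycle q \<Gamma> \<and> \<Gamma> \<subseteq> U \<and> (0, 0) \<in> inside \<Gamma> \<and> cycle_mult q \<Gamma> ((\<lambda>_. 1) \<Gamma>)"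
      using \<Gamma>1 \<Gamma>2 \<Gamma>3 by blast
    show "(\<Sum>\<Gamma>\<in>{\<Gamma>1, \<Gamma>2, \<Gamma>3}. (\<lambda>_. 1) \<Gamma>) = (3 :: nat)" using ne by simp
  qed
  moreover have "q \<in> V" using q0 by (simp add: V0_def)
  ultimately show "\<exists>q\<in>V. has_cycles_in q U 3" by blast
qed

theorem proposition4p1:
  shows "(\<exists>p. weak_focus_of_order p 4)
       \<and> (\<forall>p q. weak_focus_of_order p q \<longrightarrow> q \<le> 4)
       \<and> (\<forall>p\<in>Tc. weak_focus_of_order p 4)
       \<and> (\<forall>p\<in>Tc. unfolds_cycles p 3)"
proof -
  \<comment> \<open>A point showing that \<open>Tc\<close> is nonempty; the product in its
    definition has the value 2 here.\<close>
  have "(0, - 1, 1, 1, 2, 0) \<in> Tc" by (simp add: Tc_def)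
  then show ?thesis
    using Tc_weak_focus_4 weak_focus_order_le_4 Tc_unfolds by blast
qed

end
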